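(* Let $\mathscr{Y}$ be the Young lattice, let $k$ be a field, let $\|\bullet\|$ be the sum norm on $\mathrm{Ob}(\mathscr{Y})$, and let $V$ be a $\mathscr{Y}$-module over $k$. If $s\geqslant 2$ and $\mathrm{hd}_{s-1}(V)>0$, then \[ \mathrm{hd}_s(V)\leqslant \mathrm{hd}_{s-1}(V)\,\bigl(\ln(\mathrm{hd}_{s-1}(V))+1\bigr). \] In particular, the category of $\mathscr{Y}$-modules presented in finite degrees (the full subcategory of $\mathscr{Y}\text{-Mod}$ on these modules) is abelian.
   Context: The Young lattice $\mathscr{Y}$ is the poset of weakly decreasing sequences $\mathbf{x}=(x_1\geqslant x_2\geqslant\cdots)$ of natural numbers (including $0$) with all but finitely many entries $0$, ordered by $\mathbf{x}\leqslant\mathbf{y}$ iff $x_i\leqslant y_i$ for all $i$; it is viewed as a category with exactly one morphism $\mathbf{x}\to\mathbf{y}$ if $\mathbf{x}\leqslant\mathbf{y}$ and none otherwise. A $\mathscr{Y}$-module over $k$ is a covariant functor $V:\mathscr{Y}\to k\text{-Mod}$, with value $V_{\mathbf{x}}$ at $\mathbf{x}$. Let $k\mathscr{Y}$ be the category (incidence) algebra, regard $V$ as the $k\mathscr{Y}$-module $\bigoplus_{\mathbf{x}}V_{\mathbf{x}}$, and let $\mathfrak{I}$ be the two-sided ideal of $k\mathscr{Y}$ spanned by all morphisms $\mathbf{x}\to\mathbf{y}$ with $\mathbf{x}\neq\mathbf{y}$. Put $H_i(V)=\mathrm{Tor}_i^{k\mathscr{Y}}(k\mathscr{Y}/\mathfrak{I},V)$,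 a $\mathscr{Y}$-module; in particular $H_0(V)_{\mathbf{x}}\cong V_{\mathbf{x}}/\sum_{\mathbf{y}<\mathbf{x}}\mathrm{im}(V_{\mathbf{y}}\to V_{\mathbf{x}})$, and the $H_i$ are the left derived functors of $H_0$. The sum norm is $\|\mathbf{x}\|=\sum_i x_i$. The $i$-th homological degree is $\mathrm{hd}_i(V)=\sup\{\|\mathbf{x}\| : H_i(V)_{\mathbf{x}}\neq 0\}\in\{-1\}\cup\mathbb{N}\cup\{\infty\}$, with value $-1$ if the set is empty (if $\mathrm{hd}_{s-1}(V)=\infty$ the right-hand side of the inequality is $\infty$). $V$ is presented in finite degrees if $\mathrm{hd}_0(V)$ and $\mathrm{hd}_1(V)$ are both finite (i.e. $<\infty$). *)

theory Defs
  imports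
    "HOL-Algebra.Module"
    "HOL-Algebra.AbelCoset"
    "HOL-Library.FuncSet"
    "HOL-Library.Extended_Real"
begin

section \<open>Abelian categories\<close>

text \<open>
  Categories are given by hom-sets, which need not be disjoint; the composition
  \<open>ccomp C X Y Z g f\<close> of \<open>f : X \<rightarrow> Y\<close> and \<open>g : Y \<rightarrow> Z\<close> therefore takes the objects as arguments.
\<close>

record ('o, 'a) preadd_cat =
  cobj  :: "'o set"
  chom  :: "'o \<Rightarrow> 'o \<Rightarrow> 'a set"
  cid   :: "'o \<Rightarrow> 'a"
  ccomp :: "'o \<Rightarrow> 'o \<Rightarrow> 'o \<Rightarrow> 'a \<Rightarrow> 'a \<Rightarrow> 'a"
  czero :: "'o \<Rightarrow> 'o \<Rightarrow> 'a"
  cplus :: "'o \<Rightarrow> 'o \<Rightarrow> 'a \<Rightarrow> 'a \<Rightarrow> 'a"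

locale preadditive_category =
  fixes C :: "('o, 'a) preadd_cat"
  assumes id_closed: "X \<in> cobj C \<Longrightarrow> cid C X \<in> chom C X X"
    and comp_closed:
      "\<lbrakk>X \<in> cobj C; Y \<in> cobj C; Z \<in> cobj C; f \<in> chom C X Y; g \<in> chom C Y Z\<rbrakk>
        \<Longrightarrow> ccomp C X Y Z g f \<in> chom C X Z"
    and comp_id_right:
      "\<lbrakk>X \<in> cobj C; Y \<in> cobj C; f \<in> chom C X Y\<rbrakk> \<Longrightarrow> ccomp C X X Y f (cid C X) = f"
    and comp_id_left:
      "\<lbrakk>X \<in> cobj C; Y \<in> cobj C; f \<in> chom C X Y\<rbrakk> \<Longrightarrow> ccomp C X Y Y (cid C Y) f = f"
    and comp_assoc:
      "\<lbrakk>W \<in> cobj C; X \<in> cobj C; Y \<in> cobj C; Z \<in> cobj C;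
        f \<in> chom C W X; g \<in> chom C X Y; h \<in> chom C Y Z\<rbrakk>
        \<Longrightarrow> ccomp C W Y Z h (ccomp C W X Y g f) = ccomp C W X Z (ccomp C X Y Z h g) f"
    and hom_comm_group:
      "\<lbrakk>X \<in> cobj C; Y \<in> cobj C\<rbrakk>
        \<Longrightarrow> comm_group \<lparr>carrier = chom C X Y, mult = cplus C X Y, one = czero C X Y\<rparr>"
    and comp_plus_right:
      "\<lbrakk>X \<in> cobj C; Y \<in> cobj C; Z \<in> cobj C;
        f \<in> chom C X Y; f' \<in> chom C X Y; g \<in> chom C Y Z\<rbrakk>
        \<Longrightarrow> ccomp C X Y Z g (cplus C X Y f f')
            = cplus C X Z (ccomp C X Y Z g f) (ccomp C X Y Z g f')"
    and comp_plus_left: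
      "\<lbrakk>X \<in> cobj C; Y \<in> cobj C; Z \<in> cobj C;
        f \<in> chom C X Y; g \<in> chom C Y Z; g' \<in> chom C Y Z\<rbrakk>
        \<Longrightarrow> ccomp C X Y Z (cplus C Y Z g g') f
            = cplus C X Z (ccomp C X Y Z g f) (ccomp C X Y Z g' f)"

definition is_zero_object :: "('o, 'a) preadd_cat \<Rightarrow> 'o \<Rightarrow> bool" where
  "is_zero_object C Z \<longleftrightarrow> Z \<in> cobj C \<and>
     (\<forall>X\<in>cobj C. (\<exists>!f. f \<in> chom C X Z) \<and> (\<exists>!f. f \<in> chom C Z X))"

definition is_monic :: "('o, 'a) preadd_cat \<Rightarrow> 'o \<Rightarrow> 'o \<Rightarrow> 'a \<Rightarrow> bool" where
  "is_monic C X Y f \<longleftrightarrow>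
     (\<forall>T\<in>cobj C. \<forall>u\<in>chom C T X. \<forall>v\<in>chom C T X.
        ccomp C T X Y f u = ccomp C T X Y f v \<longrightarrow> u = v)"

definition is_epic :: "('o, 'a) preadd_cat \<Rightarrow> 'o \<Rightarrow> 'o \<Rightarrow> 'a \<Rightarrow> bool" where
  "is_epic C X Y f \<longleftrightarrow>
     (\<forall>T\<in>cobj C. \<forall>u\<in>chom C Y T. \<forall>v\<in>chom C Y T.
        ccomp C X Y T u f = ccomp C X Y T v f \<longrightarrow> u = v)"

definition is_kernel ::
    "('o, 'a) preadd_cat \<Rightarrow> 'o \<Rightarrow> 'o \<Rightarrow> 'a \<Rightarrow> 'o \<Rightarrow> 'a \<Rightarrow> bool" where
  "is_kernel C X Y f N i \<longleftrightarrow> N \<in> cobj C \<and> i \<in> chom C N X \<and>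
     ccomp C N X Y f i = czero C N Y \<and>
     (\<forall>T\<in>cobj C. \<forall>t\<in>chom C T X. ccomp C T X Y f t = czero C T Y \<longrightarrow>
        (\<exists>!u. u \<in> chom C T N \<and> ccomp C T N X i u = t))"

definition is_cokernel ::
    "('o, 'a) preadd_cat \<Rightarrow> 'o \<Rightarrow> 'o \<Rightarrow> 'a \<Rightarrow> 'o \<Rightarrow> 'a \<Rightarrow> bool" where
  "is_cokernel C X Y f Q p \<longleftrightarrow> Q \<in> cobj C \<and> p \<in> chom C Y Q \<and>
     ccomp C X Y Q p f = czero C X Q \<and>
     (\<forall>T\<in>cobj C. \<forall>t\<in>chom C Y T. ccomp C X Y T t f = czero C X T \<longrightarrow>
        (\<exists>!u. u \<in> chom C Q T \<and> ccomp C Y Q T u p = t))"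

definition is_biproduct ::
    "('o, 'a) preadd_cat \<Rightarrow> 'o \<Rightarrow> 'o \<Rightarrow> 'o \<Rightarrow> 'a \<Rightarrow> 'a \<Rightarrow> 'a \<Rightarrow> 'a \<Rightarrow> bool" where
  "is_biproduct C X Y B i j p q \<longleftrightarrow> B \<in> cobj C \<and>
     i \<in> chom C X B \<and> j \<in> chom C Y B \<and> p \<in> chom C B X \<and> q \<in> chom C B Y \<and>
     ccomp C X B X p i = cid C X \<and> ccomp C Y B Y q j = cid C Y \<and>
     ccomp C Y B X p j = czero C Y X \<and> ccomp C X B Y q i = czero C X Y \<and>
     cplus C B B (ccomp C B X B i p) (ccomp C B Y B j q) = cid C B"

locale abelian_category = preadditive_category C for C :: "('o, 'a) preadd_cat" +
  assumes has_zero_object: "\<exists>Z. is_zero_object C Z"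
    and has_biproducts:
      "\<lbrakk>X \<in> cobj C; Y \<in> cobj C\<rbrakk> \<Longrightarrow> \<exists>B i j p q. is_biproduct C X Y B i j p q"
    and has_kernels:
      "\<lbrakk>X \<in> cobj C; Y \<in> cobj C; f \<in> chom C X Y\<rbrakk> \<Longrightarrow> \<exists>N i. is_kernel C X Y f N i"
    and has_cokernels:
      "\<lbrakk>X \<in> cobj C; Y \<in> cobj C; f \<in> chom C X Y\<rbrakk> \<Longrightarrow> \<exists>Q p. is_cokernel C X Y f Q p"
    and monic_normal:
      "\<lbrakk>X \<in> cobj C; Y \<in> cobj C; f \<in> chom C X Y; is_monic C X Y f\<rbrakk>
        \<Longrightarrow> \<exists>Z\<in>cobj C. \<exists>g\<in>chom C Y Z. is_kernel C Y Z g X f"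
    and epic_normal:
      "\<lbrakk>X \<in> cobj C; Y \<in> cobj C; f \<in> chom C X Y; is_epic C X Y f\<rbrakk>
        \<Longrightarrow> \<exists>Z\<in>cobj C. \<exists>g\<in>chom C Z X. is_cokernel C Z X g Y f"

definition full_subcategory ::
    "('o, 'a) preadd_cat \<Rightarrow> ('o \<Rightarrow> bool) \<Rightarrow> ('o, 'a) preadd_cat" where
  "full_subcategory C P = C\<lparr>cobj := {X \<in> cobj C. P X}\<rparr>"


section \<open>The Young lattice\<close>

text \<open>Sequences are indexed from \<open>0\<close>.\<close>

typedef young = "{x :: nat \<Rightarrow> nat. antimono x \<and> finite {i. x i \<noteq> 0}}"
  morphisms part Abs_young
  by (rule exI[of _ "\<lambda>_. 0"]) (simp add: antimono_def)

instantiation young :: order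
begin

definition less_eq_young :: "young \<Rightarrow> young \<Rightarrow> bool" where
  "x \<le> y \<longleftrightarrow> (\<forall>i. part x i \<le> part y i)"

definition less_young :: "young \<Rightarrow> young \<Rightarrow> bool" where
  "(x :: young) < y \<longleftrightarrow> x \<le> y \<and> x \<noteq> y"

instance
proof
  fix x y z :: young
  show "x \<le> x"
    by (simp add: less_eq_young_def)
  show "x \<le> y \<Longrightarrow> y \<le> z \<Longrightarrow> x \<le> z"
    by (meson less_eq_young_def order_trans)
  show antisym: "x \<le> y \<Longrightarrow> y \<le> x \<Longrightarrow> x = y"
    by (simp add: less_eq_young_def part_inject[symmetric] fun_eq_iff order_antisym)
  show "x < y \<longleftrightarrow> x \<le> y \<and> \<not> y \<le> x"
    using antisym by (auto simp: less_young_def less_eq_young_def)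
qed

end

definition sum_norm :: "young \<Rightarrow> nat" where
  "sum_norm x = (\<Sum>i | part x i \<noteq> 0. part x i)"


section \<open>Modules over the Young lattice\<close>

definition linear_map ::
    "('k, 'c) ring_scheme \<Rightarrow> ('k, 'v) module \<Rightarrow> ('k, 'w) module \<Rightarrow> ('v \<Rightarrow> 'w) \<Rightarrow> bool" where
  "linear_map K M N f \<longleftrightarrow> f \<in> carrier M \<rightarrow> carrier N \<and>
     (\<forall>u\<in>carrier M. \<forall>v\<in>carrier M. f (u \<oplus>\<^bsub>M\<^esub> v) = f u \<oplus>\<^bsub>N\<^esub> f v) \<and>
     (\<forall>a\<in>carrier K. \<forall>v\<in>carrier M. f (a \<odot>\<^bsub>M\<^esub> v) = a \<odot>\<^bsub>N\<^esub> f v)"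

text \<open>
  \<open>yob V x\<close> is the value at \<open>x\<close>, and \<open>ytr V x y\<close> is the map induced by the morphism \<open>x \<rightarrow> y\<close>;
  it is meaningful only for \<open>x \<le> y\<close> and on the carrier of \<open>yob V x\<close>.
\<close>

record ('k, 'v) ymodule =
  yob :: "young \<Rightarrow> ('k, 'v) module"
  ytr :: "young \<Rightarrow> young \<Rightarrow> 'v \<Rightarrow> 'v"

definition young_module :: "('k, 'c) ring_scheme \<Rightarrow> ('k, 'v) ymodule \<Rightarrow> bool" where
  "young_module K V \<longleftrightarrow>
     (\<forall>x. Module.module K (yob V x)) \<and>
     (\<forall>x y. x \<le> y \<longrightarrow> linear_map K (yob V x) (yob V y) (ytr V x y)) \<and>
     (\<forall>x. \<forall>v\<in>carrier (yob V x). ytr V x x v = v) \<and>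
     (\<forall>x y z. x \<le> y \<longrightarrow> y \<le> z \<longrightarrow>
        (\<forall>v\<in>carrier (yob V x). ytr V y z (ytr V x y v) = ytr V x z v))"

text \<open>
  Natural transformations. Components are extensional, so that two of them are equal
  as soon as they agree on the carriers.
\<close>

definition yhom ::
    "('k, 'c) ring_scheme \<Rightarrow> ('k, 'v) ymodule \<Rightarrow> ('k, 'w) ymodule \<Rightarrow> (young \<Rightarrow> 'v \<Rightarrow> 'w) set" where
  "yhom K V W = {f.
     (\<forall>x. f x \<in> extensional (carrier (yob V x)) \<and> linear_map K (yob V x) (yob W x) (f x)) \<and>
     (\<forall>x y. x \<le> y \<longrightarrow> (\<forall>v\<in>carrier (yob V x). f y (ytr V x y v) = ytr W x y (f x v)))}"

definition ysurj ::
    "('k, 'v) ymodule \<Rightarrow> ('k, 'w) ymodule \<Rightarrow> (young \<Rightarrow> 'v \<Rightarrow> 'w) \<Rightarrow> bool" where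
  "ysurj V W f \<longleftrightarrow> (\<forall>x. f x ` carrier (yob V x) = carrier (yob W x))"

text \<open>
  The category of Young modules whose values are vector spaces with carrier in the type \<open>'v\<close>.
  The type plays the role of a universe: when it is infinite, this category is closed
  under submodules, quotients and finite direct sums up to isomorphism, and it has
  enough projectives.
\<close>

definition YMod ::
    "('k, 'c) ring_scheme \<Rightarrow> (('k, 'v) ymodule, young \<Rightarrow> 'v \<Rightarrow> 'v) preadd_cat" where
  "YMod K = \<lparr>
     cobj = {V. young_module K V},
     chom = yhom K,
     cid = (\<lambda>V x. \<lambda>v\<in>carrier (yob V x). v),
     ccomp = (\<lambda>U V W g f x. compose (carrier (yob U x)) (g x) (f x)),
     czero = (\<lambda>V W x. \<lambda>v\<in>carrier (yob V x). \<zero>\<^bsub>yob W x\<^esub>),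
     cplus = (\<lambda>V W f g x. \<lambda>v\<in>carrier (yob V x). f x v \<oplus>\<^bsub>yob W x\<^esub> g x v)\<rparr>"


section \<open>Subquotients\<close>

text \<open>
  The ring multiplication and unit, which are part of the \<open>module\<close> record, are irrelevant
  for modules. The union in \<open>smult\<close> is over representatives of the coset \<open>A\<close>; if \<open>N\<close> is a
  submodule, all of them give the same coset. The same applies to \<open>quot_map\<close>.
\<close>

definition quot_module :: "('k, 'v) module \<Rightarrow> 'v set \<Rightarrow> ('k, 'v set) module" where
  "quot_module M N = \<lparr>carrier = a_rcosets\<^bsub>M\<^esub> N, mult = undefined, one = undefined,
     zero = N, add = set_add M, smult = (\<lambda>a A. \<Union>v\<in>A. N +>\<^bsub>M\<^esub> (a \<odot>\<^bsub>M\<^esub> v))\<rparr>"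

definition quot_map ::
    "('k, 'w) module \<Rightarrow> 'w set \<Rightarrow> ('v \<Rightarrow> 'w) \<Rightarrow> 'v set \<Rightarrow> 'w set" where
  "quot_map M N f A = (\<Union>v\<in>A. N +>\<^bsub>M\<^esub> f v)"

definition sub_ymodule ::
    "('k, 'v) ymodule \<Rightarrow> (young \<Rightarrow> 'v set) \<Rightarrow> ('k, 'v) ymodule" where
  "sub_ymodule V N = \<lparr>yob = (\<lambda>x. (yob V x)\<lparr>carrier := N x\<rparr>), ytr = ytr V\<rparr>"

definition quot_ymodule ::
    "('k, 'v) ymodule \<Rightarrow> (young \<Rightarrow> 'v set) \<Rightarrow> ('k, 'v set) ymodule" where
  "quot_ymodule V N = \<lparr>yob = (\<lambda>x. quot_module (yob V x) (N x)),
     ytr = (\<lambda>x y. quot_map (yob V y) (N y) (ytr V x y))\<rparr>"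


section \<open>Homology groups and homological degrees\<close>

text \<open>
  For the ideal \<open>\<II>\<close> of the incidence algebra spanned by the non-identity morphisms,
  \<open>aug_sub K V\<close> is \<open>\<II> V\<close>: its value at \<open>x\<close> is the sum of the images of all \<open>V\<^sub>y \<rightarrow> V\<^sub>x\<close>
  with \<open>y < x\<close>, written as the smallest subspace containing them.
\<close>

definition aug_sub ::
    "('k, 'c) ring_scheme \<Rightarrow> ('k, 'v) ymodule \<Rightarrow> young \<Rightarrow> 'v set" where
  "aug_sub K V x = \<Inter>{N. submodule N K (yob V x) \<and>
     (\<forall>y<x. ytr V y x ` carrier (yob V y) \<subseteq> N)}"

text \<open>The functor \<open>H\<^sub>0 = (k\<Y> / \<II>) \<otimes> -\<close>, i.e. \<open>V \<mapsto> V / \<II> V\<close>, on objects and on morphisms.\<close>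

definition H0 :: "('k, 'c) ring_scheme \<Rightarrow> ('k, 'v) ymodule \<Rightarrow> ('k, 'v set) ymodule" where
  "H0 K V = quot_ymodule V (aug_sub K V)"

definition H0_map ::
    "('k, 'c) ring_scheme \<Rightarrow> ('k, 'w) ymodule \<Rightarrow> (young \<Rightarrow> 'v \<Rightarrow> 'w) \<Rightarrow>
      young \<Rightarrow> 'v set \<Rightarrow> 'w set" where
  "H0_map K W f x = quot_map (yob W x) (aug_sub K W x) (f x)"

definition projective_ymodule :: "('k, 'c) ring_scheme \<Rightarrow> ('k, 'v) ymodule \<Rightarrow> bool" where
  "projective_ymodule K P \<longleftrightarrow> young_module K P \<and>
     (\<forall>(M :: ('k, 'v) ymodule) (N :: ('k, 'v) ymodule) g f.
        young_module K M \<longrightarrow> young_module K N \<longrightarrow> g \<in> yhom K M N \<longrightarrow> ysurj M N g \<longrightarrow>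
        f \<in> yhom K P N \<longrightarrow>
        (\<exists>h\<in>yhom K P M. \<forall>x. \<forall>v\<in>carrier (yob P x). g x (h x v) = f x v))"

text \<open>\<open>\<dots> \<rightarrow> P\<^sub>2 \<rightarrow> P\<^sub>1 \<rightarrow> P\<^sub>0 \<rightarrow> V \<rightarrow> 0\<close> with differentials \<open>d n : P (n + 1) \<rightarrow> P n\<close>.\<close>

definition projective_resolution ::
    "('k, 'c) ring_scheme \<Rightarrow> ('k, 'v) ymodule \<Rightarrow> (nat \<Rightarrow> ('k, 'v) ymodule) \<Rightarrow>
      (nat \<Rightarrow> young \<Rightarrow> 'v \<Rightarrow> 'v) \<Rightarrow> (young \<Rightarrow> 'v \<Rightarrow> 'v) \<Rightarrow> bool" where
  "projective_resolution K V P d e \<longleftrightarrow>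
     (\<forall>n. projective_ymodule K (P n)) \<and>
     (\<forall>n. d n \<in> yhom K (P (Suc n)) (P n)) \<and>
     e \<in> yhom K (P 0) V \<and> ysurj (P 0) V e \<and>
     (\<forall>x. d 0 x ` carrier (yob (P 1) x) = a_kernel (yob (P 0) x) (yob V x) (e x)) \<and>
     (\<forall>n x. d (Suc n) x ` carrier (yob (P (Suc (Suc n))) x)
        = a_kernel (yob (P (Suc n)) x) (yob (P n) x) (d n x))"

text \<open>
  The homology in degree \<open>i\<close> of \<open>\<dots> \<rightarrow> C\<^sub>1 \<rightarrow> C\<^sub>0 \<rightarrow> 0\<close> with differentials \<open>d n : C (n + 1) \<rightarrow> C n\<close>.
\<close>

definition cycles ::
    "(nat \<Rightarrow> ('k, 'v) ymodule) \<Rightarrow> (nat \<Rightarrow> young \<Rightarrow> 'v \<Rightarrow> 'v) \<Rightarrow> nat \<Rightarrow> young \<Rightarrow> 'v set" where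
  "cycles C d i x = (case i of
       0 \<Rightarrow> carrier (yob (C 0) x)
     | Suc n \<Rightarrow> a_kernel (yob (C (Suc n)) x) (yob (C n) x) (d n x))"

definition homology_of ::
    "(nat \<Rightarrow> ('k, 'v) ymodule) \<Rightarrow> (nat \<Rightarrow> young \<Rightarrow> 'v \<Rightarrow> 'v) \<Rightarrow> nat \<Rightarrow> ('k, 'v set) ymodule" where
  "homology_of C d i =
     quot_ymodule (sub_ymodule (C i) (cycles C d i))
       (\<lambda>x. d i x ` carrier (yob (C (Suc i)) x))"

text \<open>
  \<open>H\<^sub>i(V) = Tor\<^sub>i(k\<Y> / \<II>, V)\<close>, the \<open>i\<close>-th left derived functor of \<open>H0\<close>, computed from a chosen
  projective resolution. The result does not depend on the choice up to isomorphism, and a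
  projective resolution exists in the universe \<open>'v\<close> of \<open>V\<close> if \<open>'v\<close> is infinite.
\<close>

definition chosen_resolution ::
    "('k, 'c) ring_scheme \<Rightarrow> ('k, 'v) ymodule \<Rightarrow>
      (nat \<Rightarrow> ('k, 'v) ymodule) \<times> (nat \<Rightarrow> young \<Rightarrow> 'v \<Rightarrow> 'v)" where
  "chosen_resolution K V = (SOME (P, d). \<exists>e. projective_resolution K V P d e)"

definition Tor_homology ::
    "('k, 'c) ring_scheme \<Rightarrow> nat \<Rightarrow> ('k, 'v) ymodule \<Rightarrow> ('k, 'v set set) ymodule" where
  "Tor_homology K i V = (case chosen_resolution K V of (P, d) \<Rightarrow>
     homology_of (\<lambda>n. H0 K (P n)) (\<lambda>n. H0_map K (P n) (d n)) i)"

definition hdeg :: "('k, 'c) ring_scheme \<Rightarrow> nat \<Rightarrow> ('k, 'v) ymodule \<Rightarrow> ereal" where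
  "hdeg K i V =
     (let S = {x. carrier (yob (Tor_homology K i V) x) \<noteq> {\<zero>\<^bsub>yob (Tor_homology K i V) x\<^esub>}}
      in if S = {} then -1 else (SUP x\<in>S. ereal (real (sum_norm x))))"

definition presented_in_finite_degrees ::
    "('k, 'c) ring_scheme \<Rightarrow> ('k, 'v) ymodule \<Rightarrow> bool" where
  "presented_in_finite_degrees K V \<longleftrightarrow> hdeg K 0 V < \<infinity> \<and> hdeg K 1 V < \<infinity>"

text \<open>The natural logarithm with \<open>ln \<infinity> = \<infinity>\<close>; only used at positive arguments.\<close>

definition ln_ereal :: "ereal \<Rightarrow> ereal" where
  "ln_ereal a = (case a of ereal r \<Rightarrow> ereal (ln r) | PInfty \<Rightarrow> \<infinity> | MInfty \<Rightarrow> -\<infinity>)"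

end

theory Submission
  imports Defs
begin

text \<open>
  Every partition of norm at most \<open>N\<close> lies below the partition \<open>\<mu>\<close> with \<open>i\<close>-th part \<open>\<lfloor>N / i\<rfloor>\<close>, whose
  norm is at most \<open>N (ln N + 1)\<close>. Let \<open>P\<^sub>s \<rightarrow> P\<^sub>s\<^sub>-\<^sub>1 \<rightarrow> P\<^sub>s\<^sub>-\<^sub>2\<close> be part of a projective resolution with \<open>s \<ge> 2\<close>.
  If \<open>H\<^sub>s\<^sub>-\<^sub>1\<close> vanishes in degrees above \<open>N\<close>, then a relation among elements of \<open>P\<^sub>s\<^sub>-\<^sub>1\<close> in degrees
  below \<open>x\<close> can be rewritten, modulo consequences of relations in degrees below \<open>x\<close>, so that it
  involves only elements in degrees of norm at most \<open>N\<close>, hence below \<open>x \<sqinter> \<mu>\<close>. As the maps of \<open>P\<^sub>s\<^sub>-\<^sub>2\<close> are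
  injective, the relation already holds in degree \<open>x \<sqinter> \<mu>\<close>; if \<open>x\<close> is not below \<open>\<mu>\<close>, this degree is
  smaller than \<open>x\<close>, and so \<open>H\<^sub>s\<close> vanishes at \<open>x\<close>.

  The same argument shows that \<open>V\<close> is presented in finite degrees iff for some \<open>N\<close> all maps from
  the value of \<open>V\<close> at \<open>x \<sqinter> \<mu>\<close> to its value at \<open>x\<close> are bijective. This condition is inherited by kernels,
  cokernels and finite direct sums, which are computed degreewise.
\<close>

section \<open>The Young lattice\<close>

text \<open>Two obstacles shape the development. Projectivity is tested only against modules whose
  carriers lie in the type \<open>'v\<close>, and Tor is computed from some chosen resolution inside
  that type. So free modules, quotients and direct sums are built over functions, cosets and pairs
  and then moved back into \<open>'v\<close> along injections. Moreover, the members of the chosen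
  resolution are merely projective, with no basis at hand. What the argument uses of a basis is a
  component for each degree y that is unchanged by the maps of the module, vanishes at all x not
  above y, and at y itself detects membership in \<open>aug_sub\<close>. Such components pass from a
  free module to its direct summands, and lifting the identity exhibits every projective as one.
  That free modules are projective themselves rests on the splitting of surjections of vector
  spaces. The rewriting of a relation removes the degrees of norm above N one at a time, always one
  of greatest norm. No other degree still involved lies above it, so its component can be isolated,
  and it must vanish because the whole relation maps to 0.\<close>

lemma antimono_part: "antimono (part x)" and finite_part: "finite {i. part x i \<noteq> 0}"
  using part[of x] by auto

lemma young_eqI: "(\<And>i. part x i = part y i) \<Longrightarrow> x = y"
  by (simp add: part_inject[symmetric] fun_eq_iff)

instantiation young :: semilattice_inf
begin

definition inf_young :: "young \<Rightarrow> young \<Rightarrow> young" where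
  "inf_young x y = Abs_young (\<lambda>i. min (part x i) (part y i))"

lemma part_inf: "part (inf x y) i = min (part x i) (part y i)"
proof -
  have "antimono (\<lambda>i. min (part x i) (part y i))"
    using antimono_part[of x] antimono_part[of y]
    by (auto simp: antimono_def min_le_iff_disj)
  moreover have "finite {i. min (part x i) (part y i) \<noteq> 0}"
    by (rule finite_subset[OF _ finite_part[of x]]) auto
  ultimately show ?thesis
    unfolding inf_young_def by (subst Abs_young_inverse) auto
qed

instance
  by standard (auto simp: less_eq_young_def part_inf)

end

lemma sum_norm_eq_sum:
  assumes "finite I" "{i. part x i \<noteq> 0} \<subseteq> I"
  shows "sum_norm x = sum (part x) I"
  unfolding sum_norm_def using assms by (intro sum.mono_neutral_left) auto

lemma sum_norm_mono: "x \<le> y \<Longrightarrow> sum_norm x \<le> sum_norm y"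
proof -
  assume le: "x \<le> y"
  then have "{i. part x i \<noteq> 0} \<subseteq> {i. part y i \<noteq> 0}"
    by (auto simp: less_eq_young_def intro: less_le_trans)
  then have "sum_norm x = sum (part x) {i. part y i \<noteq> 0}"
    by (intro sum_norm_eq_sum finite_part)
  also have "\<dots> \<le> sum_norm y"
    unfolding sum_norm_def using le by (intro sum_mono) (auto simp: less_eq_young_def)
  finally show ?thesis .
qed

text \<open>Makes the norm a measure for induction along the order, and makes an element of greatest
  norm in a set a maximal one.\<close>

lemma sum_norm_strict_mono: "x < y \<Longrightarrow> sum_norm x < sum_norm y"
proof -
  assume less: "x < y"
  then have le: "\<And>i. part x i \<le> part y i"
    by (simp add: less_young_def less_eq_young_def)
  obtain j where j: "part x j < part y j"
    using less le young_eqI[of x y] by (metis less_young_def le_neq_implies_less)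
  have "{i. part x i \<noteq> 0} \<subseteq> {i. part y i \<noteq> 0}"
    using le by (auto intro: less_le_trans)
  then have "sum_norm x = sum (part x) {i. part y i \<noteq> 0}"
    by (intro sum_norm_eq_sum finite_part)
  also have "\<dots> < sum_norm y"
    unfolding sum_norm_def using le j by (intro sum_strict_mono_ex1 finite_part) (auto intro!: exI[of _ j])
  finally show ?thesis .
qed

text \<open>A partition below x is supported where x is, with values at most the largest part
  \<open>part x 0\<close>; only finitely many functions satisfy this. This finiteness underlies the
  sums in the free module and the inductions over sets of degrees.\<close>

lemma finite_young_below: "finite {y :: young. y \<le> x}"
proof -
  let ?A = "{i. part x i \<noteq> 0}" and ?B = "{..part x 0}"
  let ?F = "{f. \<forall>i. (i \<in> ?A \<longrightarrow> f i \<in> ?B) \<and> (i \<notin> ?A \<longrightarrow> f i = 0)}"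
  have "finite ?F"
    by (intro finite_set_of_finite_funs finite_part) auto
  moreover have "part ` {y. y \<le> x} \<subseteq> ?F"
  proof clarify
    fix y i assume y: "y \<le> x"
    have "part x i \<le> part x 0"
      using antimono_part[of x] by (simp add: antimono_def)
    then show "(i \<in> ?A \<longrightarrow> part y i \<in> ?B) \<and> (i \<notin> ?A \<longrightarrow> part y i = 0)"
      using y by (auto simp: less_eq_young_def) (metis le_trans, metis le_zero_eq)
  qed
  ultimately have "finite (part ` {y. y \<le> x})"
    by (rule rev_finite_subset)
  then show ?thesis
    by (rule finite_imageD) (auto simp: inj_on_def part_inject)
qed

section \<open>The partition above all partitions of bounded norm\<close>

definition hyperbola :: "nat \<Rightarrow> young" where
  "hyperbola N = Abs_young (\<lambda>i. N div Suc i)"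

lemma part_hyperbola: "part (hyperbola N) i = N div Suc i"
proof -
  have "antimono (\<lambda>i. N div Suc i)"
    by (auto simp: antimono_def intro: div_le_mono2)
  moreover have "finite {i. N div Suc i \<noteq> 0}"
    by (rule finite_subset[of _ "{..N}"]) (auto simp: div_eq_0_iff)
  ultimately show ?thesis
    unfolding hyperbola_def by (subst Abs_young_inverse) auto
qed

lemma hyperbola_mono: "M \<le> N \<Longrightarrow> hyperbola M \<le> hyperbola N"
  by (auto simp: less_eq_young_def part_hyperbola intro: div_le_mono)

text \<open>The first i + 1 parts of y are each at least \<open>part y i\<close>, so the norm is at
  least i + 1 times that part. The rectangle with i + 1 rows of length N div (i + 1) shows that
  \<open>hyperbola N\<close> is in fact the least upper bound of these partitions.\<close>

lemma le_hyperbola: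
  assumes "sum_norm y \<le> N"
  shows "y \<le> hyperbola N"
  unfolding less_eq_young_def
proof
  fix i
  have "Suc i * part y i = (\<Sum>j\<le>i. part y i)"
    by simp
  also have "\<dots> \<le> (\<Sum>j\<le>i. part y j)"
    using antimono_part[of y] by (intro sum_mono) (auto simp: antimono_def)
  also have "\<dots> \<le> sum (part y) ({..i} \<union> {i. part y i \<noteq> 0})"
    by (intro sum_mono2 finite_UnI finite_part) auto
  also have "\<dots> = sum_norm y"
    by (intro sum_norm_eq_sum[symmetric] finite_UnI finite_part) auto
  finally have "Suc i * part y i \<le> N"
    using assms by simp
  then show "part y i \<le> part (hyperbola N) i"
    by (simp only: part_hyperbola) (metis div_le_mono nonzero_mult_div_cancel_left nat.distinct(1))
qed

text \<open>Induction using ln t \<le> t - 1 at t = N / (N + 1), which bounds 1 / (N + 1) by ln (N +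
  1) - ln N. The summand 1 on the right is the term with i = 0.\<close>

lemma harmonic_le_ln: "N \<ge> 1 \<Longrightarrow> (\<Sum>i<N. 1 / real (Suc i)) \<le> ln (real N) + 1"
proof (induction N rule: nat_induct_at_least)
  case base
  then show ?case by simp
next
  case (Suc N)
  have "ln (real N / real (Suc N)) \<le> real N / real (Suc N) - 1"
    using Suc.hyps by (intro ln_le_minus_one) auto
  also have "\<dots> = - (1 / real (Suc N))"
    by (simp add: field_simps)
  finally have "1 / real (Suc N) \<le> ln (real (Suc N)) - ln (real N)"
    using Suc.hyps by (simp add: ln_div)
  then show ?case
    using Suc.IH by simp
qed

text \<open>The norm is the sum of floor(N / i) over i = 1, ..., N; dropping the floors leaves N
  times a harmonic number.\<close>

lemma sum_norm_hyperbola: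
  assumes "N \<ge> 1"
  shows "real (sum_norm (hyperbola N)) \<le> real N * (ln (real N) + 1)"
proof -
  have "sum_norm (hyperbola N) = (\<Sum>i<N. N div Suc i)"
    by (subst sum_norm_eq_sum[of "{..<N}"]) (auto simp: part_hyperbola div_eq_0_iff)
  then have "real (sum_norm (hyperbola N)) \<le> (\<Sum>i<N. real N * (1 / real (Suc i)))"
    by (simp del: of_nat_Suc) (intro sum_mono of_nat_div_le_of_nat)
  also have "\<dots> = real N * (\<Sum>i<N. 1 / real (Suc i))"
    by (simp only: sum_distrib_left)
  also have "\<dots> \<le> real N * (ln (real N) + 1)"
    using harmonic_le_ln[OF assms] by (intro mult_left_mono) auto
  finally show ?thesis .
qed

section \<open>Linear maps\<close>

lemma linear_mapI:
  assumes "\<And>v. v \<in> carrier M \<Longrightarrow> f v \<in> carrier N"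
    and "\<And>u v. \<lbrakk>u \<in> carrier M; v \<in> carrier M\<rbrakk> \<Longrightarrow> f (u \<oplus>\<^bsub>M\<^esub> v) = f u \<oplus>\<^bsub>N\<^esub> f v"
    and "\<And>a v. \<lbrakk>a \<in> carrier K; v \<in> carrier M\<rbrakk> \<Longrightarrow> f (a \<odot>\<^bsub>M\<^esub> v) = a \<odot>\<^bsub>N\<^esub> f v"
  shows "linear_map K M N f"
  using assms by (auto simp: linear_map_def)

lemma linear_map_closed: "\<lbrakk>linear_map K M N f; v \<in> carrier M\<rbrakk> \<Longrightarrow> f v \<in> carrier N"
  and linear_map_add:
    "\<lbrakk>linear_map K M N f; u \<in> carrier M; v \<in> carrier M\<rbrakk> \<Longrightarrow> f (u \<oplus>\<^bsub>M\<^esub> v) = f u \<oplus>\<^bsub>N\<^esub> f v"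
  and linear_map_smult:
    "\<lbrakk>linear_map K M N f; a \<in> carrier K; v \<in> carrier M\<rbrakk> \<Longrightarrow> f (a \<odot>\<^bsub>M\<^esub> v) = a \<odot>\<^bsub>N\<^esub> f v"
  by (auto simp: linear_map_def)

lemma linear_map_cong:
  assumes "Module.module K M" "linear_map K M N f" "\<And>v. v \<in> carrier M \<Longrightarrow> g v = f v"
  shows "linear_map K M N g"
proof -
  interpret M: Module.module K M by fact
  show ?thesis
    using assms(2,3) by (auto simp: linear_map_def Pi_iff)
qed

lemma linear_map_comp:
  assumes "linear_map K L M f" "linear_map K M N g"
  shows "linear_map K L N (\<lambda>v. g (f v))"
  using assms by (auto simp: linear_map_def Pi_iff)

lemma linear_map_id: "linear_map K M M (\<lambda>v. v)"
  by (simp add: linear_map_def)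

lemma linear_map_zero:
  assumes "Module.module K M" "Module.module K N" "linear_map K M N f"
  shows "f \<zero>\<^bsub>M\<^esub> = \<zero>\<^bsub>N\<^esub>"
proof -
  interpret M: Module.module K M by fact
  interpret N: Module.module K N by fact
  have c: "f \<zero>\<^bsub>M\<^esub> \<in> carrier N"
    using assms(3) by (simp add: linear_map_closed)
  have "f \<zero>\<^bsub>M\<^esub> \<oplus>\<^bsub>N\<^esub> f \<zero>\<^bsub>M\<^esub> = f \<zero>\<^bsub>M\<^esub>"
    using linear_map_add[OF assms(3), of "\<zero>\<^bsub>M\<^esub>" "\<zero>\<^bsub>M\<^esub>"] by simp
  then show ?thesis
    using c N.add.r_cancel_one by blast
qed

lemma linear_map_neg:
  assumes "Module.module K M" "Module.module K N" "linear_map K M N f" "v \<in> carrier M"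
  shows "f (\<ominus>\<^bsub>M\<^esub> v) = \<ominus>\<^bsub>N\<^esub> f v"
proof -
  interpret M: Module.module K M by fact
  interpret N: Module.module K N by fact
  have "f (\<ominus>\<^bsub>M\<^esub> v) \<oplus>\<^bsub>N\<^esub> f v = \<zero>\<^bsub>N\<^esub>"
    using linear_map_add[OF assms(3), of "\<ominus>\<^bsub>M\<^esub> v" v] linear_map_zero[OF assms(1-3)] assms(4)
    by (simp add: M.l_neg)
  moreover have "f v \<in> carrier N" "f (\<ominus>\<^bsub>M\<^esub> v) \<in> carrier N"
    using assms(3,4) by (simp_all add: linear_map_closed)
  ultimately show ?thesis
    using N.minus_equality by simp
qed

lemma linear_map_minus:
  assumes "Module.module K M" "Module.module K N" "linear_map K M N f"
    "u \<in> carrier M" "v \<in> carrier M"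
  shows "f (u \<ominus>\<^bsub>M\<^esub> v) = f u \<ominus>\<^bsub>N\<^esub> f v"
proof -
  interpret M: Module.module K M by fact
  show ?thesis
    using assms linear_map_neg[OF assms(1-3,5)]
    by (simp add: a_minus_def linear_map_add)
qed

lemma linear_map_zero_map:
  assumes "Module.module K N"
  shows "linear_map K M N (\<lambda>v. \<zero>\<^bsub>N\<^esub>)"
proof -
  interpret N: Module.module K N by fact
  show ?thesis
    by (rule linear_mapI) auto
qed

lemma linear_map_plus:
  assumes "Module.module K M" "Module.module K N" "linear_map K M N f" "linear_map K M N g"
  shows "linear_map K M N (\<lambda>v. f v \<oplus>\<^bsub>N\<^esub> g v)"
proof -
  interpret M: Module.module K M by fact
  interpret N: Module.module K N by fact
  have c: "f v \<in> carrier N" "g v \<in> carrier N" if "v \<in> carrier M" for v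
    using assms(3,4) that by (auto intro: linear_map_closed)
  show ?thesis
  proof (rule linear_mapI)
    fix u v assume "u \<in> carrier M" "v \<in> carrier M"
    then show "f (u \<oplus>\<^bsub>M\<^esub> v) \<oplus>\<^bsub>N\<^esub> g (u \<oplus>\<^bsub>M\<^esub> v) = f u \<oplus>\<^bsub>N\<^esub> g u \<oplus>\<^bsub>N\<^esub> (f v \<oplus>\<^bsub>N\<^esub> g v)"
      using assms c by (simp add: linear_map_add N.a_ac)
  qed (use assms c in \<open>simp_all add: linear_map_smult N.smult_r_distr\<close>)
qed

lemma linear_map_uminus:
  assumes "Module.module K M" "Module.module K N" "linear_map K M N f"
  shows "linear_map K M N (\<lambda>v. \<ominus>\<^bsub>N\<^esub> f v)"
proof -
  interpret M: Module.module K M by fact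
  interpret N: Module.module K N by fact
  have c: "f v \<in> carrier N" if "v \<in> carrier M" for v
    using assms(3) that by (auto intro: linear_map_closed)
  show ?thesis
    by (rule linear_mapI)
      (use assms c in \<open>simp_all add: linear_map_add linear_map_smult N.smult_r_minus N.minus_add\<close>)
qed

section \<open>Submodules obtained from linear maps, intersections and sums\<close>

lemma submodule_vimage:
  assumes "Module.module K M" "Module.module K N" "linear_map K M N f" "submodule L K N"
  shows "submodule {v \<in> carrier M. f v \<in> L} K M"
proof -
  interpret M: Module.module K M by fact
  interpret N: Module.module K N by fact
  note L = N.submoduleE[OF assms(4)]
  have "\<zero>\<^bsub>N\<^esub> \<in> L"
    using subgroup.one_closed[OF submodule.axioms(1)[OF assms(4)]] by simp
  then show ?thesis
    by (intro M.submoduleI)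
      (auto simp: linear_map_add[OF assms(3)] linear_map_smult[OF assms(3)]
        linear_map_neg[OF assms(1-3)] linear_map_zero[OF assms(1-3)] L(3-5))
qed

lemma submodule_zero_mem: "submodule L K M \<Longrightarrow> \<zero>\<^bsub>M\<^esub> \<in> L"
  by (auto dest!: submodule.axioms(1) subgroup.one_closed)

lemma submodule_minus_mem:
  assumes "Module.module K M" "submodule L K M" "u \<in> L" "v \<in> L"
  shows "u \<ominus>\<^bsub>M\<^esub> v \<in> L"
  using Module.module.submoduleE[OF assms(1,2)] assms(3,4) by (simp add: a_minus_def)

lemma submodule_image:
  assumes "Module.module K M" "Module.module K N" "linear_map K M N f" "submodule L K M"
  shows "submodule (f ` L) K N"
proof -
  interpret M: Module.module K M by fact
  interpret N: Module.module K N by fact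
  note L = M.submoduleE[OF assms(4)]
  have Lc: "v \<in> carrier M" if "v \<in> L" for v
    using L(1) that by blast
  show ?thesis
  proof (rule N.submoduleI)
    show "f ` L \<subseteq> carrier N"
      using Lc assms(3) by (auto intro: linear_map_closed)
    show "\<zero>\<^bsub>N\<^esub> \<in> f ` L"
      using submodule_zero_mem[OF assms(4)] linear_map_zero[OF assms(1-3)]
      by (intro image_eqI[of _ _ "\<zero>\<^bsub>M\<^esub>"]) auto
    show "\<ominus>\<^bsub>N\<^esub> a \<in> f ` L" if a: "a \<in> f ` L" for a
    proof -
      obtain v where "v \<in> L" "a = f v"
        using a by auto
      then have "\<ominus>\<^bsub>N\<^esub> a = f (\<ominus>\<^bsub>M\<^esub> v)"
        using linear_map_neg[OF assms(1-3)] by (simp add: Lc)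
      then show ?thesis
        using L(3) \<open>v \<in> L\<close> by auto
    qed
    show "a \<oplus>\<^bsub>N\<^esub> b \<in> f ` L" if ab: "a \<in> f ` L" "b \<in> f ` L" for a b
    proof -
      obtain u v where "u \<in> L" "v \<in> L" "a = f u" "b = f v"
        using ab by auto
      then have "a \<oplus>\<^bsub>N\<^esub> b = f (u \<oplus>\<^bsub>M\<^esub> v)"
        by (simp add: linear_map_add[OF assms(3)] Lc)
      then show ?thesis
        using L(5) \<open>u \<in> L\<close> \<open>v \<in> L\<close> by auto
    qed
    show "a \<odot>\<^bsub>N\<^esub> b \<in> f ` L" if ab: "a \<in> carrier K" "b \<in> f ` L" for a b
    proof -
      obtain v where "v \<in> L" "b = f v"
        using ab by auto
      then have "a \<odot>\<^bsub>N\<^esub> b = f (a \<odot>\<^bsub>M\<^esub> v)"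
        using linear_map_smult[OF assms(3) ab(1)] by (simp add: Lc)
      then show ?thesis
        using L(4) ab(1) \<open>v \<in> L\<close> by auto
    qed
  qed
qed

lemma submodule_trivial:
  assumes "Module.module K M"
  shows "submodule {\<zero>\<^bsub>M\<^esub>} K M"
proof -
  interpret M: Module.module K M by fact
  show ?thesis
    by (rule M.submoduleI) auto
qed

lemma submodule_Inter:
  assumes "Module.module K M" "\<S> \<noteq> {}" "\<And>N. N \<in> \<S> \<Longrightarrow> submodule N K M"
  shows "submodule (\<Inter>\<S>) K M"
proof -
  interpret M: Module.module K M by fact
  note E = M.submoduleE[OF assms(3)]
  show ?thesis
  proof (rule M.submoduleI)
    show "\<Inter>\<S> \<subseteq> carrier M"
      using assms(2) E(1) by blast
  qed (use submodule_zero_mem[OF assms(3)] E(3-5) in \<open>simp_all\<close>)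
qed

lemma submodule_sum:
  assumes "Module.module K M" "submodule A K M" "submodule B K M"
  shows "submodule {a \<oplus>\<^bsub>M\<^esub> b |a b. a \<in> A \<and> b \<in> B} K M" (is "submodule ?S K M")
proof -
  interpret M: Module.module K M by fact
  note A = M.submoduleE[OF assms(2)] and B = M.submoduleE[OF assms(3)]
  have c: "a \<in> A \<Longrightarrow> a \<in> carrier M" "b \<in> B \<Longrightarrow> b \<in> carrier M" for a b
    using A(1) B(1) by auto
  have S: "v \<in> ?S" if "v = a \<oplus>\<^bsub>M\<^esub> b" "a \<in> A" "b \<in> B" for v a b
    using that by auto
  show ?thesis
  proof (rule M.submoduleI)
    show "?S \<subseteq> carrier M"
      using c by auto
    show "\<zero>\<^bsub>M\<^esub> \<in> ?S"
      using submodule_zero_mem[OF assms(2)] submodule_zero_mem[OF assms(3)]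
      by (intro S[of _ "\<zero>\<^bsub>M\<^esub>" "\<zero>\<^bsub>M\<^esub>"]) auto
  next
    fix v assume "v \<in> ?S"
    then obtain a b where v: "a \<in> A" "b \<in> B" "v = a \<oplus>\<^bsub>M\<^esub> b"
      by auto
    then show "\<ominus>\<^bsub>M\<^esub> v \<in> ?S"
      by (intro S[of _ "\<ominus>\<^bsub>M\<^esub> a" "\<ominus>\<^bsub>M\<^esub> b"]) (simp_all add: c M.minus_add A(3) B(3))
    show "k \<odot>\<^bsub>M\<^esub> v \<in> ?S" if "k \<in> carrier K" for k
      using v \<open>k \<in> carrier K\<close>
      by (intro S[of _ "k \<odot>\<^bsub>M\<^esub> a" "k \<odot>\<^bsub>M\<^esub> b"]) (simp_all add: c M.smult_r_distr A(4) B(4))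
    fix w assume "w \<in> ?S"
    then obtain a' b' where w: "a' \<in> A" "b' \<in> B" "w = a' \<oplus>\<^bsub>M\<^esub> b'"
      by auto
    show "v \<oplus>\<^bsub>M\<^esub> w \<in> ?S"
      using v w
      by (intro S[of _ "a \<oplus>\<^bsub>M\<^esub> a'" "b \<oplus>\<^bsub>M\<^esub> b'"]) (simp_all add: c M.a_ac A(5) B(5))
  qed
qed

lemma mem_a_kernel: "v \<in> a_kernel M N f \<longleftrightarrow> v \<in> carrier M \<and> f v = \<zero>\<^bsub>N\<^esub>"
  by (simp add: a_kernel_def kernel_def)

lemma submodule_a_kernel:
  assumes "Module.module K M" "Module.module K N" "linear_map K M N f"
  shows "submodule (a_kernel M N f) K M"
proof -
  have "a_kernel M N f = {v \<in> carrier M. f v \<in> {\<zero>\<^bsub>N\<^esub>}}"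
    by (auto simp: mem_a_kernel)
  then show ?thesis
    using submodule_vimage[OF assms submodule_trivial[OF assms(2)]] by simp
qed

lemma (in abelian_group) minus_eq_zero_iff:
  assumes "u \<in> carrier G" "v \<in> carrier G"
  shows "u \<ominus> v = \<zero> \<longleftrightarrow> u = v"
proof
  assume "u \<ominus> v = \<zero>"
  then have "\<ominus> (\<ominus> v) = u"
    using assms by (intro minus_equality) (simp_all add: a_minus_def)
  then show "u = v"
    using assms by simp
qed (use assms in \<open>simp add: a_minus_def r_neg\<close>)

lemma linear_map_inj_onI:
  assumes "Module.module K M" "Module.module K N" "linear_map K M N f"
    and "\<And>v. \<lbrakk>v \<in> carrier M; f v = \<zero>\<^bsub>N\<^esub>\<rbrakk> \<Longrightarrow> v = \<zero>\<^bsub>M\<^esub>"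
  shows "inj_on f (carrier M)"
proof (rule inj_onI)
  interpret M: Module.module K M by fact
  interpret N: Module.module K N by fact
  fix u v assume uv: "u \<in> carrier M" "v \<in> carrier M" "f u = f v"
  have "f v \<in> carrier N"
    using assms(3) uv by (simp add: linear_map_closed)
  then have "f (u \<ominus>\<^bsub>M\<^esub> v) = \<zero>\<^bsub>N\<^esub>"
    using linear_map_minus[OF assms(1-3)] uv by (simp add: a_minus_def N.r_neg)
  then have "u \<ominus>\<^bsub>M\<^esub> v = \<zero>\<^bsub>M\<^esub>"
    using assms(4) uv by simp
  then show "u = v"
    using uv by (simp add: M.minus_eq_zero_iff)
qed

subsection \<open>Quotients\<close>

context
  fixes K :: "('k, 'c) ring_scheme" and M :: "('k, 'v) module" and N :: "'v set"
  assumes M: "Module.module K M" and N: "submodule N K M"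
begin

interpretation M: Module.module K M by (fact M)

interpretation Q: abelian_subgroup N M
  using N M.abelian_group_axioms submodule.axioms(1) 
  by (intro abelian_subgroupI3 additive_subgroupI) auto

lemma coset_eq_iff:
  assumes "u \<in> carrier M" "v \<in> carrier M"
  shows "N +>\<^bsub>M\<^esub> u = N +>\<^bsub>M\<^esub> v \<longleftrightarrow> u \<ominus>\<^bsub>M\<^esub> v \<in> N"
proof
  assume "N +>\<^bsub>M\<^esub> u = N +>\<^bsub>M\<^esub> v"
  then have "N +>\<^bsub>M\<^esub> (u \<oplus>\<^bsub>M\<^esub> \<ominus>\<^bsub>M\<^esub> v) = N"
    using assms M.a_coset_add_inv2 Q.a_subset by blast
  then show "u \<ominus>\<^bsub>M\<^esub> v \<in> N"
    using assms M.a_coset_join1 Q.a_subgroup by (simp add: a_minus_def)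
next
  assume "u \<ominus>\<^bsub>M\<^esub> v \<in> N"
  then have "N +>\<^bsub>M\<^esub> (u \<oplus>\<^bsub>M\<^esub> \<ominus>\<^bsub>M\<^esub> v) = N"
    using assms M.a_coset_join2 Q.a_subgroup by (simp add: a_minus_def)
  then show "N +>\<^bsub>M\<^esub> u = N +>\<^bsub>M\<^esub> v"
    using assms M.a_coset_add_inv1 Q.a_subset by blast
qed

lemma coset_eq_self_iff:
  assumes "v \<in> carrier M"
  shows "N +>\<^bsub>M\<^esub> v = N \<longleftrightarrow> v \<in> N"
  using assms M.a_coset_join1 M.a_coset_join2 Q.a_subgroup by blast

lemma mem_coset_iff:
  assumes "v \<in> carrier M"
  shows "u \<in> N +>\<^bsub>M\<^esub> v \<longleftrightarrow> u \<in> carrier M \<and> N +>\<^bsub>M\<^esub> u = N +>\<^bsub>M\<^esub> v"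
proof
  assume u: "u \<in> N +>\<^bsub>M\<^esub> v"
  then show "u \<in> carrier M \<and> N +>\<^bsub>M\<^esub> u = N +>\<^bsub>M\<^esub> v"
    using M.a_r_coset_subset_G[OF Q.a_subset assms] M.a_repr_independence[OF u assms Q.a_subgroup]
    by auto
next
  assume u: "u \<in> carrier M \<and> N +>\<^bsub>M\<^esub> u = N +>\<^bsub>M\<^esub> v"
  then have "\<zero>\<^bsub>M\<^esub> \<oplus>\<^bsub>M\<^esub> u \<in> N +>\<^bsub>M\<^esub> v"
    using M.a_rcosI[OF Q.zero_closed Q.a_subset] by metis
  then show "u \<in> N +>\<^bsub>M\<^esub> v"
    using u by simp
qed

lemma quot_module_carrier: "carrier (quot_module M N) = (\<lambda>v. N +>\<^bsub>M\<^esub> v) ` carrier M"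
  by (auto simp: quot_module_def A_RCOSETS_def')

text \<open>The zero of the quotient is \<open>N\<close> itself. Written as a coset of 0 it has the
  shape of the elements delivered by \<open>quot_module_carrier\<close>, so the module axioms reduce
  to those of \<open>M\<close> by rewriting.\<close>

lemma quot_module_zero: "\<zero>\<^bsub>quot_module M N\<^esub> = N +>\<^bsub>M\<^esub> \<zero>\<^bsub>M\<^esub>"
  using coset_eq_self_iff[of "\<zero>\<^bsub>M\<^esub>"] by (simp add: quot_module_def)

lemma quot_module_add:
  "\<lbrakk>u \<in> carrier M; v \<in> carrier M\<rbrakk> \<Longrightarrow>
    (N +>\<^bsub>M\<^esub> u) \<oplus>\<^bsub>quot_module M N\<^esub> (N +>\<^bsub>M\<^esub> v) = N +>\<^bsub>M\<^esub> (u \<oplus>\<^bsub>M\<^esub> v)"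
  using Q.a_rcos_sum by (simp add: quot_module_def)

lemma quot_module_smult:
  assumes "a \<in> carrier K" "v \<in> carrier M"
  shows "a \<odot>\<^bsub>quot_module M N\<^esub> (N +>\<^bsub>M\<^esub> v) = N +>\<^bsub>M\<^esub> (a \<odot>\<^bsub>M\<^esub> v)"
proof -
  \<comment> \<open>All representatives of the coset give the same value, which collapses the union
    in the definition of \<open>smult\<close>.\<close>
  have eq: "N +>\<^bsub>M\<^esub> (a \<odot>\<^bsub>M\<^esub> u) = N +>\<^bsub>M\<^esub> (a \<odot>\<^bsub>M\<^esub> v)" if u: "u \<in> N +>\<^bsub>M\<^esub> v" for u
  proof -
    have u': "u \<in> carrier M" "u \<ominus>\<^bsub>M\<^esub> v \<in> N"
      using u mem_coset_iff assms(2) coset_eq_iff by auto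
    then have "a \<odot>\<^bsub>M\<^esub> (u \<ominus>\<^bsub>M\<^esub> v) \<in> N"
      using assms N M.submoduleE(4) by blast
    moreover have "a \<odot>\<^bsub>M\<^esub> (u \<ominus>\<^bsub>M\<^esub> v) = a \<odot>\<^bsub>M\<^esub> u \<ominus>\<^bsub>M\<^esub> a \<odot>\<^bsub>M\<^esub> v"
      using assms u' by (simp add: a_minus_def M.smult_r_distr M.smult_r_minus)
    ultimately show ?thesis
      using assms u' coset_eq_iff by simp
  qed
  have "v \<in> N +>\<^bsub>M\<^esub> v"
    using mem_coset_iff assms by simp
  then have "(\<Union>u\<in>N +>\<^bsub>M\<^esub> v. N +>\<^bsub>M\<^esub> (a \<odot>\<^bsub>M\<^esub> u)) = N +>\<^bsub>M\<^esub> (a \<odot>\<^bsub>M\<^esub> v)"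
    by (rule UN_constant_eq) (intro ballI eq)
  then show ?thesis
    by (simp add: quot_module_def)
qed

lemma quot_module_module: "Module.module K (quot_module M N)"
proof (rule moduleI)
  show "cring K" ..
  show "abelian_group (quot_module M N)"
  proof (rule abelian_groupI)
    fix A assume "A \<in> carrier (quot_module M N)"
    then obtain v where v: "v \<in> carrier M" "A = N +>\<^bsub>M\<^esub> v"
      by (auto simp: quot_module_carrier)
    then show "\<exists>B\<in>carrier (quot_module M N). B \<oplus>\<^bsub>quot_module M N\<^esub> A = \<zero>\<^bsub>quot_module M N\<^esub>"
      by (intro bexI[of _ "N +>\<^bsub>M\<^esub> (\<ominus>\<^bsub>M\<^esub> v)"])
        (auto simp: quot_module_carrier quot_module_zero quot_module_add M.l_neg)
  qed (auto simp: quot_module_carrier quot_module_zero quot_module_add M.a_ac)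
qed (auto simp: quot_module_carrier quot_module_add quot_module_smult
      M.smult_l_distr M.smult_r_distr M.smult_assoc1)

lemma quot_module_proj: "linear_map K M (quot_module M N) (\<lambda>v. N +>\<^bsub>M\<^esub> v)"
  by (rule linear_mapI) (auto simp: quot_module_carrier quot_module_add quot_module_smult)

end

text \<open>As f sends \<open>A\<close> into \<open>B\<close>, representatives of one coset of
  \<open>A\<close> have their images in one coset of \<open>B\<close>, so the union in
  \<open>quot_map\<close> is over equal sets.\<close>

lemma quot_map_coset:
  assumes "Module.module K L" "submodule A K L" "Module.module K M" "submodule B K M"
    and "linear_map K L M f" "f ` A \<subseteq> B" "v \<in> carrier L"
  shows "quot_map M B f (A +>\<^bsub>L\<^esub> v) = B +>\<^bsub>M\<^esub> f v"
proof -
  have eq: "B +>\<^bsub>M\<^esub> f u = B +>\<^bsub>M\<^esub> f v" if u: "u \<in> A +>\<^bsub>L\<^esub> v" for u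
  proof -
    have u': "u \<in> carrier L" "u \<ominus>\<^bsub>L\<^esub> v \<in> A"
      using u mem_coset_iff[OF assms(1,2)] assms(7) coset_eq_iff[OF assms(1,2)] by auto
    then have "f u \<ominus>\<^bsub>M\<^esub> f v \<in> B"
      using assms(6,7) linear_map_minus[OF assms(1,3,5)] by force
    then show ?thesis
      using coset_eq_iff[OF assms(3,4)] u' assms(5,7) by (simp add: linear_map_closed)
  qed
  show ?thesis
    unfolding quot_map_def
  proof (rule UN_constant_eq)
    show "v \<in> A +>\<^bsub>L\<^esub> v"
      by (simp add: mem_coset_iff[OF assms(1,2)] assms(7))
  qed (intro ballI eq)
qed

lemma quot_map_linear:
  assumes "Module.module K L" "submodule A K L" "Module.module K M" "submodule B K M"
    and "linear_map K L M f" "f ` A \<subseteq> B"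
  shows "linear_map K (quot_module L A) (quot_module M B) (quot_map M B f)"
proof -
  interpret L: Module.module K L by fact
  note q = quot_map_coset[OF assms]
  show ?thesis
    by (rule linear_mapI)
      (auto simp: quot_module_carrier[OF assms(1,2)] quot_module_carrier[OF assms(3,4)]
        quot_module_add[OF assms(1,2)] quot_module_add[OF assms(3,4)]
        quot_module_smult[OF assms(1,2)] quot_module_smult[OF assms(3,4)]
        q linear_map_closed[OF assms(5)] linear_map_add[OF assms(5)] linear_map_smult[OF assms(5)])
qed

subsection \<open>Linear sections\<close>

text \<open>Zorn's lemma provides a maximal submodule C that meets L trivially. If some v lay
  outside C + L, then adding the line through v to C would keep the intersection with L trivial,
  because a nonzero coefficient of v can be inverted.\<close>

lemma complement_exists:
  fixes K :: "('k, 'c) ring_scheme" and M :: "('k, 'v) module"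
  assumes "field K" "Module.module K M" "submodule L K M"
  shows "\<exists>C. submodule C K M \<and> C \<inter> L = {\<zero>\<^bsub>M\<^esub>} \<and>
    (\<forall>v\<in>carrier M. \<exists>c\<in>C. \<exists>l\<in>L. v = c \<oplus>\<^bsub>M\<^esub> l)"
proof -
  interpret K: field K by fact
  interpret M: Module.module K M by fact
  note L = M.submoduleE[OF assms(3)]
  let ?S = "{C. submodule C K M \<and> C \<inter> L = {\<zero>\<^bsub>M\<^esub>}}"
  have "\<exists>C\<in>?S. \<forall>X\<in>?S. C \<subseteq> X \<longrightarrow> X = C"
  proof (rule subset_Zorn_nonempty)
    show "?S \<noteq> {}"
      using submodule_trivial[OF assms(2)] submodule_zero_mem[OF assms(3)] by auto
    fix \<C> assume ne: "\<C> \<noteq> {}" and chain: "subset.chain ?S \<C>"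
    then have sub: "submodule C K M" and int: "C \<inter> L = {\<zero>\<^bsub>M\<^esub>}" if "C \<in> \<C>" for C
      using that by (auto simp: subset.chain_def)
    have "submodule (\<Union>\<C>) K M"
    proof (rule M.submoduleI)
      show "\<Union>\<C> \<subseteq> carrier M"
        using M.submoduleE(1)[OF sub] by auto
      show "\<zero>\<^bsub>M\<^esub> \<in> \<Union>\<C>"
        using ne submodule_zero_mem[OF sub] by auto
      show "\<ominus>\<^bsub>M\<^esub> a \<in> \<Union>\<C>" if "a \<in> \<Union>\<C>" for a
        using that M.submoduleE(3)[OF sub] by auto
      show "k \<odot>\<^bsub>M\<^esub> a \<in> \<Union>\<C>" if "k \<in> carrier K" "a \<in> \<Union>\<C>" for k a
        using that M.submoduleE(4)[OF sub] by auto
      show "a \<oplus>\<^bsub>M\<^esub> b \<in> \<Union>\<C>" if ab: "a \<in> \<Union>\<C>" "b \<in> \<Union>\<C>" for a b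
      proof -
        obtain A B where "A \<in> \<C>" "B \<in> \<C>" "a \<in> A" "b \<in> B"
          using ab by auto
        moreover have "A \<subseteq> B \<or> B \<subseteq> A"
          using chain \<open>A \<in> \<C>\<close> \<open>B \<in> \<C>\<close> by (auto simp: subset.chain_def)
        ultimately show ?thesis
          using M.submoduleE(5)[OF sub] by (metis Union_iff subsetD)
      qed
    qed
    moreover have "\<Union>\<C> \<inter> L = {\<zero>\<^bsub>M\<^esub>}"
      using ne int by blast
    ultimately show "\<Union>\<C> \<in> ?S"
      by simp
  qed
  then obtain C where C: "submodule C K M" "C \<inter> L = {\<zero>\<^bsub>M\<^esub>}"
    and max: "\<And>X. \<lbrakk>submodule X K M; X \<inter> L = {\<zero>\<^bsub>M\<^esub>}; C \<subseteq> X\<rbrakk> \<Longrightarrow> X = C"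
    by auto
  note CE = M.submoduleE[OF C(1)]
  have "\<exists>c\<in>C. \<exists>l\<in>L. v = c \<oplus>\<^bsub>M\<^esub> l" if v: "v \<in> carrier M" for v
  proof (rule ccontr)
    assume no: "\<not> ?thesis"
    \<comment> \<open>The sum of C and the line through v. Maximality will force it to equal C, and
      then v itself lies in C.\<close>
    let ?X = "{a \<oplus>\<^bsub>M\<^esub> b |a b. a \<in> C \<and> b \<in> (\<lambda>k. k \<odot>\<^bsub>M\<^esub> v) ` carrier K}"
    have "submodule ((\<lambda>k. k \<odot>\<^bsub>M\<^esub> v) ` carrier K) K M"
    proof (rule M.submoduleI)
      show "(\<lambda>k. k \<odot>\<^bsub>M\<^esub> v) ` carrier K \<subseteq> carrier M"
        using v by auto
      show "\<zero>\<^bsub>M\<^esub> \<in> (\<lambda>k. k \<odot>\<^bsub>M\<^esub> v) ` carrier K"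
        using v by (intro image_eqI[of _ _ "\<zero>\<^bsub>K\<^esub>"]) auto
    qed (use v in \<open>auto simp: M.smult_l_minus[symmetric] M.smult_l_distr[symmetric]
           M.smult_assoc1[symmetric]\<close>)
    then have X: "submodule ?X K M"
      by (rule submodule_sum[OF assms(2) C(1)])
    have CX: "C \<subseteq> ?X"
    proof
      fix c assume "c \<in> C"
      then have "c = c \<oplus>\<^bsub>M\<^esub> \<zero>\<^bsub>K\<^esub> \<odot>\<^bsub>M\<^esub> v"
        using v CE(1) by auto
      then show "c \<in> ?X"
        using \<open>c \<in> C\<close> by blast
    qed
    have "?X \<inter> L \<subseteq> {\<zero>\<^bsub>M\<^esub>}"
    proof
      fix w assume "w \<in> ?X \<inter> L"
      then obtain c k where w: "c \<in> C" "k \<in> carrier K" "w = c \<oplus>\<^bsub>M\<^esub> k \<odot>\<^bsub>M\<^esub> v" "w \<in> L"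
        by auto
      have c: "c \<in> carrier M" "w \<in> carrier M"
        using w CE(1) L(1) by auto
      show "w \<in> {\<zero>\<^bsub>M\<^esub>}"
      proof (cases "k = \<zero>\<^bsub>K\<^esub>")
        case True
        then have "w = c"
          using w v c by simp
        then show ?thesis
          using w C(2) by blast
      next
        \<comment> \<open>Dividing by k writes v as an element of C plus an element of L, contrary
          to the choice of v.\<close>
        case False
        then have k: "inv\<^bsub>K\<^esub> k \<in> carrier K" "inv\<^bsub>K\<^esub> k \<otimes>\<^bsub>K\<^esub> k = \<one>\<^bsub>K\<^esub>"
          using w(2) K.field_Units by auto
        have "k \<odot>\<^bsub>M\<^esub> v = \<ominus>\<^bsub>M\<^esub> c \<oplus>\<^bsub>M\<^esub> w"
          using w c v by (simp add: M.r_neg1)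
        then have "inv\<^bsub>K\<^esub> k \<odot>\<^bsub>M\<^esub> (k \<odot>\<^bsub>M\<^esub> v) = inv\<^bsub>K\<^esub> k \<odot>\<^bsub>M\<^esub> (\<ominus>\<^bsub>M\<^esub> c) \<oplus>\<^bsub>M\<^esub> inv\<^bsub>K\<^esub> k \<odot>\<^bsub>M\<^esub> w"
          using k c by (simp add: M.smult_r_distr)
        then have "v = inv\<^bsub>K\<^esub> k \<odot>\<^bsub>M\<^esub> (\<ominus>\<^bsub>M\<^esub> c) \<oplus>\<^bsub>M\<^esub> inv\<^bsub>K\<^esub> k \<odot>\<^bsub>M\<^esub> w"
          using k w(2) v by (simp add: M.smult_assoc1[symmetric])
        moreover have "inv\<^bsub>K\<^esub> k \<odot>\<^bsub>M\<^esub> (\<ominus>\<^bsub>M\<^esub> c) \<in> C" "inv\<^bsub>K\<^esub> k \<odot>\<^bsub>M\<^esub> w \<in> L"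
          using k(1) w CE(3,4) L(4) by auto
        ultimately show ?thesis
          using no by blast
      qed
    qed
    then have "?X \<inter> L = {\<zero>\<^bsub>M\<^esub>}"
      using submodule_zero_mem[OF X] submodule_zero_mem[OF assms(3)] by blast
    then have "?X = C"
      using max X CX by blast
    moreover have "\<zero>\<^bsub>M\<^esub> \<oplus>\<^bsub>M\<^esub> \<one>\<^bsub>K\<^esub> \<odot>\<^bsub>M\<^esub> v \<in> ?X"
      using submodule_zero_mem[OF C(1)] by blast
    ultimately have "v \<in> C"
      using v by simp
    then have "v = v \<oplus>\<^bsub>M\<^esub> \<zero>\<^bsub>M\<^esub>" "v \<in> C"
      using v by auto
    then show False
      using no submodule_zero_mem[OF assms(3)] by blast
  qed
  then show ?thesis
    using C by blast
qed

text \<open>A surjection restricts to a bijection on a complement of its kernel; the section is the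
  inverse of this restriction.\<close>

lemma linear_section_exists:
  fixes K :: "('k, 'c) ring_scheme"
  assumes "field K" "Module.module K M" "Module.module K N" "linear_map K M N g"
    and surj: "g ` carrier M = carrier N"
  obtains s where "linear_map K N M s" "\<And>w. w \<in> carrier N \<Longrightarrow> g (s w) = w"
proof -
  interpret M: Module.module K M by fact
  interpret N: Module.module K N by fact
  obtain C where C: "submodule C K M" "C \<inter> a_kernel M N g = {\<zero>\<^bsub>M\<^esub>}"
    and dec: "\<forall>v\<in>carrier M. \<exists>c\<in>C. \<exists>l\<in>a_kernel M N g. v = c \<oplus>\<^bsub>M\<^esub> l"
    using complement_exists[OF assms(1,2) submodule_a_kernel[OF assms(2-4)]] by (elim exE conjE)
  note CE = M.submoduleE[OF C(1)]
  have ex: "\<exists>c\<in>C. g c = w" if w: "w \<in> carrier N" for w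
  proof -
    obtain v where v: "v \<in> carrier M" "g v = w"
      using w unfolding surj[symmetric] by blast
    obtain c l where cl: "c \<in> C" "l \<in> a_kernel M N g" "v = c \<oplus>\<^bsub>M\<^esub> l"
      using bspec[OF dec v(1)] by (elim bexE)
    have "c \<in> carrier M" "l \<in> carrier M" "g l = \<zero>\<^bsub>N\<^esub>"
      using cl(1,2) CE(1) by (auto simp: mem_a_kernel)
    then have "g c = w"
      unfolding v(2)[symmetric] cl(3)
      by (simp add: linear_map_add[OF assms(4)] linear_map_closed[OF assms(4)])
    then show ?thesis
      using cl by blast
  qed
  have inj: "c = c'" if c: "c \<in> C" "c' \<in> C" "g c = g c'" for c c'
  proof -
    have cc: "c \<in> carrier M" "c' \<in> carrier M"
      using c CE(1) by auto
    then have "g (c \<ominus>\<^bsub>M\<^esub> c') = \<zero>\<^bsub>N\<^esub>"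
      using linear_map_minus[OF assms(2-4)] linear_map_closed[OF assms(4)] c(3)
      by (simp add: a_minus_def N.r_neg)
    then have "c \<ominus>\<^bsub>M\<^esub> c' \<in> C \<inter> a_kernel M N g"
      using c cc submodule_minus_mem[OF assms(2) C(1)] by (simp add: mem_a_kernel)
    then have "c \<ominus>\<^bsub>M\<^esub> c' = \<zero>\<^bsub>M\<^esub>"
      using C(2) by auto
    then show ?thesis
      using cc by (simp add: M.minus_eq_zero_iff)
  qed
  define s where "s w = (SOME c. c \<in> C \<and> g c = w)" for w
  have s: "s w \<in> C" "g (s w) = w" if "w \<in> carrier N" for w
    using someI_ex[OF ex[OF that, unfolded Bex_def]] by (simp_all add: s_def)
  have sM: "s w \<in> carrier M" if "w \<in> carrier N" for w
    using s(1)[OF that] CE(1) by auto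
  have "linear_map K N M s"
  proof (rule linear_mapI)
    fix u v assume uv: "u \<in> carrier N" "v \<in> carrier N"
    show "s (u \<oplus>\<^bsub>N\<^esub> v) = s u \<oplus>\<^bsub>M\<^esub> s v"
      using uv s sM by (intro inj) (simp_all add: CE(5) linear_map_add[OF assms(4)])
  next
    fix a v assume av: "a \<in> carrier K" "v \<in> carrier N"
    show "s (a \<odot>\<^bsub>N\<^esub> v) = a \<odot>\<^bsub>M\<^esub> s v"
      using av s sM by (intro inj) (simp_all add: CE(4) linear_map_smult[OF assms(4)])
  qed (use sM in auto)
  then show thesis
    using s(2) by (rule that)
qed

section \<open>Young modules\<close>

abbreviation elts :: "('k, 'v) ymodule \<Rightarrow> young \<Rightarrow> 'v set" where
  "elts V x \<equiv> carrier (yob V x)"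

lemma young_moduleI:
  assumes "\<And>x. Module.module K (yob V x)"
    and "\<And>x y. x \<le> y \<Longrightarrow> linear_map K (yob V x) (yob V y) (ytr V x y)"
    and "\<And>x v. v \<in> elts V x \<Longrightarrow> ytr V x x v = v"
    and "\<And>x y z v. \<lbrakk>x \<le> y; y \<le> z; v \<in> elts V x\<rbrakk> \<Longrightarrow> ytr V y z (ytr V x y v) = ytr V x z v"
  shows "young_module K V"
  using assms by (auto simp: young_module_def)

lemma young_moduleD:
  assumes "young_module K V"
  shows "Module.module K (yob V x)"
    and "x \<le> y \<Longrightarrow> linear_map K (yob V x) (yob V y) (ytr V x y)"
    and "v \<in> elts V x \<Longrightarrow> ytr V x x v = v"
    and "\<lbrakk>x \<le> y; y \<le> z; v \<in> elts V x\<rbrakk> \<Longrightarrow> ytr V y z (ytr V x y v) = ytr V x z v"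
  using assms by (auto simp: young_module_def)

lemma ytr_closed:
  "\<lbrakk>young_module K V; x \<le> y; v \<in> elts V x\<rbrakk> \<Longrightarrow> ytr V x y v \<in> elts V y"
  by (blast intro: linear_map_closed young_moduleD(2))

lemma yhomI:
  assumes "\<And>x. linear_map K (yob V x) (yob W x) (f x)"
    and "\<And>x y v. \<lbrakk>x \<le> y; v \<in> elts V x\<rbrakk> \<Longrightarrow> f y (ytr V x y v) = ytr W x y (f x v)"
    and "\<And>x. f x \<in> extensional (elts V x)"
  shows "f \<in> yhom K V W"
  using assms by (auto simp: yhom_def)

lemma yhom_restrictI:
  assumes "young_module K V"
    and "\<And>x. linear_map K (yob V x) (yob W x) (f x)"
    and "\<And>x y v. \<lbrakk>x \<le> y; v \<in> elts V x\<rbrakk> \<Longrightarrow> f y (ytr V x y v) = ytr W x y (f x v)"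
  shows "(\<lambda>x. restrict (f x) (elts V x)) \<in> yhom K V W"
proof (rule yhomI)
  fix x
  show "linear_map K (yob V x) (yob W x) (restrict (f x) (elts V x))"
    by (rule linear_map_cong[OF young_moduleD(1)[OF assms(1)] assms(2)]) auto
qed (use assms ytr_closed[OF assms(1)] in auto)

lemma yhomD:
  assumes "f \<in> yhom K V W"
  shows "linear_map K (yob V x) (yob W x) (f x)"
    and "\<lbrakk>x \<le> y; v \<in> elts V x\<rbrakk> \<Longrightarrow> f y (ytr V x y v) = ytr W x y (f x v)"
    and "f x \<in> extensional (elts V x)"
  using assms by (auto simp: yhom_def)

lemma yhom_closed: "\<lbrakk>f \<in> yhom K V W; v \<in> elts V x\<rbrakk> \<Longrightarrow> f x v \<in> elts W x"
  by (blast intro: linear_map_closed yhomD(1))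

lemmas yhom_add = linear_map_add[OF yhomD(1)]
  and yhom_smult = linear_map_smult[OF yhomD(1)]
  and yhom_zero = linear_map_zero[OF young_moduleD(1) young_moduleD(1) yhomD(1)]
  and ytr_add = linear_map_add[OF young_moduleD(2)]
  and ytr_smult = linear_map_smult[OF young_moduleD(2)]

lemma yhom_eqI:
  assumes "f \<in> yhom K V W" "g \<in> yhom K V W'"
    and "\<And>x v. v \<in> elts V x \<Longrightarrow> f x v = g x v"
  shows "f = g"
proof
  fix x show "f x = g x"
    using yhomD(3)[OF assms(1)] yhomD(3)[OF assms(2)] assms(3) by (rule extensionalityI)
qed

lemma yhom_comp:
  assumes "f \<in> yhom K U V" "g \<in> yhom K V W" "young_module K U"
  shows "(\<lambda>x. compose (elts U x) (g x) (f x)) \<in> yhom K U W"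
proof -
  have "(\<lambda>x. \<lambda>v\<in>elts U x. g x (f x v)) \<in> yhom K U W"
  proof (rule yhom_restrictI[OF assms(3)])
    show "linear_map K (yob U x) (yob W x) (\<lambda>v. g x (f x v))" for x
      by (rule linear_map_comp[OF yhomD(1)[OF assms(1)] yhomD(1)[OF assms(2)]])
    show "g y (f y (ytr U x y v)) = ytr W x y (g x (f x v))"
      if "x \<le> y" "v \<in> elts U x" for x y v
      using that by (simp add: yhomD(2)[OF assms(1)] yhomD(2)[OF assms(2)] yhom_closed[OF assms(1)])
  qed
  then show ?thesis
    by (simp add: compose_def)
qed

subsection \<open>Submodules generated by prescribed degrees\<close>

text \<open>The value at x of the submodule of V generated by the V_y with y in \<open>A\<close>.
  Degrees in \<open>A\<close> that are not below x contribute nothing at x, so one set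
  \<open>A\<close> can be kept while x varies.\<close>

definition span_from ::
    "('k, 'c) ring_scheme \<Rightarrow> ('k, 'v) ymodule \<Rightarrow> young set \<Rightarrow> young \<Rightarrow> 'v set" where
  "span_from K V A x = \<Inter>{N. submodule N K (yob V x) \<and>
     (\<forall>y\<in>A. y \<le> x \<longrightarrow> ytr V y x ` elts V y \<subseteq> N)}"

lemma aug_sub_eq_span_from: "aug_sub K V x = span_from K V {y. y < x} x"
  unfolding aug_sub_def span_from_def
  by (intro arg_cong[where f = Inter] Collect_cong) (auto simp: less_imp_le)

lemma submodule_span_from:
  assumes "young_module K V"
  shows "submodule (span_from K V A x) K (yob V x)"
proof -
  have "elts V x \<in> {N. submodule N K (yob V x) \<and>
     (\<forall>y\<in>A. y \<le> x \<longrightarrow> ytr V y x ` elts V y \<subseteq> N)}"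
    using Module.module.carrier_is_submodule[OF young_moduleD(1)[OF assms]] ytr_closed[OF assms]
    by auto
  then show ?thesis
    unfolding span_from_def by (intro submodule_Inter young_moduleD(1)[OF assms]) auto
qed

lemma submodule_aug_sub: "young_module K V \<Longrightarrow> submodule (aug_sub K V x) K (yob V x)"
  by (simp add: aug_sub_eq_span_from submodule_span_from)

lemma span_from_carrier:
  "\<lbrakk>young_module K V; v \<in> span_from K V A x\<rbrakk> \<Longrightarrow> v \<in> elts V x"
  using Module.module.submoduleE(1)[OF young_moduleD(1) submodule_span_from] by blast

lemma span_from_ytr:
  "\<lbrakk>y \<in> A; y \<le> x; v \<in> elts V y\<rbrakk> \<Longrightarrow> ytr V y x v \<in> span_from K V A x"
  by (auto simp: span_from_def)

text \<open>The induction principle for generated submodules: N is usually the set of elements with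
  the property to be shown, a submodule by \<open>submodule_vimage\<close> or
  \<open>submodule_sum\<close>.\<close>

lemma span_from_least:
  assumes "submodule N K (yob V x)"
    and "\<And>y v. \<lbrakk>y \<in> A; y \<le> x; v \<in> elts V y\<rbrakk> \<Longrightarrow> ytr V y x v \<in> N"
  shows "span_from K V A x \<subseteq> N"
  using assms unfolding span_from_def by (intro Inter_lower) auto

lemma span_from_mono:
  assumes "young_module K V" "\<And>y. \<lbrakk>y \<in> A; y \<le> x\<rbrakk> \<Longrightarrow> y \<in> B"
  shows "span_from K V A x \<subseteq> span_from K V B x"
  by (intro span_from_least submodule_span_from[OF assms(1)] span_from_ytr assms(2)) auto

lemma span_from_push:
  assumes "young_module K V" "x \<le> x'" "v \<in> span_from K V A x"
  shows "ytr V x x' v \<in> span_from K V A x'"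
proof -
  have "span_from K V A x \<subseteq> {v \<in> elts V x. ytr V x x' v \<in> span_from K V A x'}"
  proof (rule span_from_least)
    show "submodule {v \<in> elts V x. ytr V x x' v \<in> span_from K V A x'} K (yob V x)"
      by (rule submodule_vimage[OF young_moduleD(1)[OF assms(1)] young_moduleD(1)[OF assms(1)]
          young_moduleD(2)[OF assms(1,2)] submodule_span_from[OF assms(1)]])
  next
    fix y v assume "y \<in> A" "y \<le> x" "v \<in> elts V y"
    then show "ytr V y x v \<in> {v \<in> elts V x. ytr V x x' v \<in> span_from K V A x'}"
      using assms(2) by (auto simp: ytr_closed[OF assms(1)] young_moduleD(4)[OF assms(1)]
          intro!: span_from_ytr intro: order_trans)
  qed
  then show ?thesis
    using assms(3) by auto
qed

lemma span_from_hom: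
  assumes "young_module K V" "young_module K W" "f \<in> yhom K V W" "v \<in> span_from K V A x"
  shows "f x v \<in> span_from K W A x"
proof -
  have "span_from K V A x \<subseteq> {v \<in> elts V x. f x v \<in> span_from K W A x}"
  proof (rule span_from_least)
    show "submodule {v \<in> elts V x. f x v \<in> span_from K W A x} K (yob V x)"
      by (rule submodule_vimage[OF young_moduleD(1)[OF assms(1)] young_moduleD(1)[OF assms(2)]
          yhomD(1)[OF assms(3)] submodule_span_from[OF assms(2)]])
  next
    fix y v assume "y \<in> A" "y \<le> x" "v \<in> elts V y"
    then show "ytr V y x v \<in> {v \<in> elts V x. f x v \<in> span_from K W A x}"
      by (auto simp: ytr_closed[OF assms(1)] yhomD(2)[OF assms(3)] yhom_closed[OF assms(3)]
          intro!: span_from_ytr)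
  qed
  then show ?thesis
    using assms(4) by auto
qed

lemma aug_sub_hom:
  "\<lbrakk>young_module K V; young_module K W; f \<in> yhom K V W; v \<in> aug_sub K V x\<rbrakk>
    \<Longrightarrow> f x v \<in> aug_sub K W x"
  by (simp add: aug_sub_eq_span_from span_from_hom)

lemma ysurjD:
  assumes "ysurj V W f" "w \<in> elts W x"
  obtains v where "v \<in> elts V x" "f x v = w"
proof -
  have "w \<in> f x ` elts V x"
    using assms by (simp add: ysurj_def)
  then show thesis
    using that by auto
qed

text \<open>Splits off the contribution of a single degree; this is how a relation is stripped of
  its degrees one by one.\<close>

lemma span_from_insert:
  assumes "young_module K V" "a \<le> x" "v \<in> span_from K V (insert a A) x"
  obtains u w where "u \<in> elts V a" "w \<in> span_from K V A x"
    "v = ytr V a x u \<oplus>\<^bsub>yob V x\<^esub> w"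
proof -
  interpret M: Module.module K "yob V x"
    by (rule young_moduleD(1)[OF assms(1)])
  let ?N = "{b \<oplus>\<^bsub>yob V x\<^esub> w |b w. b \<in> ytr V a x ` elts V a \<and> w \<in> span_from K V A x}"
  have im: "submodule (ytr V a x ` elts V a) K (yob V x)"
    by (intro submodule_image[OF _ _ young_moduleD(2)[OF assms(1,2)]] young_moduleD(1)[OF assms(1)]
        Module.module.carrier_is_submodule)
  have "span_from K V (insert a A) x \<subseteq> ?N"
  proof (rule span_from_least)
    show "submodule ?N K (yob V x)"
      by (rule submodule_sum[OF young_moduleD(1)[OF assms(1)] im submodule_span_from[OF assms(1)]])
  next
    fix y v assume y: "y \<in> insert a A" "y \<le> x" "v \<in> elts V y"
    have c: "ytr V y x v \<in> elts V x"
      by (rule ytr_closed[OF assms(1) y(2,3)])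
    show "ytr V y x v \<in> ?N"
    proof (cases "y = a")
      case True
      have "ytr V y x v = ytr V y x v \<oplus>\<^bsub>yob V x\<^esub> \<zero>\<^bsub>yob V x\<^esub>"
        using c by simp
      then show ?thesis
        using submodule_zero_mem[OF submodule_span_from[OF assms(1)]] True y by blast
    next
      case False
      have "ytr V y x v = \<zero>\<^bsub>yob V x\<^esub> \<oplus>\<^bsub>yob V x\<^esub> ytr V y x v"
        using c by simp
      moreover have "ytr V y x v \<in> span_from K V A x"
        using y False by (auto intro: span_from_ytr)
      ultimately show ?thesis
        using submodule_zero_mem[OF im] by blast
    qed
  qed
  then show thesis
    using assms(3) that by blast
qed

subsection \<open>Coordinates\<close>

text \<open>
  What remains of a homogeneous basis after passing to a direct summand of a free module:
  functionals \<open>c y x\<close> on \<open>P\<^sub>x\<close> that extract the component generated in degree \<open>y\<close>.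
\<close>

definition coordinates ::
    "('k, 'c) ring_scheme \<Rightarrow> ('k, 'v) ymodule \<Rightarrow> (young \<Rightarrow> ('k, 'w) module) \<Rightarrow>
      (young \<Rightarrow> young \<Rightarrow> 'v \<Rightarrow> 'w) \<Rightarrow> bool" where
  "coordinates K P E c \<longleftrightarrow> young_module K P \<and>
     (\<forall>y. Module.module K (E y)) \<and>
     (\<forall>y x. linear_map K (yob P x) (E y) (c y x)) \<and>
     (\<forall>y x x' p. x \<le> x' \<longrightarrow> p \<in> elts P x \<longrightarrow> c y x' (ytr P x x' p) = c y x p) \<and>
     (\<forall>y x p. \<not> y \<le> x \<longrightarrow> p \<in> elts P x \<longrightarrow> c y x p = \<zero>\<^bsub>E y\<^esub>) \<and>
     (\<forall>y. \<forall>p\<in>elts P y. c y y p = \<zero>\<^bsub>E y\<^esub> \<longrightarrow> p \<in> aug_sub K P y) \<and>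
     (\<forall>x. \<forall>p\<in>elts P x. (\<forall>y. c y x p = \<zero>\<^bsub>E y\<^esub>) \<longrightarrow> p = \<zero>\<^bsub>yob P x\<^esub>)"

lemma coordinatesD:
  assumes "coordinates K P E c"
  shows "young_module K P"
    and "Module.module K (E y)"
    and "linear_map K (yob P x) (E y) (c y x)"
    and "\<lbrakk>x \<le> x'; p \<in> elts P x\<rbrakk> \<Longrightarrow> c y x' (ytr P x x' p) = c y x p"
    and "\<lbrakk>\<not> y \<le> x; p \<in> elts P x\<rbrakk> \<Longrightarrow> c y x p = \<zero>\<^bsub>E y\<^esub>"
    and "\<lbrakk>p \<in> elts P y; c y y p = \<zero>\<^bsub>E y\<^esub>\<rbrakk> \<Longrightarrow> p \<in> aug_sub K P y"
    and "\<lbrakk>p \<in> elts P x; \<And>y. c y x p = \<zero>\<^bsub>E y\<^esub>\<rbrakk> \<Longrightarrow> p = \<zero>\<^bsub>yob P x\<^esub>"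
  using assms by (simp_all add: coordinates_def)

text \<open>Coordinates are unchanged by the maps of P and jointly detect 0, so these maps are
  injective as in a free module.\<close>

lemma coordinates_injective:
  assumes "coordinates K P E c" "x \<le> x'" "p \<in> elts P x" "ytr P x x' p = \<zero>\<^bsub>yob P x'\<^esub>"
  shows "p = \<zero>\<^bsub>yob P x\<^esub>"
proof (rule coordinatesD(7)[OF assms(1,3)])
  fix y
  show "c y x p = \<zero>\<^bsub>E y\<^esub>"
    using coordinatesD(4)[OF assms(1-3), of y]
      linear_map_zero[OF young_moduleD(1)[OF coordinatesD(1)[OF assms(1)]]
        coordinatesD(2)[OF assms(1)] coordinatesD(3)[OF assms(1)]]
    by (simp add: assms(4))
qed

text \<open>An element of degree z has a component of degree y only if y \<le> z, and this passes to
  everything generated by such elements.\<close>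

lemma coordinates_span_from:
  assumes "coordinates K P E c" "p \<in> span_from K P A x" "\<And>z. \<lbrakk>z \<in> A; z \<le> x\<rbrakk> \<Longrightarrow> \<not> y \<le> z"
  shows "c y x p = \<zero>\<^bsub>E y\<^esub>"
proof -
  note P = coordinatesD(1)[OF assms(1)]
  have "span_from K P A x \<subseteq> {p \<in> elts P x. c y x p \<in> {\<zero>\<^bsub>E y\<^esub>}}"
  proof (rule span_from_least)
    show "submodule {p \<in> elts P x. c y x p \<in> {\<zero>\<^bsub>E y\<^esub>}} K (yob P x)"
      by (rule submodule_vimage[OF young_moduleD(1)[OF P] coordinatesD(2)[OF assms(1)]
          coordinatesD(3)[OF assms(1)] submodule_trivial[OF coordinatesD(2)[OF assms(1)]]])
  next
    fix z p assume "z \<in> A" "z \<le> x" "p \<in> elts P z"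
    then show "ytr P z x p \<in> {p \<in> elts P x. c y x p \<in> {\<zero>\<^bsub>E y\<^esub>}}"
      using assms(3) coordinatesD(4,5)[OF assms(1)] ytr_closed[OF P] by simp
  qed
  then show ?thesis
    using assms(2) by auto
qed

text \<open>Coordinates are pulled back along i. If the component of p in its own degree vanishes,
  then i p lies in \<open>aug_sub\<close> of F; natural transformations preserve
  \<open>aug_sub\<close>, so r carries this back to p.\<close>

lemma coordinates_retract:
  assumes "coordinates K F E c" "young_module K P" "i \<in> yhom K P F" "r \<in> yhom K F P"
    and ri: "\<And>x p. p \<in> elts P x \<Longrightarrow> r x (i x p) = p"
  shows "coordinates K P E (\<lambda>y x p. c y x (i x p))"
proof -
  note F = coordinatesD(1)[OF assms(1)]
  note ic = yhom_closed[OF assms(3)]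
  have "p \<in> aug_sub K P y" if "p \<in> elts P y" "c y y (i y p) = \<zero>\<^bsub>E y\<^esub>" for y p
    using aug_sub_hom[OF F assms(2,4) coordinatesD(6)[OF assms(1) ic[OF that(1)] that(2)]] ri that
    by simp
  moreover have "p = \<zero>\<^bsub>yob P x\<^esub>" if "p \<in> elts P x" "\<forall>y. c y x (i x p) = \<zero>\<^bsub>E y\<^esub>" for x p
  proof -
    have "i x p = \<zero>\<^bsub>yob F x\<^esub>"
      using that(2) by (intro coordinatesD(7)[OF assms(1) ic[OF that(1)]]) simp
    then show ?thesis
      using ri[OF that(1)] yhom_zero[OF F assms(2) assms(4), of x]
      by simp
  qed
  ultimately show ?thesis
    unfolding coordinates_def
    using assms(2) coordinatesD(2,4,5)[OF assms(1)] ic yhomD(2)[OF assms(3)]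
      linear_map_comp[OF yhomD(1)[OF assms(3)] coordinatesD(3)[OF assms(1)]]
    by simp
qed

subsection \<open>Transport along injections, submodules and quotients\<close>

text \<open>Transport of structure, meant for \<phi> injective on the carrier. It brings modules
  built over functions, cosets or pairs back into the type of the given module.\<close>

definition transport_module :: "('k, 'w) module \<Rightarrow> ('w \<Rightarrow> 'v) \<Rightarrow> ('k, 'v) module" where
  "transport_module M \<phi> = (let \<psi> = inv_into (carrier M) \<phi> in
     \<lparr>carrier = \<phi> ` carrier M, mult = undefined, one = undefined, zero = \<phi> \<zero>\<^bsub>M\<^esub>,
      add = (\<lambda>u v. \<phi> (\<psi> u \<oplus>\<^bsub>M\<^esub> \<psi> v)), smult = (\<lambda>a v. \<phi> (a \<odot>\<^bsub>M\<^esub> \<psi> v))\<rparr>)"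

lemma transport_module:
  assumes "Module.module K M" "inj_on \<phi> (carrier M)"
  shows "Module.module K (transport_module M \<phi>)"
    and "linear_map K M (transport_module M \<phi>) \<phi>"
    and "linear_map K (transport_module M \<phi>) M (inv_into (carrier M) \<phi>)"
proof -
  interpret M: Module.module K M by fact
  note inv [simp] = inv_into_f_f[OF assms(2)]
  have [simp]: "carrier (transport_module M \<phi>) = \<phi> ` carrier M"
    "\<zero>\<^bsub>transport_module M \<phi>\<^esub> = \<phi> \<zero>\<^bsub>M\<^esub>"
    by (simp_all add: transport_module_def Let_def)
  have [simp]: "\<lbrakk>u \<in> carrier M; v \<in> carrier M\<rbrakk> \<Longrightarrow> \<phi> u \<oplus>\<^bsub>transport_module M \<phi>\<^esub> \<phi> v = \<phi> (u \<oplus>\<^bsub>M\<^esub> v)"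
    "v \<in> carrier M \<Longrightarrow> a \<odot>\<^bsub>transport_module M \<phi>\<^esub> \<phi> v = \<phi> (a \<odot>\<^bsub>M\<^esub> v)" for u v a
    by (simp_all add: transport_module_def Let_def)
  show "Module.module K (transport_module M \<phi>)"
  proof (rule moduleI)
    show "cring K" ..
    show "abelian_group (transport_module M \<phi>)"
    proof (rule abelian_groupI)
      fix A assume "A \<in> carrier (transport_module M \<phi>)"
      then obtain v where v: "v \<in> carrier M" "A = \<phi> v"
        by auto
      then show "\<exists>B\<in>carrier (transport_module M \<phi>). B \<oplus>\<^bsub>transport_module M \<phi>\<^esub> A = \<zero>\<^bsub>transport_module M \<phi>\<^esub>"
        by (intro bexI[of _ "\<phi> (\<ominus>\<^bsub>M\<^esub> v)"]) (auto simp: M.l_neg)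
    qed (auto simp: M.a_ac)
  qed (auto simp: M.smult_l_distr M.smult_r_distr M.smult_assoc1)
  show "linear_map K M (transport_module M \<phi>) \<phi>"
    by (rule linear_mapI) auto
  show "linear_map K (transport_module M \<phi>) M (inv_into (carrier M) \<phi>)"
    by (rule linear_mapI) auto
qed

text \<open>The injections at different x are unrelated to each other. Naturality is built in, since
  the new transition maps are the old ones conjugated by the injections.\<close>

lemma transport_ymodule:
  fixes W :: "('k, 'w) ymodule" and K :: "('k, 'c) ring_scheme"
  assumes "young_module K W" "\<And>x. \<exists>\<phi> :: 'w \<Rightarrow> 'v. inj_on \<phi> (elts W x)"
  obtains T :: "('k, 'v) ymodule" and f g where "young_module K T" "f \<in> yhom K W T" "g \<in> yhom K T W"
    "\<And>x w. w \<in> elts W x \<Longrightarrow> g x (f x w) = w"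
    "\<And>x t. t \<in> elts T x \<Longrightarrow> f x (g x t) = t"
proof -
  obtain \<phi> :: "young \<Rightarrow> 'w \<Rightarrow> 'v" where inj: "\<And>x. inj_on (\<phi> x) (elts W x)"
    using assms(2) by metis
  define \<psi> where "\<psi> x = inv_into (elts W x) (\<phi> x)" for x
  define T where "T = \<lparr>yob = \<lambda>x. transport_module (yob W x) (\<phi> x),
    ytr = \<lambda>x y v. \<phi> y (ytr W x y (\<psi> x v))\<rparr>"
  have yob: "yob T x = transport_module (yob W x) (\<phi> x)" for x
    by (simp add: T_def)
  have ytr: "ytr T x y v = \<phi> y (ytr W x y (\<psi> x v))" for x y v
    by (simp add: T_def)
  note WM = young_moduleD(1)[OF assms(1)]
  note tm = transport_module[OF WM inj]
  have carr: "elts T x = \<phi> x ` elts W x" for x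
    by (simp add: yob transport_module_def Let_def)
  have \<psi>: "\<psi> x (\<phi> x w) = w" if "w \<in> elts W x" for x w
    using that inj by (simp add: \<psi>_def)
  have l1: "linear_map K (yob W x) (yob T x) (\<phi> x)" and l2: "linear_map K (yob T x) (yob W x) (\<psi> x)" for x
    using tm(2,3)[of x] by (simp_all add: yob \<psi>_def)
  have T: "young_module K T"
  proof (rule young_moduleI)
    show "Module.module K (yob T x)" for x
      using tm(1) by (simp add: yob)
    show "linear_map K (yob T x) (yob T y) (ytr T x y)" if "x \<le> y" for x y
      using linear_map_comp[OF linear_map_comp[OF l2 young_moduleD(2)[OF assms(1) that]] l1]
      by (rule linear_map_cong[rotated]) (auto simp: ytr yob tm(1))
  qed (auto simp: carr ytr \<psi> ytr_closed[OF assms(1)] young_moduleD(3,4)[OF assms(1)])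
  show thesis
  proof (rule that[OF T])
    show "(\<lambda>x. restrict (\<phi> x) (elts W x)) \<in> yhom K W T"
      by (rule yhom_restrictI[OF assms(1) l1]) (simp add: ytr \<psi>)
    show "(\<lambda>x. restrict (\<psi> x) (elts T x)) \<in> yhom K T W"
      by (rule yhom_restrictI[OF T l2]) (auto simp: carr ytr \<psi> ytr_closed[OF assms(1)])
  qed (auto simp: carr \<psi>)
qed

lemma young_module_sub:
  assumes "young_module K V" "\<And>x. submodule (N x) K (yob V x)"
    and "\<And>x y v. \<lbrakk>x \<le> y; v \<in> N x\<rbrakk> \<Longrightarrow> ytr V x y v \<in> N y"
  shows "young_module K (sub_ymodule V N)"
    and "(\<lambda>x. restrict (\<lambda>v. v) (N x)) \<in> yhom K (sub_ymodule V N) V"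
proof -
  have N: "v \<in> elts V x" if "v \<in> N x" for v x
    using Module.module.submoduleE(1)[OF young_moduleD(1)[OF assms(1)] assms(2)] that by blast
  show Y: "young_module K (sub_ymodule V N)"
  proof (rule young_moduleI)
    show "Module.module K (yob (sub_ymodule V N) x)" for x
      unfolding sub_ymodule_def
      by (simp add: submodule.submodule_is_module[OF assms(2) young_moduleD(1)[OF assms(1)]])
    show "linear_map K (yob (sub_ymodule V N) x) (yob (sub_ymodule V N) y) (ytr (sub_ymodule V N) x y)"
      if "x \<le> y" for x y
      using young_moduleD(2)[OF assms(1) that] assms(3)[OF that] N
      by (intro linear_mapI) (auto simp: sub_ymodule_def linear_map_add linear_map_smult)
  qed (auto simp: sub_ymodule_def N young_moduleD(3,4)[OF assms(1)])
  have c: "elts (sub_ymodule V N) x = N x" for x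
    by (simp add: sub_ymodule_def)
  have "(\<lambda>x. restrict (\<lambda>v. v) (elts (sub_ymodule V N) x)) \<in> yhom K (sub_ymodule V N) V"
    by (rule yhom_restrictI[OF Y]) (auto simp: sub_ymodule_def N linear_map_def)
  then show "(\<lambda>x. restrict (\<lambda>v. v) (N x)) \<in> yhom K (sub_ymodule V N) V"
    by (simp add: c)
qed

lemma young_module_quot:
  assumes "young_module K V" "\<And>x. submodule (N x) K (yob V x)"
    and "\<And>x y v. \<lbrakk>x \<le> y; v \<in> N x\<rbrakk> \<Longrightarrow> ytr V x y v \<in> N y"
  shows "young_module K (quot_ymodule V N)"
    and "(\<lambda>x. \<lambda>v\<in>elts V x. N x +>\<^bsub>yob V x\<^esub> v) \<in> yhom K V (quot_ymodule V N)"
proof -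
  note VM = young_moduleD(1)[OF assms(1)]
  note carr = quot_module_carrier[OF VM assms(2)]
  have q: "quot_map (yob V y) (N y) (ytr V x y) (N x +>\<^bsub>yob V x\<^esub> v) = N y +>\<^bsub>yob V y\<^esub> ytr V x y v"
    if "x \<le> y" "v \<in> elts V x" for x y v
    using assms(3) that by (intro quot_map_coset[OF VM assms(2) VM assms(2) young_moduleD(2)[OF assms(1)]]) auto
  show Y: "young_module K (quot_ymodule V N)"
  proof (rule young_moduleI)
    show "Module.module K (yob (quot_ymodule V N) x)" for x
      using quot_module_module[OF VM assms(2)] by (simp add: quot_ymodule_def)
    show "linear_map K (yob (quot_ymodule V N) x) (yob (quot_ymodule V N) y) (ytr (quot_ymodule V N) x y)"
      if "x \<le> y" for x y
      using quot_map_linear[OF VM assms(2) VM assms(2) young_moduleD(2)[OF assms(1) that]] assms(3) that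
      by (auto simp: quot_ymodule_def)
  qed (auto simp: quot_ymodule_def carr q ytr_closed[OF assms(1)] young_moduleD(3,4)[OF assms(1)]
        intro: order_trans)
  show "(\<lambda>x. \<lambda>v\<in>elts V x. N x +>\<^bsub>yob V x\<^esub> v) \<in> yhom K V (quot_ymodule V N)"
    using quot_module_proj[OF VM assms(2)]
    by (intro yhom_restrictI[OF assms(1)]) (auto simp: quot_ymodule_def q)
qed

section \<open>Projective covers\<close>

lemma linear_map_finsum:
  assumes "Module.module K M" "Module.module K N" "linear_map K M N f"
    and "finite A" "g \<in> A \<rightarrow> carrier M"
  shows "f (finsum M g A) = finsum N (\<lambda>i. f (g i)) A"
proof -
  interpret M: Module.module K M by fact
  interpret N: Module.module K N by fact
  show ?thesis
    using assms(4,5)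
  proof (induction A rule: finite_induct)
    case empty
    then show ?case
      by (simp add: linear_map_zero[OF assms(1-3)])
  next
    case (insert a A)
    then have "g \<in> A \<rightarrow> carrier M" "g a \<in> carrier M"
      by auto
    then show ?case
      using insert
      by (simp add: M.finsum_insert N.finsum_insert linear_map_add[OF assms(3)] M.finsum_closed
          linear_map_closed[OF assms(3)] Pi_iff)
  qed
qed

text \<open>
  The module freely generated by the vector spaces \<open>V\<^sub>y\<close>, each placed in degree \<open>y\<close>. Its value at
  \<open>x\<close> is the direct sum of the \<open>V\<^sub>y\<close> with \<open>y \<le> x\<close>, and the maps are inclusions.
\<close>

definition free_ymodule :: "('k, 'v) ymodule \<Rightarrow> ('k, young \<Rightarrow> 'v) ymodule" where
  "free_ymodule V = \<lparr>yob = (\<lambda>x.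
      \<lparr>carrier = {f. (\<forall>y. f y \<in> elts V y) \<and> (\<forall>y. \<not> y \<le> x \<longrightarrow> f y = \<zero>\<^bsub>yob V y\<^esub>)},
       mult = undefined, one = undefined, zero = (\<lambda>y. \<zero>\<^bsub>yob V y\<^esub>),
       add = (\<lambda>f g y. f y \<oplus>\<^bsub>yob V y\<^esub> g y), smult = (\<lambda>a f y. a \<odot>\<^bsub>yob V y\<^esub> f y)\<rparr>),
     ytr = (\<lambda>x y f. f)\<rparr>"

definition free_single :: "('k, 'v) ymodule \<Rightarrow> young \<Rightarrow> 'v \<Rightarrow> young \<Rightarrow> 'v" where
  "free_single V y v = (\<lambda>z. if z = y then v else \<zero>\<^bsub>yob V z\<^esub>)"

context
  fixes K :: "('k, 'c) ring_scheme" and V :: "('k, 'v) ymodule"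
  assumes V: "young_module K V"
begin

private abbreviation (input) "F \<equiv> free_ymodule V"

interpretation V: Module.module K "yob V x" for x
  by (rule young_moduleD(1)[OF V])

lemma free_carrier: "f \<in> elts F x \<longleftrightarrow>
    (\<forall>y. f y \<in> elts V y) \<and> (\<forall>y. \<not> y \<le> x \<longrightarrow> f y = \<zero>\<^bsub>yob V y\<^esub>)"
  and free_zero: "\<zero>\<^bsub>yob F x\<^esub> = (\<lambda>y. \<zero>\<^bsub>yob V y\<^esub>)"
  and free_add: "f \<oplus>\<^bsub>yob F x\<^esub> g = (\<lambda>y. f y \<oplus>\<^bsub>yob V y\<^esub> g y)"
  and free_smult: "a \<odot>\<^bsub>yob F x\<^esub> f = (\<lambda>y. a \<odot>\<^bsub>yob V y\<^esub> f y)"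
  and free_ytr: "ytr F x x' f = f"
  by (simp_all add: free_ymodule_def)

lemma free_module: "Module.module K (yob F x)"
proof (rule moduleI)
  show "cring K" ..
  show "abelian_group (yob F x)"
  proof (rule abelian_groupI)
    fix f assume f: "f \<in> elts F x"
    then have "(\<lambda>y. \<ominus>\<^bsub>yob V y\<^esub> f y) \<in> elts F x"
      by (simp add: free_carrier)
    moreover have "(\<lambda>y. \<ominus>\<^bsub>yob V y\<^esub> f y) \<oplus>\<^bsub>yob F x\<^esub> f = \<zero>\<^bsub>yob F x\<^esub>"
      using f by (simp add: free_carrier free_add free_zero V.l_neg)
    ultimately show "\<exists>g\<in>elts F x. g \<oplus>\<^bsub>yob F x\<^esub> f = \<zero>\<^bsub>yob F x\<^esub>"
      by blast
  qed (simp_all add: free_carrier free_add free_zero V.a_ac)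
qed (simp_all add: free_carrier free_add free_smult V.smult_l_distr V.smult_r_distr V.smult_assoc1)

lemma young_module_free: "young_module K F"
proof (rule young_moduleI)
  fix x y :: young assume "x \<le> y"
  then show "linear_map K (yob F x) (yob F y) (ytr F x y)"
    by (intro linear_mapI) (auto simp: free_carrier free_add free_smult free_ytr intro: order_trans)
qed (simp_all add: free_module free_ytr)

lemma free_single_closed: "\<lbrakk>v \<in> elts V y; y \<le> x\<rbrakk> \<Longrightarrow> free_single V y v \<in> elts F x"
  by (auto simp: free_carrier free_single_def)

lemma free_single_linear: "linear_map K (yob V y) (yob F y) (free_single V y)"
  by (rule linear_mapI)
    (simp add: free_single_closed, simp_all add: fun_eq_iff free_add free_smult free_single_def)

text \<open>An element at x is supported in the finitely many degrees below x, hence is a finite sum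
  of elements concentrated in one degree.\<close>

lemma free_span:
  assumes "submodule N K (yob F x)" "f \<in> elts F x"
    and "\<And>y. \<lbrakk>y \<le> x; f y \<noteq> \<zero>\<^bsub>yob V y\<^esub>\<rbrakk> \<Longrightarrow> free_single V y (f y) \<in> N"
  shows "f \<in> N"
proof -
  have gen: "f \<in> N" if "finite A" "f \<in> elts F x" "\<forall>y. y \<notin> A \<longrightarrow> f y = \<zero>\<^bsub>yob V y\<^esub>"
    "\<forall>y\<in>A. free_single V y (f y) \<in> N" for A f
    using that
  proof (induction A arbitrary: f rule: finite_induct)
    case empty
    then have "f = \<zero>\<^bsub>yob F x\<^esub>"
      by (simp add: free_zero fun_eq_iff)
    then show ?case
      using submodule_zero_mem[OF assms(1)] by simp
  next
    case (insert a A)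
    let ?g = "f(a := \<zero>\<^bsub>yob V a\<^esub>)"
    have g: "?g \<in> elts F x"
      using insert.prems(1) by (simp add: free_carrier)
    have gN: "?g \<in> N"
    proof (rule insert.IH[OF g])
      show "\<forall>y\<in>A. free_single V y (?g y) \<in> N"
        using insert.prems(3) insert.hyps(2) by auto
    qed (use insert.prems(2) in auto)
    have "free_single V a (f a) \<oplus>\<^bsub>yob F x\<^esub> ?g \<in> N"
      using insert.prems(3) gN by (intro Module.module.submoduleE(5)[OF free_module assms(1)]) simp_all
    moreover have "f = free_single V a (f a) \<oplus>\<^bsub>yob F x\<^esub> ?g"
      using insert.prems(1) by (simp add: free_carrier free_add free_single_def fun_eq_iff)
    ultimately show ?case
      by simp
  qed
  show ?thesis
  proof (rule gen[OF _ assms(2)])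
    show "finite {y. y \<le> x \<and> f y \<noteq> \<zero>\<^bsub>yob V y\<^esub>}"
      by (rule finite_subset[OF _ finite_young_below[of x]]) auto
    show "\<forall>y. y \<notin> {y. y \<le> x \<and> f y \<noteq> \<zero>\<^bsub>yob V y\<^esub>} \<longrightarrow> f y = \<zero>\<^bsub>yob V y\<^esub>"
      using assms(2) by (auto simp: free_carrier)
    show "\<forall>y\<in>{y. y \<le> x \<and> f y \<noteq> \<zero>\<^bsub>yob V y\<^esub>}. free_single V y (f y) \<in> N"
      using assms(3) by simp
  qed
qed

text \<open>The coordinate of degree y is evaluation at y, with values in V_y. When it vanishes on
  an element at y, all remaining components have degree strictly below y.\<close>

lemma free_coordinates: "coordinates K F (yob V) (\<lambda>y x f. f y)"
proof -
  have "f \<in> aug_sub K F y" if f: "f \<in> elts F y" and fy: "f y = \<zero>\<^bsub>yob V y\<^esub>" for y f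
  proof (rule free_span[OF submodule_aug_sub[OF young_module_free] f])
    fix z assume z: "z \<le> y" "f z \<noteq> \<zero>\<^bsub>yob V z\<^esub>"
    then have "z < y"
      using fy by (auto simp: less_young_def)
    then have "ytr F z y (free_single V z (f z)) \<in> aug_sub K F y"
      using f unfolding aug_sub_eq_span_from
      by (intro span_from_ytr free_single_closed) (auto simp: free_carrier)
    then show "free_single V z (f z) \<in> aug_sub K F y"
      by (simp add: free_ytr)
  qed
  moreover have "linear_map K (yob F x) (yob V y) (\<lambda>f. f y)" for x y
    by (rule linear_mapI) (auto simp: free_carrier free_add free_smult)
  ultimately show ?thesis
    by (simp add: coordinates_def young_module_free V.module_axioms free_ytr free_zero free_carrier fun_eq_iff)
qed

text \<open>The universal property of the free module: linear maps given on the generators extend by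
  pushing the images to x and summing over the degrees below x.\<close>

lemma free_extend:
  fixes M :: "('k, 'w) ymodule"
  assumes M: "young_module K M" and \<phi>: "\<And>y. linear_map K (yob V y) (yob M y) (\<phi> y)"
  shows "\<exists>h\<in>yhom K F M. \<forall>y. \<forall>v\<in>elts V y. h y (free_single V y v) = \<phi> y v"
proof -
  interpret M: Module.module K "yob M x" for x
    by (rule young_moduleD(1)[OF M])
  define h where "h x f = finsum (yob M x) (\<lambda>y. ytr M y x (\<phi> y (f y))) {y. y \<le> x}" for x f
  have c: "ytr M y x (\<phi> y (f y)) \<in> elts M x" if "f \<in> elts F x'" "y \<le> x" for f y x x'
    using that by (intro ytr_closed[OF M] linear_map_closed[OF \<phi>]) (simp_all add: free_carrier)
  have z: "ytr M y x (\<phi> y \<zero>\<^bsub>yob V y\<^esub>) = \<zero>\<^bsub>yob M x\<^esub>" if "y \<le> x" for x y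
    by (simp add: linear_map_zero[OF V.module_axioms M.module_axioms \<phi>]
        linear_map_zero[OF M.module_axioms M.module_axioms young_moduleD(2)[OF M that]])
  have lin: "linear_map K (yob F x) (yob M x) (h x)" for x
  proof (rule linear_mapI)
    fix f assume f: "f \<in> elts F x"
    then show "h x f \<in> elts M x"
      unfolding h_def by (intro M.finsum_closed) (auto simp: c)
    have fc: "f y \<in> elts V y" for y
      using f by (simp add: free_carrier)
    show "h x (a \<odot>\<^bsub>yob F x\<^esub> f) = a \<odot>\<^bsub>yob M x\<^esub> h x f" if a: "a \<in> carrier K" for a
    proof -
      have "a \<odot>\<^bsub>yob M x\<^esub> h x f = finsum (yob M x) (\<lambda>y. a \<odot>\<^bsub>yob M x\<^esub> ytr M y x (\<phi> y (f y))) {y. y \<le> x}"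
        unfolding h_def using a c[OF f]
        by (intro M.finsum_smult_ldistr finite_young_below) auto
      also have "\<dots> = h x (a \<odot>\<^bsub>yob F x\<^esub> f)"
        unfolding h_def using a c[OF f]
        by (intro M.finsum_cong')
          (auto simp: free_smult linear_map_smult[OF \<phi> a fc]
            ytr_smult[OF M _ a linear_map_closed[OF \<phi> fc]])
      finally show ?thesis ..
    qed
    fix g assume g: "g \<in> elts F x"
    then have gc: "g y \<in> elts V y" for y
      by (simp add: free_carrier)
    have "h x f \<oplus>\<^bsub>yob M x\<^esub> h x g = finsum (yob M x)
        (\<lambda>y. ytr M y x (\<phi> y (f y)) \<oplus>\<^bsub>yob M x\<^esub> ytr M y x (\<phi> y (g y))) {y. y \<le> x}"
      unfolding h_def using c[OF f] c[OF g] by (intro M.finsum_addf[symmetric]) auto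
    also have "\<dots> = h x (f \<oplus>\<^bsub>yob F x\<^esub> g)"
      unfolding h_def using c[OF f] c[OF g]
      by (intro M.finsum_cong')
        (auto simp: free_add linear_map_add[OF \<phi> fc gc]
          ytr_add[OF M _ linear_map_closed[OF \<phi> fc] linear_map_closed[OF \<phi> gc]])
    finally show "h x (f \<oplus>\<^bsub>yob F x\<^esub> g) = h x f \<oplus>\<^bsub>yob M x\<^esub> h x g" ..
  qed
  have nat: "h x' (ytr F x x' f) = ytr M x x' (h x f)" if le: "x \<le> x'" and f: "f \<in> elts F x" for x x' f
  proof -
    have "ytr M x x' (h x f) = finsum (yob M x') (\<lambda>y. ytr M x x' (ytr M y x (\<phi> y (f y)))) {y. y \<le> x}"
      unfolding h_def using c[OF f]
      by (intro linear_map_finsum[OF M.module_axioms M.module_axioms young_moduleD(2)[OF M le]] finite_young_below) auto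
    \<comment> \<open>Passing from x to x' enlarges the index set, but an element at x has no
      components in the degrees that are added.\<close>
    also have "\<dots> = h x' f"
      unfolding h_def
    proof (rule M.add.finprod_mono_neutral_cong_left)
      fix y assume "y \<in> {y. y \<le> x'} - {y. y \<le> x}"
      then show "ytr M y x' (\<phi> y (f y)) = \<zero>\<^bsub>yob M x'\<^esub>"
        using f z by (simp add: free_carrier)
    next
      fix y assume "y \<in> {y. y \<le> x}"
      then show "ytr M x x' (ytr M y x (\<phi> y (f y))) = ytr M y x' (\<phi> y (f y))"
        using f le by (auto intro!: young_moduleD(4)[OF M] linear_map_closed[OF \<phi>] simp: free_carrier)
    qed (use finite_young_below le c[OF f] in \<open>auto intro: order_trans\<close>)
    finally show ?thesis
      by (simp add: free_ytr)
  qed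
  have single: "h y (free_single V y v) = \<phi> y v" if v: "v \<in> elts V y" for y v
  proof -
    have "h y (free_single V y v) = finsum (yob M y) (\<lambda>z. if y = z then \<phi> y v else \<zero>\<^bsub>yob M y\<^esub>) {z. z \<le> y}"
      unfolding h_def using v
      by (intro M.finsum_cong')
        (auto simp: free_single_def z linear_map_closed[OF \<phi>] young_moduleD(3)[OF M])
    also have "\<dots> = \<phi> y v"
      using v by (intro M.finsum_singleton finite_young_below) (auto simp: linear_map_closed[OF \<phi>])
    finally show ?thesis .
  qed
  have "(\<lambda>x. restrict (h x) (elts F x)) \<in> yhom K F M"
    by (rule yhom_restrictI[OF young_module_free]) (rule lin, rule nat)
  then show ?thesis
    by (rule bexI[rotated]) (auto simp: single free_single_closed)
qed

lemma free_hom_eq: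
  assumes "young_module K M"
    and lin: "linear_map K (yob F x) (yob M x) f" "linear_map K (yob F x) (yob M x) g"
    and "\<And>y v. \<lbrakk>y \<le> x; v \<in> elts V y\<rbrakk> \<Longrightarrow> f (free_single V y v) = g (free_single V y v)"
    and "p \<in> elts F x"
  shows "f p = g p"
proof -
  interpret F: Module.module K "yob F x"
    by (rule free_module)
  note MM = young_moduleD(1)[OF assms(1)]
  note zero = linear_map_zero[OF free_module MM lin(1)] linear_map_zero[OF free_module MM lin(2)]
  note neg = linear_map_neg[OF free_module MM lin(1)] linear_map_neg[OF free_module MM lin(2)]
  have "submodule {p \<in> elts F x. f p = g p} K (yob F x)"
    by (rule F.submoduleI)
      (auto simp: zero neg linear_map_add[OF lin(1)] linear_map_add[OF lin(2)]
        linear_map_smult[OF lin(1)] linear_map_smult[OF lin(2)])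
  then have "p \<in> {p \<in> elts F x. f p = g p}"
    using assms(5)
  proof (rule free_span)
    fix y assume y: "y \<le> x"
    have "p y \<in> elts V y"
      using assms(5) by (simp add: free_carrier)
    then show "free_single V y (p y) \<in> {p \<in> elts F x. f p = g p}"
      using y assms(4) free_single_closed by simp
  qed
  then show ?thesis
    by simp
qed

text \<open>Linear sections of g exist at each degree separately but need not commute with the
  transition maps. They are therefore applied to generators only, and freeness extends the result to
  a natural transformation.\<close>

lemma free_lift:
  fixes M :: "('k, 'w) ymodule" and N :: "('k, 'u) ymodule"
  assumes "field K" and M: "young_module K M" and N: "young_module K N"
    and g: "g \<in> yhom K M N" "ysurj M N g" and f: "f \<in> yhom K F N"
  shows "\<exists>h\<in>yhom K F M. \<forall>x. \<forall>v\<in>elts F x. g x (h x v) = f x v"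
proof -
  have "\<exists>s. linear_map K (yob N y) (yob M y) s \<and> (\<forall>w\<in>elts N y. g y (s w) = w)" for y
    using g(2) linear_section_exists[OF assms(1) young_moduleD(1)[OF M] young_moduleD(1)[OF N] yhomD(1)[OF g(1)], of y]
    by (metis ysurj_def)
  then obtain s where s: "\<And>y. linear_map K (yob N y) (yob M y) (s y)"
    and gs: "\<And>y w. w \<in> elts N y \<Longrightarrow> g y (s y w) = w"
    by metis
  have "linear_map K (yob V y) (yob M y) (\<lambda>v. s y (f y (free_single V y v)))" for y
    by (rule linear_map_comp[OF linear_map_comp[OF free_single_linear yhomD(1)[OF f]] s])
  from free_extend[OF M this] obtain h where h: "h \<in> yhom K F M"
    and hs: "\<And>y v. v \<in> elts V y \<Longrightarrow> h y (free_single V y v) = s y (f y (free_single V y v))"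
    by blast
  have "g x (h x p) = f x p" if p: "p \<in> elts F x" for x p
  proof (rule free_hom_eq[OF N linear_map_comp[OF yhomD(1)[OF h] yhomD(1)[OF g(1)]] yhomD(1)[OF f] _ p])
    fix y v assume y: "y \<le> x" and v: "v \<in> elts V y"
    note c = free_single_closed[OF v order_refl]
    have "g x (h x (ytr F y x (free_single V y v))) = ytr N y x (g y (h y (free_single V y v)))"
      using y c by (simp add: yhomD(2)[OF h] yhomD(2)[OF g(1)] yhom_closed[OF h])
    also have "\<dots> = f x (ytr F y x (free_single V y v))"
      using y c by (simp add: hs[OF v] gs yhom_closed[OF f] yhomD(2)[OF f])
    finally show "g x (h x (free_single V y v)) = f x (free_single V y v)"
      by (simp add: free_ytr)
  qed
  then show ?thesis
    using h by blast
qed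

end

section \<open>Projective modules and resolutions inside an infinite type\<close>

lemma infinite_pairing:
  assumes "infinite (UNIV :: 'v set)"
  shows "\<exists>\<pi> :: 'v \<times> 'v \<Rightarrow> 'v. inj \<pi>"
  using ordIso_imp_ordLeq[OF card_of_Times_same_infinite[OF assms]]
  by (simp add: card_of_ordLeq[symmetric])

text \<open>A function that agrees with z outside \<open>A\<close> is encoded by its finitely many
  values on \<open>A\<close>, using an iterated pairing. With z the family of zeros and
  \<open>A\<close> the degrees below x, this covers the value of a free module at x.\<close>

lemma finite_support_embeds:
  fixes z :: "'i \<Rightarrow> 'v"
  assumes "infinite (UNIV :: 'v set)" "finite A"
  shows "\<exists>\<phi> :: ('i \<Rightarrow> 'v) \<Rightarrow> 'v. inj_on \<phi> {f. \<forall>i. i \<notin> A \<longrightarrow> f i = z i}"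
proof -
  obtain \<pi> :: "'v \<times> 'v \<Rightarrow> 'v" where \<pi>: "inj \<pi>"
    using infinite_pairing[OF assms(1)] by blast
  show ?thesis
    using assms(2)
  proof (induction A rule: finite_induct)
    case empty
    have "inj_on (\<lambda>f :: 'i \<Rightarrow> 'v. undefined :: 'v) {f. \<forall>i. i \<notin> {} \<longrightarrow> f i = z i}"
      by (auto simp: inj_on_def)
    then show ?case
      by blast
  next
    case (insert a A)
    then obtain \<phi> :: "('i \<Rightarrow> 'v) \<Rightarrow> 'v" where \<phi>: "inj_on \<phi> {f. \<forall>i. i \<notin> A \<longrightarrow> f i = z i}"
      by blast
    \<comment> \<open>Resetting the value at a to \<open>z a\<close> makes the induction hypothesis
      applicable; the erased value survives in the first component of the pair.\<close>
    have "inj_on (\<lambda>f. \<pi> (f a, \<phi> (f(a := z a)))) {f. \<forall>i. i \<notin> insert a A \<longrightarrow> f i = z i}"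
    proof (rule inj_onI)
      fix f g
      assume f: "f \<in> {f. \<forall>i. i \<notin> insert a A \<longrightarrow> f i = z i}"
        and g: "g \<in> {f. \<forall>i. i \<notin> insert a A \<longrightarrow> f i = z i}"
        and eq: "\<pi> (f a, \<phi> (f(a := z a))) = \<pi> (g a, \<phi> (g(a := z a)))"
      from eq have fg: "f a = g a" "\<phi> (f(a := z a)) = \<phi> (g(a := z a))"
        using \<pi> by (auto dest: injD)
      have "f(a := z a) = g(a := z a)"
      proof (rule inj_onD[OF \<phi>])
        show "\<phi> (f(a := z a)) = \<phi> (g(a := z a))"
          by (rule fg(2))
      qed (use f g in auto)
      then show "f = g"
        using fg(1) by (metis fun_upd_triv fun_upd_upd)
    qed
    then show ?case
      by blast
  qed
qed

lemma yhom_id: "young_module K V \<Longrightarrow> (\<lambda>x. restrict (\<lambda>v. v) (elts V x)) \<in> yhom K V V"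
  by (rule yhom_restrictI) (auto simp: linear_map_id)

text \<open>The cover is not meant to be minimal: it is the free module on all the spaces V_y,
  transported into \<open>'v\<close>. Each v in V_y is hit by the generator that it defines.\<close>

lemma projective_cover:
  fixes K :: "('k, 'c) ring_scheme" and V :: "('k, 'v) ymodule"
  assumes "field K" "infinite (UNIV :: 'v set)" and V: "young_module K V"
  shows "\<exists>(P :: ('k, 'v) ymodule) e. projective_ymodule K P \<and> e \<in> yhom K P V \<and> ysurj P V e \<and>
    (\<exists>c. coordinates K P (yob V) c)"
proof -
  let ?F = "free_ymodule V"
  note F = young_module_free[OF V]
  have "\<exists>\<phi> :: (young \<Rightarrow> 'v) \<Rightarrow> 'v. inj_on \<phi> (elts ?F x)" for x
  proof -
    obtain \<phi> :: "(young \<Rightarrow> 'v) \<Rightarrow> 'v"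
      where "inj_on \<phi> {f. \<forall>y. y \<notin> {y. y \<le> x} \<longrightarrow> f y = \<zero>\<^bsub>yob V y\<^esub>}"
      using finite_support_embeds[OF assms(2) finite_young_below[of x], of "\<lambda>y. \<zero>\<^bsub>yob V y\<^esub>"] by blast
    then have "inj_on \<phi> (elts ?F x)"
      by (rule inj_on_subset) (auto simp: free_carrier[OF V])
    then show ?thesis
      by blast
  qed
  from transport_ymodule[OF F this] obtain T :: "('k, 'v) ymodule" and i r where T: "young_module K T"
    and i: "i \<in> yhom K ?F T" and r: "r \<in> yhom K T ?F"
    and ri: "\<And>x w. w \<in> elts ?F x \<Longrightarrow> r x (i x w) = w"
    and ir: "\<And>x t. t \<in> elts T x \<Longrightarrow> i x (r x t) = t"
    by metis
  have "projective_ymodule K T"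
    unfolding projective_ymodule_def
  proof (intro conjI allI impI T)
    fix M N :: "('k, 'v) ymodule" and g f
    assume M: "young_module K M" and N: "young_module K N" and g: "g \<in> yhom K M N" "ysurj M N g"
      and f: "f \<in> yhom K T N"
    obtain h where h: "h \<in> yhom K ?F M"
      and gh: "\<And>x v. v \<in> elts ?F x \<Longrightarrow> g x (h x v) = compose (elts ?F x) (f x) (i x) v"
      using free_lift[OF V assms(1) M N g yhom_comp[OF i f F]] by blast
    show "\<exists>h\<in>yhom K T M. \<forall>x. \<forall>v\<in>elts T x. g x (h x v) = f x v"
      by (rule bexI[OF _ yhom_comp[OF r h T]]) (auto simp: compose_def gh yhom_closed[OF r] ir)
  qed
  moreover obtain e where e: "e \<in> yhom K ?F V"
    and es: "\<And>y v. v \<in> elts V y \<Longrightarrow> e y (free_single V y v) = v"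
    using free_extend[OF V V linear_map_id] by blast
  moreover have "ysurj T V (\<lambda>x. compose (elts T x) (e x) (r x))"
    unfolding ysurj_def
  proof (intro allI equalityI subsetI)
    fix x v assume v: "v \<in> elts V x"
    note s = free_single_closed[OF V v order_refl]
    show "v \<in> compose (elts T x) (e x) (r x) ` elts T x"
      using v s by (intro image_eqI[of _ _ "i x (free_single V x v)"])
        (simp_all add: compose_def ri es yhom_closed[OF i])
  qed (auto simp: compose_def yhom_closed[OF r] yhom_closed[OF e])
  moreover have "coordinates K T (yob V) (\<lambda>y x t. r x t y)"
    by (rule coordinates_retract[OF free_coordinates[OF V] T r i]) (rule ir)
  ultimately show ?thesis
    using yhom_comp[OF r e T] by blast
qed

text \<open>The cover of P has its carriers in the same type as P, so projectivity of P lifts the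
  identity of P to it. This makes P a direct summand of a module with coordinates.\<close>

lemma projective_coordinates:
  fixes K :: "('k, 'c) ring_scheme" and P :: "('k, 'v) ymodule"
  assumes "field K" "infinite (UNIV :: 'v set)" "projective_ymodule K P"
  shows "\<exists>(E :: young \<Rightarrow> ('k, 'v) module) c. coordinates K P E c"
proof -
  have P: "young_module K P"
    using assms(3) by (simp add: projective_ymodule_def)
  obtain F :: "('k, 'v) ymodule" and e c where F: "projective_ymodule K F" and e: "e \<in> yhom K F P" "ysurj F P e"
    and c: "coordinates K F (yob P) c"
    using projective_cover[OF assms(1,2) P] by blast
  have "young_module K F"
    using F by (simp add: projective_ymodule_def)
  then obtain s where s: "s \<in> yhom K P F"
    and es: "\<And>x v. v \<in> elts P x \<Longrightarrow> e x (s x v) = restrict (\<lambda>v. v) (elts P x) v"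
    using assms(3) e P yhom_id[OF P] unfolding projective_ymodule_def by meson
  have "coordinates K P (yob P) (\<lambda>y x p. c y x (s x p))"
    by (rule coordinates_retract[OF c P s e(1)]) (simp add: es)
  then show ?thesis
    by blast
qed

lemma submodule_yhom_kernel:
  "\<lbrakk>young_module K V; young_module K W; f \<in> yhom K V W\<rbrakk>
    \<Longrightarrow> submodule (a_kernel (yob V x) (yob W x) (f x)) K (yob V x)"
  by (intro submodule_a_kernel young_moduleD(1) yhomD(1))

lemma yhom_kernel_stable:
  assumes "young_module K V" "young_module K W" "f \<in> yhom K V W"
    and "x \<le> y" "v \<in> a_kernel (yob V x) (yob W x) (f x)"
  shows "ytr V x y v \<in> a_kernel (yob V y) (yob W y) (f y)"
  using assms(4,5) linear_map_zero[OF young_moduleD(1)[OF assms(2)] young_moduleD(1)[OF assms(2)]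
      young_moduleD(2)[OF assms(2,4)]]
  by (simp add: mem_a_kernel ytr_closed[OF assms(1)] yhomD(2)[OF assms(3)])

lemma projective_resolution_exists:
  fixes K :: "('k, 'c) ring_scheme" and V :: "('k, 'v) ymodule"
  assumes "field K" "infinite (UNIV :: 'v set)" and V: "young_module K V"
  shows "\<exists>P d e. projective_resolution K V P d e"
proof -
  define ker where "ker M N f = sub_ymodule M (\<lambda>x. a_kernel (yob M x) (yob N x) (f x))"
    for M N :: "('k, 'v) ymodule" and f
  \<comment> \<open>With the hypothesis on V inside the existential, covers can be chosen as total
    functions of the module.\<close>
  have "\<exists>(P :: ('k, 'v) ymodule) e. young_module K V \<longrightarrow> projective_ymodule K P \<and> e \<in> yhom K P V \<and> ysurj P V e"
    for V :: "('k, 'v) ymodule"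
    using projective_cover[OF assms(1,2), of V] by blast
  then obtain cov \<epsilon> where cov: "\<And>V :: ('k, 'v) ymodule. young_module K V \<Longrightarrow>
      projective_ymodule K (cov V :: ('k, 'v) ymodule) \<and> \<epsilon> V \<in> yhom K (cov V) V \<and> ysurj (cov V) V (\<epsilon> V)"
    by metis
  \<comment> \<open>The n-th syzygy of V: each one is the kernel of the cover of its
    predecessor.\<close>
  define Z where "Z n = ((\<lambda>V. ker (cov V) V (\<epsilon> V)) ^^ n) V" for n
  have Z0: "Z 0 = V" and ZS: "Z (Suc n) = ker (cov (Z n)) (Z n) (\<epsilon> (Z n))" for n
    by (simp_all add: Z_def)
  have Z: "young_module K (Z n)" for n
  proof (induction n)
    case 0
    then show ?case
      using V by (simp add: Z0)
  next
    case (Suc n)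
    have c: "young_module K (cov (Z n))" "\<epsilon> (Z n) \<in> yhom K (cov (Z n)) (Z n)"
      using cov[OF Suc] by (auto simp: projective_ymodule_def)
    show ?case
      unfolding ZS ker_def
      by (rule young_module_sub(1)[OF c(1) submodule_yhom_kernel[OF c(1) Suc c(2)]])
        (rule yhom_kernel_stable[OF c(1) Suc c(2)])
  qed
  have P: "projective_ymodule K (cov (Z n))" "young_module K (cov (Z n))"
    "\<epsilon> (Z n) \<in> yhom K (cov (Z n)) (Z n)" "ysurj (cov (Z n)) (Z n) (\<epsilon> (Z n))" for n
    using cov[OF Z] by (auto simp: projective_ymodule_def)
  have carr: "elts (Z (Suc n)) x = a_kernel (yob (cov (Z n)) x) (yob (Z n) x) (\<epsilon> (Z n) x)" for n x
    by (simp add: ZS ker_def sub_ymodule_def)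
  have zero: "\<zero>\<^bsub>yob (Z (Suc n)) x\<^esub> = \<zero>\<^bsub>yob (cov (Z n)) x\<^esub>" for n x
    by (simp add: ZS ker_def sub_ymodule_def)
  \<comment> \<open>As a submodule of \<open>cov (Z n)\<close>, the syzygy \<open>Z (Suc n)\<close>
    has its operations and transition maps. So the cover of \<open>Z (Suc n)\<close>, read with the
    larger target, already is the differential.\<close>
  define d where "d n = \<epsilon> (Z (Suc n))" for n
  have d: "d n \<in> yhom K (cov (Z (Suc n))) (cov (Z n))" for n
  proof (rule yhomI)
    note P3 = P(3)[of "Suc n"]
    note closed = yhom_closed[OF P3, unfolded carr mem_a_kernel]
    fix x
    show "linear_map K (yob (cov (Z (Suc n))) x) (yob (cov (Z n)) x) (d n x)"
      using yhom_add[OF P3] yhom_smult[OF P3] closed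
      by (intro linear_mapI) (auto simp: d_def ZS ker_def sub_ymodule_def)
    show "d n x \<in> extensional (elts (cov (Z (Suc n))) x)"
      using yhomD(3)[OF P3] by (simp add: d_def)
    fix y v assume "x \<le> y" "v \<in> elts (cov (Z (Suc n))) x"
    then show "d n y (ytr (cov (Z (Suc n))) x y v) = ytr (cov (Z n)) x y (d n x v)"
      using yhomD(2)[OF P3] by (simp add: d_def ZS ker_def sub_ymodule_def)
  qed
  have exact: "d n x ` elts (cov (Z (Suc n))) x
      = a_kernel (yob (cov (Z n)) x) (yob (Z n) x) (\<epsilon> (Z n) x)" for n x
    using P(4)[of "Suc n"] by (simp add: ysurj_def d_def carr)
  have "a_kernel (yob (cov (Z (Suc n))) x) (yob (cov (Z n)) x) (d n x)
      = a_kernel (yob (cov (Z (Suc n))) x) (yob (Z (Suc n)) x) (\<epsilon> (Z (Suc n)) x)" for n x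
    by (auto simp: mem_a_kernel d_def zero)
  then have "projective_resolution K V (\<lambda>n. cov (Z n)) d (\<epsilon> V)"
    unfolding projective_resolution_def
    using P d exact[of 0] exact P(3,4)[of 0] by (simp add: Z0)
  then show ?thesis
    by blast
qed

section \<open>Relations in low degrees\<close>

lemma (in abelian_group) minus_add_cancel:
  "\<lbrakk>u \<in> carrier G; v \<in> carrier G\<rbrakk> \<Longrightarrow> v \<oplus> (u \<ominus> v) = u"
  by (simp add: a_minus_def a_lcomm[of v u] r_neg)

lemma (in abelian_group) minus_minus_cancel:
  "\<lbrakk>u \<in> carrier G; v \<in> carrier G\<rbrakk> \<Longrightarrow> u \<ominus> (u \<ominus> v) = v"
  by (simp add: a_minus_def minus_add a_assoc[symmetric] r_neg)

text \<open>Two elements with the same image under d' differ by an element of its kernel, hence by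
  an image of d''. If d' r is also attained on \<open>aug_sub\<close>, then r is congruent to an
  image of d'' modulo lower degrees.\<close>

lemma lift_modulo_kernel:
  assumes R: "young_module K R" and Q: "young_module K Q" and d': "d' \<in> yhom K R Q"
    and exact': "d'' x ` elts S x = a_kernel (yob R x) (yob Q x) (d' x)"
    and r: "r \<in> elts R x" "d' x r \<in> d' x ` aug_sub K R x"
  shows "\<exists>s\<in>elts S x. r \<ominus>\<^bsub>yob R x\<^esub> d'' x s \<in> aug_sub K R x"
proof -
  interpret R: Module.module K "yob R x"
    by (rule young_moduleD(1)[OF R])
  interpret Q: Module.module K "yob Q x"
    by (rule young_moduleD(1)[OF Q])
  obtain a where a: "a \<in> aug_sub K R x" "d' x r = d' x a"
    using r(2) by blast
  have ac: "a \<in> elts R x"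
    using a(1) R.submoduleE(1)[OF submodule_aug_sub[OF R]] by blast
  have "d' x (r \<ominus>\<^bsub>yob R x\<^esub> a) = \<zero>\<^bsub>yob Q x\<^esub>"
    using linear_map_minus[OF R.module_axioms Q.module_axioms yhomD(1)[OF d'] r(1) ac] a(2)
      yhom_closed[OF d' ac]
    by (simp add: Q.minus_eq_zero_iff)
  then have "r \<ominus>\<^bsub>yob R x\<^esub> a \<in> d'' x ` elts S x"
    using r(1) ac by (simp add: exact' mem_a_kernel)
  then obtain s where "s \<in> elts S x" "d'' x s = r \<ominus>\<^bsub>yob R x\<^esub> a"
    by auto
  then show ?thesis
    using a(1) r(1) ac by (intro bexI[of _ s]) (simp_all add: R.minus_minus_cancel)
qed

lemma exists_max_sum_norm:
  assumes "finite A" "A \<noteq> {}"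
  shows "\<exists>a\<in>A. \<forall>b\<in>A. sum_norm b \<le> sum_norm a"
proof -
  have "Max (sum_norm ` A) \<in> sum_norm ` A"
    using assms by (intro Max_in) auto
  then obtain a where "a \<in> A" "Max (sum_norm ` A) = sum_norm a"
    by auto
  then show ?thesis
    using assms by (metis Max_ge finite_imageI imageI)
qed

text \<open>An element of greatest norm is maximal in the order, so its removal leaves a down-closed
  set. By the last claim, whatever \<open>aug_sub\<close> contains in degree a is generated by
  degrees in \<open>A - {a}\<close>, so elements rewritten at a do not reintroduce a.\<close>

lemma remove_maximal:
  assumes "a \<in> A" "\<forall>b\<in>A. sum_norm b \<le> sum_norm a" "\<forall>y\<in>A. \<forall>z\<le>y. z \<in> A"
  shows "\<forall>y\<in>A - {a}. \<forall>z\<le>y. z \<in> A - {a}" "z \<in> A - {a} \<Longrightarrow> \<not> a \<le> z"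
    "z < a \<Longrightarrow> z \<in> A - {a}"
proof -
  show *: "\<not> a \<le> z" if "z \<in> A - {a}" for z
    using that assms(2) sum_norm_strict_mono[of a z] by (force simp: less_young_def)
  then show "\<forall>y\<in>A - {a}. \<forall>z\<le>y. z \<in> A - {a}"
    using assms(3) by blast
  show "z < a \<Longrightarrow> z \<in> A - {a}"
    using assms(1,3) by (auto simp: less_young_def)
qed

text \<open>If every contributing degree lies below z, the generators pass through V_z on their way
  to x.\<close>

lemma span_from_le_image:
  assumes V: "young_module K V" and "z \<le> x" "\<And>y. \<lbrakk>y \<in> A; y \<le> x\<rbrakk> \<Longrightarrow> y \<le> z"
  shows "span_from K V A x \<subseteq> ytr V z x ` elts V z"
proof (rule span_from_least)
  show "submodule (ytr V z x ` elts V z) K (yob V x)"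
    by (rule submodule_image[OF young_moduleD(1)[OF V] young_moduleD(1)[OF V] young_moduleD(2)[OF V assms(2)]
          Module.module.carrier_is_submodule[OF young_moduleD(1)[OF V]]])
next
  fix y v assume y: "y \<in> A" "y \<le> x" "v \<in> elts V y"
  then have "ytr V y x v = ytr V z x (ytr V y z v)"
    using assms by (simp add: young_moduleD(4)[OF V])
  then show "ytr V y x v \<in> ytr V z x ` elts V z"
    using ytr_closed[OF V assms(3)[OF y(1,2)] y(3)] by simp
qed

text \<open>The image of w is generated in degrees of \<open>A\<close>, none of which is above a, so
  it has no component of degree a. What remains depends on u alone and can be read off in degree
  a.\<close>

lemma coordinate_of_image:
  assumes P: "coordinates K P E c" and Q: "young_module K Q" and d: "d \<in> yhom K Q P"
    and a: "a \<le> x" "u \<in> elts Q a" "w \<in> span_from K Q A x"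
    and na: "\<And>z. \<lbrakk>z \<in> A; z \<le> x\<rbrakk> \<Longrightarrow> \<not> a \<le> z"
  shows "c a x (d x (ytr Q a x u \<oplus>\<^bsub>yob Q x\<^esub> w)) = c a a (d a u)"
proof -
  interpret E: Module.module K "E a"
    by (rule coordinatesD(2)[OF P])
  note PY = coordinatesD(1)[OF P]
  note dc = yhom_closed[OF d]
  have w: "w \<in> elts Q x"
    by (rule span_from_carrier[OF Q a(3)])
  have t: "ytr Q a x u \<in> elts Q x"
    by (rule ytr_closed[OF Q a(1,2)])
  have "c a x (d x (ytr Q a x u \<oplus>\<^bsub>yob Q x\<^esub> w)) = c a x (d x (ytr Q a x u)) \<oplus>\<^bsub>E a\<^esub> c a x (d x w)"
    by (simp add: yhom_add[OF d t w] linear_map_add[OF coordinatesD(3)[OF P] dc[OF t] dc[OF w]])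
  also have "c a x (d x w) = \<zero>\<^bsub>E a\<^esub>"
    by (rule coordinates_span_from[OF P span_from_hom[OF Q PY d a(3)] na])
  also have "c a x (d x (ytr Q a x u)) = c a a (d a u)"
    by (simp add: yhomD(2)[OF d a(1,2)] coordinatesD(4)[OF P a(1) dc[OF a(2)]])
  finally show ?thesis
    using linear_map_closed[OF coordinatesD(3)[OF P] dc[OF a(2)]] by simp
qed

text \<open>The rewriting of relations, as an induction on a finite down-closed set \<open>A\<close>
  of degrees that generate q. The premise \<open>hyp\<close> states, in terms of elements, that
  homology at Q vanishes in norms above N. The conclusion says that q is a consequence of relations
  from degrees strictly below x.\<close>

lemma low_degree_kernel:
  assumes R: "young_module K R" and Q: "young_module K Q" and P: "coordinates K P E c"
    and d': "d' \<in> yhom K R Q" and d: "d \<in> yhom K Q P"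
    and exact: "\<And>y. d' y ` elts R y = a_kernel (yob Q y) (yob P y) (d y)"
    and hyp: "\<And>y q. \<lbrakk>sum_norm y > N; q \<in> elts Q y; d y q \<in> aug_sub K P y\<rbrakk>
      \<Longrightarrow> \<exists>r\<in>elts R y. q \<ominus>\<^bsub>yob Q y\<^esub> d' y r \<in> aug_sub K Q y"
    and x: "\<not> x \<le> hyperbola N"
    and A: "finite A" "\<forall>y\<in>A. y < x" "\<forall>y\<in>A. \<forall>z\<le>y. z \<in> A"
    and q: "q \<in> span_from K Q A x" "d x q = \<zero>\<^bsub>yob P x\<^esub>"
  shows "q \<in> d' x ` aug_sub K R x"
  using A q
proof (induction A arbitrary: q rule: finite_psubset_induct)
  case (psubset A)
  interpret MQ: Module.module K "yob Q y" for y
    by (rule young_moduleD(1)[OF Q])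
  interpret MP: Module.module K "yob P y" for y
    by (rule young_moduleD(1)[OF coordinatesD(1)[OF P]])
  note PY = coordinatesD(1)[OF P]
  \<comment> \<open>Relations from a degree below x, pushed to x, belong to the target
    submodule.\<close>
  have lower: "ytr Q y x (d' y r) \<in> d' x ` aug_sub K R x" if "y < x" "r \<in> elts R y" for y r
    using that unfolding aug_sub_eq_span_from
    by (intro image_eqI[of _ _ "ytr R y x r"]) (auto simp: yhomD(2)[OF d'] span_from_ytr less_imp_le)
  have dd: "d y (d' y r) = \<zero>\<^bsub>yob P y\<^esub>" if "r \<in> elts R y" for y r
  proof -
    have "d' y r \<in> a_kernel (yob Q y) (yob P y) (d y)"
      using that unfolding exact[symmetric] by blast
    then show ?thesis
      by (simp add: mem_a_kernel)
  qed
  show ?case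
  proof (cases "\<exists>a\<in>A. sum_norm a > N")
    case True
    obtain a where a: "a \<in> A" "\<forall>b\<in>A. sum_norm b \<le> sum_norm a"
      using exists_max_sum_norm[OF psubset.hyps(1)] True by blast
    then have aN: "sum_norm a > N"
      using True by force
    note A' = remove_maximal[OF a psubset.prems(2)]
    have ax: "a < x" "a \<le> x"
      using psubset.prems(1) a(1) by (auto simp: less_imp_le)
    have "q \<in> span_from K Q (insert a (A - {a})) x"
      using psubset.prems(3) a(1) by (simp add: insert_absorb)
    then obtain u w where u: "u \<in> elts Q a" and w: "w \<in> span_from K Q (A - {a}) x"
      and quw: "q = ytr Q a x u \<oplus>\<^bsub>yob Q x\<^esub> w"
      by (rule span_from_insert[OF Q ax(2)])
    \<comment> \<open>The component of degree a in d q is that of d u. As d q = 0, the element d u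
      has no component in its own degree a and so comes from lower degrees, where \<open>hyp\<close>
      takes over.\<close>
    have "c a a (d a u) = c a x (d x q)"
      unfolding quw by (rule coordinate_of_image[OF P Q d ax(2) u w A'(2), symmetric])
    also have "\<dots> = \<zero>\<^bsub>E a\<^esub>"
      unfolding psubset.prems(4) by (rule linear_map_zero[OF MP.module_axioms coordinatesD(2,3)[OF P]])
    finally have "d a u \<in> aug_sub K P a"
      by (rule coordinatesD(6)[OF P yhom_closed[OF d u]])
    from hyp[OF aN u this] obtain r where r: "r \<in> elts R a"
      and ur: "u \<ominus>\<^bsub>yob Q a\<^esub> d' a r \<in> aug_sub K Q a"
      by blast
    \<comment> \<open>q splits as b + q'. Here b is a relation from the degree a < x, while q' is
      generated by \<open>A - {a}\<close> and is again a relation, so the induction hypothesis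
      applies to it.\<close>
    define b where "b = ytr Q a x (d' a r)"
    define q' where "q' = ytr Q a x (u \<ominus>\<^bsub>yob Q a\<^esub> d' a r) \<oplus>\<^bsub>yob Q x\<^esub> w"
    have rc: "d' a r \<in> elts Q a"
      by (rule yhom_closed[OF d' r])
    have bc: "b \<in> elts Q x"
      unfolding b_def by (rule ytr_closed[OF Q ax(2) rc])
    have "u \<ominus>\<^bsub>yob Q a\<^esub> d' a r \<in> span_from K Q (A - {a}) a"
      using ur span_from_mono[OF Q, of "{y. y < a}" a "A - {a}"] A'(3)
      unfolding aug_sub_eq_span_from by blast
    then have q's: "q' \<in> span_from K Q (A - {a}) x"
      unfolding q'_def
      using MQ.submoduleE(5)[OF submodule_span_from[OF Q]] span_from_push[OF Q ax(2)] w by blast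
    have q'c: "q' \<in> elts Q x"
      by (rule span_from_carrier[OF Q q's])
    have "u = d' a r \<oplus>\<^bsub>yob Q a\<^esub> (u \<ominus>\<^bsub>yob Q a\<^esub> d' a r)"
      using u rc by (simp add: MQ.minus_add_cancel)
    then have "ytr Q a x u = b \<oplus>\<^bsub>yob Q x\<^esub> ytr Q a x (u \<ominus>\<^bsub>yob Q a\<^esub> d' a r)"
      unfolding b_def using ytr_add[OF Q ax(2) rc, of "u \<ominus>\<^bsub>yob Q a\<^esub> d' a r"] u rc
      by simp
    then have qbq: "q = b \<oplus>\<^bsub>yob Q x\<^esub> q'"
      unfolding quw q'_def using u rc bc span_from_carrier[OF Q w] ytr_closed[OF Q ax(2)]
      by (simp add: MQ.a_assoc)
    have "d x b = \<zero>\<^bsub>yob P x\<^esub>"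
      using dd ytr_closed[OF R ax(2) r] r ax(2) unfolding b_def by (simp add: yhomD(2)[OF d', symmetric])
    then have "d x q' = \<zero>\<^bsub>yob P x\<^esub>"
      using psubset.prems(4) yhom_add[OF d bc q'c] yhom_closed[OF d q'c] qbq
      by simp
    moreover have "\<forall>y\<in>A - {a}. y < x" "A - {a} \<subset> A"
      using psubset.prems(1) a(1) by auto
    ultimately have "q' \<in> d' x ` aug_sub K R x"
      using psubset.IH[of "A - {a}" q'] A'(1) q's by blast
    moreover have "b \<in> d' x ` aug_sub K R x"
      unfolding b_def by (rule lower[OF ax(1) r])
    moreover have "submodule (d' x ` aug_sub K R x) K (yob Q x)"
      by (rule submodule_image[OF young_moduleD(1)[OF R] MQ.module_axioms yhomD(1)[OF d'] submodule_aug_sub[OF R]])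
    ultimately show ?thesis
      unfolding qbq using MQ.submoduleE(5) by blast
  next
    case False
    \<comment> \<open>All degrees in \<open>A\<close> now have norm at most N and lie below the
      hyperbola. As x does not, ?z is strictly smaller than x; injectivity of the maps of P moves
      the relation to ?z, where exactness applies.\<close>
    let ?z = "inf x (hyperbola N)"
    have z: "?z \<le> x" "?z < x"
      using x by (auto simp: less_young_def) (metis inf.cobounded2)
    have "y \<le> ?z" if "y \<in> A" "y \<le> x" for y
      using that False le_hyperbola[of y N] by (auto simp: not_less)
    then have "q \<in> ytr Q ?z x ` elts Q ?z"
      using psubset.prems(3) span_from_le_image[OF Q z(1)] by blast
    then obtain q0 where q0: "q0 \<in> elts Q ?z" "q = ytr Q ?z x q0"
      by blast
    have "ytr P ?z x (d ?z q0) = \<zero>\<^bsub>yob P x\<^esub>"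
      using psubset.prems(4) q0 z(1) by (simp add: yhomD(2)[OF d])
    then have "d ?z q0 = \<zero>\<^bsub>yob P ?z\<^esub>"
      by (rule coordinates_injective[OF P z(1) yhom_closed[OF d q0(1)]])
    then have "q0 \<in> d' ?z ` elts R ?z"
      using q0(1) by (simp add: exact mem_a_kernel)
    then obtain r where "r \<in> elts R ?z" "q0 = d' ?z r"
      by blast
    then show ?thesis
      using lower[OF z(2)] q0(2) by simp
  qed
qed

text \<open>That r is a cycle after dividing by \<open>aug_sub\<close> means that d' r is generated
  in degrees below x. Since d (d' r) = 0, it is a relation to which the rewriting applies, with all
  degrees below x as the initial set.\<close>

lemma vanishing_step:
  assumes S: "young_module K S" and R: "young_module K R" and Q: "young_module K Q"
    and P: "coordinates K P E c"
    and d'': "d'' \<in> yhom K S R" and d': "d' \<in> yhom K R Q" and d: "d \<in> yhom K Q P"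
    and exact': "\<And>y. d'' y ` elts S y = a_kernel (yob R y) (yob Q y) (d' y)"
    and exact: "\<And>y. d' y ` elts R y = a_kernel (yob Q y) (yob P y) (d y)"
    and hyp: "\<And>y q. \<lbrakk>sum_norm y > N; q \<in> elts Q y; d y q \<in> aug_sub K P y\<rbrakk>
      \<Longrightarrow> \<exists>r\<in>elts R y. q \<ominus>\<^bsub>yob Q y\<^esub> d' y r \<in> aug_sub K Q y"
    and x: "\<not> x \<le> hyperbola N"
    and r: "r \<in> elts R x" "d' x r \<in> aug_sub K Q x"
  shows "\<exists>s\<in>elts S x. r \<ominus>\<^bsub>yob R x\<^esub> d'' x s \<in> aug_sub K R x"
proof -
  have "d' x r \<in> a_kernel (yob Q x) (yob P x) (d x)"
    using r(1) unfolding exact[symmetric] by blast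
  then have "d x (d' x r) = \<zero>\<^bsub>yob P x\<^esub>"
    by (simp add: mem_a_kernel)
  moreover have "finite {y. y < x}"
    by (rule finite_subset[OF _ finite_young_below[of x]]) (auto simp: less_imp_le)
  ultimately have "d' x r \<in> d' x ` aug_sub K R x"
    using r(2) unfolding aug_sub_eq_span_from[of K Q x]
    by (intro low_degree_kernel[OF R Q P d' d exact hyp x, of "{y. y < x}"])
      (auto intro: le_less_trans)
  then show ?thesis
    using lift_modulo_kernel[OF R Q d', of d'' x S r] exact' r(1) by blast
qed

section \<open>Modules determined by their values below a partition\<close>

text \<open>As \<open>inf x (hyperbola N)\<close> is the largest degree below both x and the
  hyperbola, the condition says that V is the left Kan extension of its restriction to the finite
  set of degrees below \<open>hyperbola N\<close>.\<close>

definition determined_by :: "nat \<Rightarrow> ('k, 'v) ymodule \<Rightarrow> bool" where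
  "determined_by N V \<longleftrightarrow> (\<forall>x. bij_betw (ytr V (inf x (hyperbola N)) x)
     (elts V (inf x (hyperbola N))) (elts V x))"

text \<open>Gives two modules a common bound. Meeting first with the larger hyperbola does not
  change the meet with the smaller one; so, among the maps between \<open>?m\<close>,
  \<open>?n\<close> and x, two are bijective by assumption and the third follows.\<close>

lemma determined_by_mono:
  assumes V: "young_module K V" and "determined_by M V" "M \<le> N"
  shows "determined_by N V"
  unfolding determined_by_def
proof
  fix x
  let ?m = "inf x (hyperbola M)" and ?n = "inf x (hyperbola N)"
  have mn: "?m \<le> ?n"
    using hyperbola_mono[OF assms(3)] by (rule inf_mono[OF order_refl])
  have m: "inf ?n (hyperbola M) = ?m"
    using hyperbola_mono[OF assms(3)] by (simp add: inf.assoc inf.absorb2)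
  have b1: "bij_betw (ytr V ?m ?n) (elts V ?m) (elts V ?n)"
    using assms(2) m unfolding determined_by_def by metis
  have b2: "bij_betw (ytr V ?m x) (elts V ?m) (elts V x)"
    using assms(2) unfolding determined_by_def by blast
  have "bij_betw (ytr V ?n x \<circ> ytr V ?m ?n) (elts V ?m) (elts V x)"
    using b2 by (rule bij_betw_cong[THEN iffD1, rotated]) (simp add: young_moduleD(4)[OF V mn])
  then show "bij_betw (ytr V ?n x) (elts V ?n) (elts V x)"
    using bij_betw_comp_iff[OF b1] by blast
qed

lemma determined_by_lift:
  assumes "determined_by N V" "v \<in> elts V x"
  obtains w where "w \<in> elts V (inf x (hyperbola N))" "ytr V (inf x (hyperbola N)) x w = v"
proof -
  have "v \<in> ytr V (inf x (hyperbola N)) x ` elts V (inf x (hyperbola N))"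
    using assms by (simp add: determined_by_def bij_betw_def)
  then show thesis
    using that by blast
qed

lemma determined_by_zero:
  assumes V: "young_module K V" and "determined_by N V" "w \<in> elts V (inf x (hyperbola N))"
    and "ytr V (inf x (hyperbola N)) x w = \<zero>\<^bsub>yob V x\<^esub>"
  shows "w = \<zero>\<^bsub>yob V (inf x (hyperbola N))\<^esub>"
proof -
  interpret V: Module.module K "yob V y" for y
    by (rule young_moduleD(1)[OF V])
  let ?z = "inf x (hyperbola N)"
  have "inj_on (ytr V ?z x) (elts V ?z)"
    using assms(2) by (simp add: determined_by_def bij_betw_def)
  moreover have "ytr V ?z x w = ytr V ?z x \<zero>\<^bsub>yob V ?z\<^esub>"
    by (simp add: assms(4) linear_map_zero[OF V.module_axioms V.module_axioms young_moduleD(2)[OF V inf.cobounded1]])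
  ultimately show ?thesis
    using assms(3) by (auto dest: inj_onD)
qed

lemma determined_byI:
  assumes V: "young_module K V"
    and surj: "\<And>x v. v \<in> elts V x \<Longrightarrow>
      v \<in> ytr V (inf x (hyperbola N)) x ` elts V (inf x (hyperbola N))"
    and inj: "\<And>x v. \<lbrakk>v \<in> elts V (inf x (hyperbola N));
      ytr V (inf x (hyperbola N)) x v = \<zero>\<^bsub>yob V x\<^esub>\<rbrakk> \<Longrightarrow> v = \<zero>\<^bsub>yob V (inf x (hyperbola N))\<^esub>"
  shows "determined_by N V"
  unfolding determined_by_def bij_betw_def
proof (intro allI conjI equalityI subsetI)
  fix x
  show "inj_on (ytr V (inf x (hyperbola N)) x) (elts V (inf x (hyperbola N)))"
    by (rule linear_map_inj_onI[OF young_moduleD(1)[OF V] young_moduleD(1)[OF V]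
          young_moduleD(2)[OF V inf.cobounded1] inj])
qed (use surj ytr_closed[OF V inf.cobounded1] in auto)

text \<open>The end R \<rightarrow> Q \<rightarrow> V \<rightarrow> 0 of a resolution, with
  coordinates on the module Q of generators. Both directions of the characterisation of finite
  presentation are proved here in terms of elements.\<close>

locale young_presentation =
  fixes K :: "('k, 'c) ring_scheme" and R Q V :: "('k, 'v) ymodule" and d e
    and E :: "young \<Rightarrow> ('k, 'w) module" and c
  assumes R: "young_module K R" and cQ: "coordinates K Q E c" and V: "young_module K V"
    and d: "d \<in> yhom K R Q" and e: "e \<in> yhom K Q V" and e_surj: "ysurj Q V e"
    and exact: "\<And>y. d y ` elts R y = a_kernel (yob Q y) (yob V y) (e y)"
begin

lemma Q: "young_module K Q"
  by (rule coordinatesD(1)[OF cQ])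

sublocale MR: Module.module K "yob R y" for y
  by (rule young_moduleD(1)[OF R])

sublocale MQ: Module.module K "yob Q y" for y
  by (rule young_moduleD(1)[OF Q])

sublocale MV: Module.module K "yob V y" for y
  by (rule young_moduleD(1)[OF V])

lemma e_d: "r \<in> elts R y \<Longrightarrow> e y (d y r) = \<zero>\<^bsub>yob V y\<^esub>"
proof -
  assume "r \<in> elts R y"
  then have "d y r \<in> a_kernel (yob Q y) (yob V y) (e y)"
    unfolding exact[symmetric] by blast
  then show ?thesis
    by (simp add: mem_a_kernel)
qed

lemma kernel_lift:
  assumes "q \<in> elts Q y" "e y q = \<zero>\<^bsub>yob V y\<^esub>"
  obtains r where "r \<in> elts R y" "q = d y r"
proof -
  have "q \<in> d y ` elts R y"
    using assms by (simp add: exact mem_a_kernel)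
  then show thesis
    using that by blast
qed

lemma equal_image_lift:
  assumes "q \<in> elts Q y" "q' \<in> elts Q y" "e y q = e y q'"
  obtains r where "r \<in> elts R y" "q = q' \<oplus>\<^bsub>yob Q y\<^esub> d y r" "q \<ominus>\<^bsub>yob Q y\<^esub> d y r = q'"
proof -
  have "e y (q \<ominus>\<^bsub>yob Q y\<^esub> q') = \<zero>\<^bsub>yob V y\<^esub>"
    using linear_map_minus[OF MQ.module_axioms MV.module_axioms yhomD(1)[OF e] assms(1,2)] assms(3)
      yhom_closed[OF e assms(2)]
    by (simp add: MV.minus_eq_zero_iff)
  then obtain r where "r \<in> elts R y" "q \<ominus>\<^bsub>yob Q y\<^esub> q' = d y r"
    using assms by (auto elim: kernel_lift[rotated])
  then show thesis
    using assms that[of r] by (metis MQ.minus_add_cancel MQ.minus_minus_cancel)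
qed

text \<open>The image of q in V comes from a degree strictly below x, and a lift of it to Q in that
  degree differs from q at x by a relation only.\<close>

lemma vanishing_0_of_determined:
  assumes "determined_by N V" "\<not> x \<le> hyperbola N" "q \<in> elts Q x"
  shows "\<exists>r\<in>elts R x. q \<ominus>\<^bsub>yob Q x\<^esub> d x r \<in> aug_sub K Q x"
proof -
  let ?z = "inf x (hyperbola N)"
  have z: "?z < x"
    using assms(2) by (auto simp: less_young_def) (metis inf.cobounded2)
  obtain v where v: "v \<in> elts V ?z" "ytr V ?z x v = e x q"
    by (rule determined_by_lift[OF assms(1) yhom_closed[OF e assms(3)]])
  obtain q0 where q0: "q0 \<in> elts Q ?z" "e ?z q0 = v"
    by (rule ysurjD[OF e_surj v(1)])
  have "e x q = e x (ytr Q ?z x q0)"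
    using v q0 by (simp add: yhomD(2)[OF e])
  then obtain r where r: "r \<in> elts R x" "q \<ominus>\<^bsub>yob Q x\<^esub> d x r = ytr Q ?z x q0"
    using equal_image_lift[OF assms(3) ytr_closed[OF Q less_imp_le[OF z] q0(1)]] by blast
  moreover have "ytr Q ?z x q0 \<in> aug_sub K Q x"
    unfolding aug_sub_eq_span_from using z q0(1) by (intro span_from_ytr) (auto simp: less_imp_le)
  ultimately show ?thesis
    by metis
qed

text \<open>Surjectivity of the maps of V moves every element of \<open>aug_sub\<close> at x into
  degree \<open>inf x (hyperbola N)\<close>, up to relations from degrees below x. Their injectivity
  then shows that what is left of the relation d r is a relation in that smaller degree
  already.\<close>

lemma vanishing_1_of_determined:
  assumes det: "determined_by N V" and x: "\<not> x \<le> hyperbola N"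
    and r: "r \<in> elts R x" "d x r \<in> aug_sub K Q x"
  shows "d x r \<in> d x ` aug_sub K R x"
proof -
  let ?z = "inf x (hyperbola N)"
  have z: "?z < x" "?z \<le> x"
    using x by (auto simp: less_young_def) (metis inf.cobounded2)
  have lower: "ytr Q y x (d y r) \<in> d x ` aug_sub K R x" if "y < x" "r \<in> elts R y" for y r
    using that unfolding aug_sub_eq_span_from
    by (intro image_eqI[of _ _ "ytr R y x r"]) (auto simp: yhomD(2)[OF d] span_from_ytr less_imp_le)
  have D: "submodule (d x ` aug_sub K R x) K (yob Q x)"
    by (rule submodule_image[OF MR.module_axioms MQ.module_axioms yhomD(1)[OF d] submodule_aug_sub[OF R]])
  have B: "submodule (ytr Q ?z x ` elts Q ?z) K (yob Q x)"
    by (rule submodule_image[OF MQ.module_axioms MQ.module_axioms young_moduleD(2)[OF Q z(2)] MQ.carrier_is_submodule])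
  let ?S = "{a \<oplus>\<^bsub>yob Q x\<^esub> b |a b. a \<in> d x ` aug_sub K R x \<and> b \<in> ytr Q ?z x ` elts Q ?z}"
  have "aug_sub K Q x \<subseteq> ?S"
    unfolding aug_sub_eq_span_from[of K Q x]
  proof (rule span_from_least)
    show "submodule ?S K (yob Q x)"
      by (rule submodule_sum[OF MQ.module_axioms D B])
  next
    fix y q assume y: "y \<in> {y. y < x}" and q: "q \<in> elts Q y"
    \<comment> \<open>At the price of a relation in degree y, the element q is replaced by one from
      degree ?w, which is below ?z because y is below x.\<close>
    let ?w = "inf y (hyperbola N)"
    have w: "?w \<le> y" "?w \<le> ?z" "y \<le> x"
      using y by (auto simp: less_imp_le intro: order_trans[OF inf.cobounded1])
    obtain v where v: "v \<in> elts V ?w" "ytr V ?w y v = e y q"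
      by (rule determined_by_lift[OF det yhom_closed[OF e q]])
    obtain q' where q': "q' \<in> elts Q ?w" "e ?w q' = v"
      by (rule ysurjD[OF e_surj v(1)])
    have q'y: "ytr Q ?w y q' \<in> elts Q y"
      by (rule ytr_closed[OF Q w(1) q'(1)])
    have "e y q = e y (ytr Q ?w y q')"
      using v q' w by (simp add: yhomD(2)[OF e])
    then obtain s where s: "s \<in> elts R y" "q = ytr Q ?w y q' \<oplus>\<^bsub>yob Q y\<^esub> d y s"
      using equal_image_lift[OF q q'y] by blast
    have "ytr Q y x q = ytr Q y x (ytr Q ?w y q') \<oplus>\<^bsub>yob Q x\<^esub> ytr Q y x (d y s)"
      unfolding s(2) by (rule ytr_add[OF Q w(3) q'y yhom_closed[OF d s(1)]])
    also have "ytr Q y x (ytr Q ?w y q') = ytr Q ?z x (ytr Q ?w ?z q')"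
      using w z q'(1) by (simp add: young_moduleD(4)[OF Q])
    finally have "ytr Q y x q = ytr Q y x (d y s) \<oplus>\<^bsub>yob Q x\<^esub> ytr Q ?z x (ytr Q ?w ?z q')"
      using ytr_closed[OF Q w(3) yhom_closed[OF d s(1)]] ytr_closed[OF Q z(2) ytr_closed[OF Q w(2) q'(1)]]
      by (simp add: MQ.a_comm)
    then show "ytr Q y x q \<in> ?S"
      using lower[of y s] s(1) y ytr_closed[OF Q w(2) q'(1)] by blast
  qed
  then obtain a b where a: "a \<in> aug_sub K R x" and b: "b \<in> elts Q ?z"
    and eq: "d x r = d x a \<oplus>\<^bsub>yob Q x\<^esub> ytr Q ?z x b"
    using r(2) by blast
  have ac: "a \<in> elts R x"
    using a MR.submoduleE(1)[OF submodule_aug_sub[OF R]] by blast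
  \<comment> \<open>Applying e kills the two relations and leaves the statement that the image of b
    in V vanishes at x.\<close>
  have "e x (d x r) = e x (d x a) \<oplus>\<^bsub>yob V x\<^esub> e x (ytr Q ?z x b)"
    unfolding eq by (rule yhom_add[OF e yhom_closed[OF d ac] ytr_closed[OF Q z(2) b]])
  then have "ytr V ?z x (e ?z b) = \<zero>\<^bsub>yob V x\<^esub>"
    using r(1) ac ytr_closed[OF V z(2) yhom_closed[OF e b]] by (simp add: e_d yhomD(2)[OF e z(2) b])
  then have "e ?z b = \<zero>\<^bsub>yob V ?z\<^esub>"
    by (rule determined_by_zero[OF V det yhom_closed[OF e b]])
  then obtain s where s: "s \<in> elts R ?z" "b = d ?z s"
    by (rule kernel_lift[OF b])
  have "ytr Q ?z x b \<in> d x ` aug_sub K R x"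
    unfolding s(2) by (rule lower[OF z(1) s(1)])
  then show ?thesis
    using MQ.submoduleE(5)[OF D] a unfolding eq by blast
qed

section \<open>From vanishing of H_0 and H_1 in large norms to a determined module\<close>

context
  fixes N
  assumes hyp0: "\<And>y q. \<lbrakk>sum_norm y > N; q \<in> elts Q y\<rbrakk>
      \<Longrightarrow> \<exists>r\<in>elts R y. q \<ominus>\<^bsub>yob Q y\<^esub> d y r \<in> aug_sub K Q y"
    and hyp1: "\<And>y r. \<lbrakk>sum_norm y > N; r \<in> elts R y; d y r \<in> aug_sub K Q y\<rbrakk>
      \<Longrightarrow> \<exists>u\<in>elts R y. d y u = \<zero>\<^bsub>yob Q y\<^esub> \<and> r \<ominus>\<^bsub>yob R y\<^esub> u \<in> aug_sub K R y"
begin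

text \<open>In norms above N, \<open>hyp0\<close> expresses an element modulo relations through
  strictly smaller degrees, and induction on the norm finishes. So V is generated in norms at most
  N.\<close>

lemma low_degree_generators:
  assumes "q \<in> elts Q x"
  shows "q \<in> {a \<oplus>\<^bsub>yob Q x\<^esub> b |a b. a \<in> d x ` elts R x \<and> b \<in> span_from K Q {y. sum_norm y \<le> N} x}"
  using assms
proof (induction x arbitrary: q rule: measure_induct_rule[of sum_norm])
  case (less x)
  let ?S = "\<lambda>x. {a \<oplus>\<^bsub>yob Q x\<^esub> b |a b. a \<in> d x ` elts R x \<and> b \<in> span_from K Q {y. sum_norm y \<le> N} x}"
  have D: "submodule (d x ` elts R x) K (yob Q x)"
    by (rule submodule_image[OF MR.module_axioms MQ.module_axioms yhomD(1)[OF d] MR.carrier_is_submodule])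
  note sp = submodule_span_from[OF Q, of "{y. sum_norm y \<le> N}" x]
  have S: "submodule (?S x) K (yob Q x)"
    by (rule submodule_sum[OF MQ.module_axioms D sp])
  show ?case
  proof (cases "sum_norm x \<le> N")
    case True
    then have "ytr Q x x q \<in> span_from K Q {y. sum_norm y \<le> N} x"
      using less.prems by (intro span_from_ytr) auto
    then have "\<zero>\<^bsub>yob Q x\<^esub> \<oplus>\<^bsub>yob Q x\<^esub> q \<in> ?S x"
      using submodule_zero_mem[OF D] young_moduleD(3)[OF Q less.prems] by auto
    then show ?thesis
      using less.prems by simp
  next
    case False
    then obtain r where r: "r \<in> elts R x" "q \<ominus>\<^bsub>yob Q x\<^esub> d x r \<in> aug_sub K Q x"
      using hyp0[of x q] less.prems by auto
    have "aug_sub K Q x \<subseteq> ?S x"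
      unfolding aug_sub_eq_span_from
    proof (rule span_from_least[OF S])
      fix y v assume y: "y \<in> {y. y < x}" "y \<le> x" and v: "v \<in> elts Q y"
      obtain s w where s: "s \<in> elts R y" and w: "w \<in> span_from K Q {y. sum_norm y \<le> N} y"
        and vsw: "v = d y s \<oplus>\<^bsub>yob Q y\<^esub> w"
        using less.IH[OF _ v] y sum_norm_strict_mono by blast
      have "ytr Q y x v = ytr Q y x (d y s) \<oplus>\<^bsub>yob Q x\<^esub> ytr Q y x w"
        unfolding vsw
        by (rule ytr_add[OF Q y(2) yhom_closed[OF d s] span_from_carrier[OF Q w]])
      also have "ytr Q y x (d y s) = d x (ytr R y x s)"
        by (simp add: yhomD(2)[OF d y(2) s])
      finally show "ytr Q y x v \<in> ?S x"
        using ytr_closed[OF R y(2) s] span_from_push[OF Q y(2) w] by blast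
    qed
    then have m: "q \<ominus>\<^bsub>yob Q x\<^esub> d x r \<in> ?S x"
      using r(2) by blast
    have rc: "d x r \<in> elts Q x"
      by (rule yhom_closed[OF d r(1)])
    have "d x r \<oplus>\<^bsub>yob Q x\<^esub> \<zero>\<^bsub>yob Q x\<^esub> \<in> ?S x"
      using r(1) submodule_zero_mem[OF sp] by blast
    then have "d x r \<in> ?S x"
      using rc by simp
    from MQ.submoduleE(5)[OF S this m] show ?thesis
      using MQ.minus_add_cancel[OF less.prems rc] by simp
  qed
qed

text \<open>The same removal of degrees, applied to the element r of R. By \<open>hyp1\<close> its
  part u of top degree is an element of lower degrees plus a cycle; dropping the cycle leaves d r
  unchanged throughout the induction. The set \<open>A\<close> may contain x itself, so every r at x
  is covered.\<close>

lemma low_degree_relations: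
  assumes A: "finite A" "\<forall>y\<in>A. y \<le> x" "\<forall>y\<in>A. \<forall>z\<le>y. z \<in> A"
    and r: "r \<in> span_from K R A x" "d x r \<in> span_from K Q {y. sum_norm y \<le> N} x"
  shows "\<exists>s\<in>elts R (inf x (hyperbola N)). d x r = d x (ytr R (inf x (hyperbola N)) x s)"
  using A r
proof (induction A arbitrary: r rule: finite_psubset_induct)
  case (psubset A)
  show ?case
  proof (cases "\<exists>a\<in>A. sum_norm a > N")
    case True
    obtain a where a: "a \<in> A" "\<forall>b\<in>A. sum_norm b \<le> sum_norm a"
      using exists_max_sum_norm[OF psubset.hyps(1)] True by blast
    then have aN: "sum_norm a > N"
      using True by force
    note A' = remove_maximal[OF a psubset.prems(2)]
    have ax: "a \<le> x"
      using psubset.prems(1) a(1) by auto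
    have "r \<in> span_from K R (insert a (A - {a})) x"
      using psubset.prems(3) a(1) by (simp add: insert_absorb)
    then obtain u w where u: "u \<in> elts R a" and w: "w \<in> span_from K R (A - {a}) x"
      and ruw: "r = ytr R a x u \<oplus>\<^bsub>yob R x\<^esub> w"
      by (rule span_from_insert[OF R ax])
    have "c a a (d a u) = c a x (d x r)"
      unfolding ruw by (rule coordinate_of_image[OF cQ R d ax u w A'(2), symmetric])
    \<comment> \<open>By monotonicity of the norm, a is below no degree of norm at most N, so
      elements generated in those degrees have no component of degree a.\<close>
    also have "\<dots> = \<zero>\<^bsub>E a\<^esub>"
    proof (rule coordinates_span_from[OF cQ psubset.prems(4)])
      fix z assume "z \<in> {y. sum_norm y \<le> N}"
      then show "\<not> a \<le> z"
        using aN sum_norm_mono[of a z] by auto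
    qed
    finally have "d a u \<in> aug_sub K Q a"
      by (rule coordinatesD(6)[OF cQ yhom_closed[OF d u]])
    from hyp1[OF aN u this] obtain t where t: "t \<in> elts R a" "d a t = \<zero>\<^bsub>yob Q a\<^esub>"
      and ut: "u \<ominus>\<^bsub>yob R a\<^esub> t \<in> aug_sub K R a"
      by blast
    define r' where "r' = ytr R a x (u \<ominus>\<^bsub>yob R a\<^esub> t) \<oplus>\<^bsub>yob R x\<^esub> w"
    have "u \<ominus>\<^bsub>yob R a\<^esub> t \<in> span_from K R (A - {a}) a"
      using ut span_from_mono[OF R, of "{y. y < a}" a "A - {a}"] A'(3)
      unfolding aug_sub_eq_span_from by blast
    then have r's: "r' \<in> span_from K R (A - {a}) x"
      unfolding r'_def
      using MR.submoduleE(5)[OF submodule_span_from[OF R]] span_from_push[OF R ax] w by blast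
    have wc: "w \<in> elts R x"
      by (rule span_from_carrier[OF R w])
    have utc: "u \<ominus>\<^bsub>yob R a\<^esub> t \<in> elts R a"
      using u t by simp
    have "d a (u \<ominus>\<^bsub>yob R a\<^esub> t) = d a u"
      using linear_map_minus[OF MR.module_axioms MQ.module_axioms yhomD(1)[OF d] u t(1)] t(2)
        yhom_closed[OF d u] by (simp add: a_minus_def)
    then have "d x (ytr R a x (u \<ominus>\<^bsub>yob R a\<^esub> t)) = d x (ytr R a x u)"
      using utc u by (simp add: yhomD(2)[OF d ax])
    then have dr: "d x r' = d x r"
      unfolding ruw r'_def
      using yhom_add[OF d ytr_closed[OF R ax utc] wc]
        yhom_add[OF d ytr_closed[OF R ax u] wc] by simp
    moreover have "\<forall>y\<in>A - {a}. y \<le> x" "A - {a} \<subset> A"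
      using psubset.prems(1) a(1) by auto
    ultimately have "\<exists>s\<in>elts R (inf x (hyperbola N)). d x r' = d x (ytr R (inf x (hyperbola N)) x s)"
      using psubset.IH[of "A - {a}" r'] A'(1) r's psubset.prems(4) unfolding dr by blast
    then show ?thesis
      unfolding dr .
  next
    case False
    have "y \<le> inf x (hyperbola N)" if "y \<in> A" "y \<le> x" for y
      using that False le_hyperbola[of y N] by (auto simp: not_less)
    then have "r \<in> ytr R (inf x (hyperbola N)) x ` elts R (inf x (hyperbola N))"
      using psubset.prems(3) span_from_le_image[OF R inf.cobounded1] by blast
    then obtain s where "s \<in> elts R (inf x (hyperbola N))" "r = ytr R (inf x (hyperbola N)) x s"
      by (rule imageE)
    then show ?thesis
      by (intro bexI[of _ s]) simp_all
  qed
qed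

text \<open>For surjectivity, a lift to Q is up to relations generated in norms at most N, hence
  below the hyperbola. For injectivity, a vector that dies at x has such a lift w, and pushing w to
  x gives a relation. This relation comes from degree \<open>inf x (hyperbola N)\<close>, and the
  maps of Q, being injective, turn it into an equation w = d t in that degree.\<close>

lemma determined_of_vanishing: "determined_by N V"
proof (rule determined_byI[OF V])
  fix x v assume v: "v \<in> elts V x"
  obtain q where q: "q \<in> elts Q x" "e x q = v"
    by (rule ysurjD[OF e_surj v])
  obtain r w where r: "r \<in> elts R x" and w: "w \<in> span_from K Q {y. sum_norm y \<le> N} x"
    and qrw: "q = d x r \<oplus>\<^bsub>yob Q x\<^esub> w"
    using low_degree_generators[OF q(1)] by blast
  have "v = e x w"
    using q(2) yhom_add[OF e yhom_closed[OF d r] span_from_carrier[OF Q w]]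
      yhom_closed[OF e span_from_carrier[OF Q w]] r
    by (simp add: qrw e_d)
  then have "v \<in> span_from K V {y. sum_norm y \<le> N} x"
    using span_from_hom[OF Q V e w] by simp
  then show "v \<in> ytr V (inf x (hyperbola N)) x ` elts V (inf x (hyperbola N))"
    by (rule subsetD[OF span_from_le_image[OF V inf.cobounded1], rotated]) (simp add: le_hyperbola)
next
  fix x v
  let ?z = "inf x (hyperbola N)"
  assume v: "v \<in> elts V ?z" and v0: "ytr V ?z x v = \<zero>\<^bsub>yob V x\<^esub>"
  have z: "?z \<le> x"
    by simp
  obtain q where q: "q \<in> elts Q ?z" "e ?z q = v"
    by (rule ysurjD[OF e_surj v])
  obtain r w where r: "r \<in> elts R ?z" and w: "w \<in> span_from K Q {y. sum_norm y \<le> N} ?z"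
    and qrw: "q = d ?z r \<oplus>\<^bsub>yob Q ?z\<^esub> w"
    using low_degree_generators[OF q(1)] by blast
  have wc: "w \<in> elts Q ?z"
    by (rule span_from_carrier[OF Q w])
  have ew: "v = e ?z w"
    using q(2) yhom_add[OF e yhom_closed[OF d r] wc] yhom_closed[OF e wc] r
    by (simp add: qrw e_d)
  have "e x (ytr Q ?z x w) = \<zero>\<^bsub>yob V x\<^esub>"
    using v0 by (simp add: yhomD(2)[OF e z wc] ew)
  then obtain s where s: "s \<in> elts R x" "ytr Q ?z x w = d x s"
    by (rule kernel_lift[OF ytr_closed[OF Q z wc]])
  have "s \<in> span_from K R {y. y \<le> x} x"
    using span_from_ytr[of x "{y. y \<le> x}" x s R K] s(1) young_moduleD(3)[OF R s(1)] by simp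
  moreover have "d x s \<in> span_from K Q {y. sum_norm y \<le> N} x"
    using span_from_push[OF Q z w] s(2) by simp
  ultimately have "\<exists>t\<in>elts R ?z. d x s = d x (ytr R ?z x t)"
    by (intro low_degree_relations[of "{y. y \<le> x}"] finite_young_below) (auto intro: order_trans)
  then obtain t where t: "t \<in> elts R ?z" "d x s = d x (ytr R ?z x t)"
    by blast
  have dt: "d ?z t \<in> elts Q ?z"
    by (rule yhom_closed[OF d t(1)])
  have "ytr Q ?z x (w \<ominus>\<^bsub>yob Q ?z\<^esub> d ?z t) = \<zero>\<^bsub>yob Q x\<^esub>"
    using linear_map_minus[OF MQ.module_axioms MQ.module_axioms young_moduleD(2)[OF Q z] wc dt]
      s(2) t ytr_closed[OF Q z dt] by (simp add: yhomD(2)[OF d z t(1)] MQ.minus_eq_zero_iff)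
  then have "w \<ominus>\<^bsub>yob Q ?z\<^esub> d ?z t = \<zero>\<^bsub>yob Q ?z\<^esub>"
    using wc dt by (intro coordinates_injective[OF cQ z]) auto
  then have "w = d ?z t"
    using wc dt by (simp add: MQ.minus_eq_zero_iff)
  then show "v = \<zero>\<^bsub>yob V ?z\<^esub>"
    using ew e_d[OF t(1)] by simp
qed

end

end

section \<open>Vanishing of Tor\<close>

text \<open>The elements of the homology are the cosets of cycles, and such a coset is zero exactly
  when the cycle is a boundary.\<close>

lemma homology_zero_iff:
  fixes C :: "nat \<Rightarrow> ('k, 'b) ymodule"
  assumes M: "Module.module K (yob (C i) x)"
    and Z: "submodule (cycles C d i x) K (yob (C i) x)"
    and B: "submodule (d i x ` elts (C (Suc i)) x) K (yob (C i) x)"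
  shows "elts (homology_of C d i) x = {\<zero>\<^bsub>yob (homology_of C d i) x\<^esub>} \<longleftrightarrow>
    cycles C d i x \<subseteq> d i x ` elts (C (Suc i)) x"
proof -
  let ?Z = "cycles C d i x" and ?B = "d i x ` elts (C (Suc i)) x"
  have "elts (homology_of C d i) x = (\<lambda>v. ?B +>\<^bsub>yob (C i) x\<^esub> v) ` ?Z"
    by (auto simp: homology_of_def quot_ymodule_def sub_ymodule_def quot_module_def
        A_RCOSETS_def' a_r_coset_def')
  moreover have "\<zero>\<^bsub>yob (homology_of C d i) x\<^esub> = ?B"
    by (simp add: homology_of_def quot_ymodule_def sub_ymodule_def quot_module_def)
  moreover have "?B +>\<^bsub>yob (C i) x\<^esub> v = ?B \<longleftrightarrow> v \<in> ?B" if "v \<in> ?Z" for v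
    using that Module.module.submoduleE(1)[OF M Z] by (intro coset_eq_self_iff[OF M B]) auto
  moreover have "?Z \<noteq> {}"
    using submodule_zero_mem[OF Z] by auto
  moreover have "f ` A = {b} \<longleftrightarrow> (\<forall>a\<in>A. f a = b)" if "A \<noteq> {}" for A b and f :: "'b \<Rightarrow> 'b set"
    using that by auto
  ultimately show ?thesis
    by (simp add: subset_eq)
qed

lemma yob_H0: "yob (H0 K P) x = quot_module (yob P x) (aug_sub K P x)"
  by (simp add: H0_def quot_ymodule_def)

text \<open>The negation of the condition that selects the degrees over which \<open>hdeg\<close>
  takes its supremum.\<close>

definition tor_vanishes :: "('k, 'c) ring_scheme \<Rightarrow> nat \<Rightarrow> ('k, 'v) ymodule \<Rightarrow> young \<Rightarrow> bool" where
  "tor_vanishes K i V x \<longleftrightarrow>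
     elts (Tor_homology K i V) x = {\<zero>\<^bsub>yob (Tor_homology K i V) x\<^esub>}"

context
  fixes K :: "('k, 'c) ring_scheme" and P :: "nat \<Rightarrow> ('k, 'v) ymodule" and d
  assumes P: "\<And>n. young_module K (P n)" and d: "\<And>n. d n \<in> yhom K (P (Suc n)) (P n)"
begin

private abbreviation (input) "C \<equiv> \<lambda>n. H0 K (P n)"
private abbreviation (input) "\<delta> \<equiv> \<lambda>n. H0_map K (P n) (d n)"

private lemma aug_image: "d n x ` aug_sub K (P (Suc n)) x \<subseteq> aug_sub K (P n) x"
  using aug_sub_hom[OF P P d] by blast

private lemma H0_map_coset:
  "p \<in> elts (P (Suc n)) x \<Longrightarrow> \<delta> n x (aug_sub K (P (Suc n)) x +>\<^bsub>yob (P (Suc n)) x\<^esub> p)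
    = aug_sub K (P n) x +>\<^bsub>yob (P n) x\<^esub> d n x p"
  unfolding H0_map_def
  by (rule quot_map_coset[OF young_moduleD(1)[OF P] submodule_aug_sub[OF P] young_moduleD(1)[OF P]
        submodule_aug_sub[OF P] yhomD(1)[OF d] aug_image])

private lemma H0_module: "Module.module K (yob (C n) x)"
  unfolding yob_H0 by (rule quot_module_module[OF young_moduleD(1)[OF P] submodule_aug_sub[OF P]])

private lemma H0_map_linear: "linear_map K (yob (C (Suc n)) x) (yob (C n) x) (\<delta> n x)"
  unfolding yob_H0 H0_map_def
  by (rule quot_map_linear[OF young_moduleD(1)[OF P] submodule_aug_sub[OF P] young_moduleD(1)[OF P]
        submodule_aug_sub[OF P] yhomD(1)[OF d] aug_image])

private lemma H0_carrier:
  "elts (C n) x = (\<lambda>p. aug_sub K (P n) x +>\<^bsub>yob (P n) x\<^esub> p) ` elts (P n) x"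
  unfolding yob_H0 by (rule quot_module_carrier[OF young_moduleD(1)[OF P] submodule_aug_sub[OF P]])

text \<open>The passage from cosets to elements: a class is a boundary when a representative is
  congruent to an image of d modulo lower degrees.\<close>

private lemma boundary_iff:
  assumes "p \<in> elts (P n) x"
  shows "aug_sub K (P n) x +>\<^bsub>yob (P n) x\<^esub> p \<in> \<delta> n x ` elts (C (Suc n)) x \<longleftrightarrow>
    (\<exists>q\<in>elts (P (Suc n)) x. p \<ominus>\<^bsub>yob (P n) x\<^esub> d n x q \<in> aug_sub K (P n) x)"
proof -
  have "\<delta> n x ` elts (C (Suc n)) x
      = (\<lambda>q. aug_sub K (P n) x +>\<^bsub>yob (P n) x\<^esub> d n x q) ` elts (P (Suc n)) x"
    unfolding H0_carrier image_image by (rule image_cong) (simp_all add: H0_map_coset)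
  moreover have "aug_sub K (P n) x +>\<^bsub>yob (P n) x\<^esub> p = aug_sub K (P n) x +>\<^bsub>yob (P n) x\<^esub> d n x q \<longleftrightarrow>
      p \<ominus>\<^bsub>yob (P n) x\<^esub> d n x q \<in> aug_sub K (P n) x" if "q \<in> elts (P (Suc n)) x" for q
    by (rule coset_eq_iff[OF young_moduleD(1)[OF P] submodule_aug_sub[OF P] assms yhom_closed[OF d that]])
  ultimately show ?thesis
    by (auto simp: image_iff)
qed

private lemma boundary_submodule:
  "submodule (\<delta> n x ` elts (C (Suc n)) x) K (yob (C n) x)"
  by (rule submodule_image[OF H0_module H0_module H0_map_linear Module.module.carrier_is_submodule[OF H0_module]])

lemma homology_H0_vanishes_0:
  "elts (homology_of C \<delta> 0) x = {\<zero>\<^bsub>yob (homology_of C \<delta> 0) x\<^esub>} \<longleftrightarrow>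
    (\<forall>p\<in>elts (P 0) x. \<exists>q\<in>elts (P (Suc 0)) x.
      p \<ominus>\<^bsub>yob (P 0) x\<^esub> d 0 x q \<in> aug_sub K (P 0) x)"
proof -
  have c: "cycles C \<delta> 0 x = elts (C 0) x"
    by (simp add: cycles_def)
  have "submodule (cycles C \<delta> 0 x) K (yob (C 0) x)"
    unfolding c by (rule Module.module.carrier_is_submodule[OF H0_module])
  note zero = homology_zero_iff[of K C 0 x \<delta>, OF H0_module this boundary_submodule]
  show ?thesis
    unfolding zero c H0_carrier[of 0] image_subset_iff by (rule ball_cong[OF refl boundary_iff])
qed

text \<open>A cycle is the class of some p whose image lies in \<open>aug_sub\<close>. The criterion
  obtained has exactly the form of the premise of \<open>vanishing_step\<close>.\<close>

lemma homology_H0_vanishes_Suc: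
  "elts (homology_of C \<delta> (Suc n)) x = {\<zero>\<^bsub>yob (homology_of C \<delta> (Suc n)) x\<^esub>} \<longleftrightarrow>
    (\<forall>p\<in>elts (P (Suc n)) x. d n x p \<in> aug_sub K (P n) x \<longrightarrow>
      (\<exists>q\<in>elts (P (Suc (Suc n))) x.
        p \<ominus>\<^bsub>yob (P (Suc n)) x\<^esub> d (Suc n) x q \<in> aug_sub K (P (Suc n)) x))"
proof -
  have c: "cycles C \<delta> (Suc n) x = a_kernel (yob (C (Suc n)) x) (yob (C n) x) (\<delta> n x)"
    by (simp add: cycles_def)
  have z: "\<zero>\<^bsub>yob (C n) x\<^esub> = aug_sub K (P n) x"
    by (simp add: yob_H0 quot_module_def)
  have "aug_sub K (P n) x +>\<^bsub>yob (P n) x\<^esub> d n x p = aug_sub K (P n) x \<longleftrightarrow> d n x p \<in> aug_sub K (P n) x"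
    if "p \<in> elts (P (Suc n)) x" for p
    by (rule coset_eq_self_iff[OF young_moduleD(1)[OF P] submodule_aug_sub[OF P] yhom_closed[OF d that]])
  then have c': "cycles C \<delta> (Suc n) x = (\<lambda>p. aug_sub K (P (Suc n)) x +>\<^bsub>yob (P (Suc n)) x\<^esub> p) `
      {p \<in> elts (P (Suc n)) x. d n x p \<in> aug_sub K (P n) x}"
    unfolding c by (auto simp: mem_a_kernel H0_carrier H0_map_coset z)
  have "submodule (cycles C \<delta> (Suc n) x) K (yob (C (Suc n)) x)"
    unfolding c by (rule submodule_a_kernel[OF H0_module H0_module H0_map_linear])
  note zero = homology_zero_iff[of K C "Suc n" x \<delta>, OF H0_module this boundary_submodule]
  have "(\<forall>p\<in>{p \<in> elts (P (Suc n)) x. d n x p \<in> aug_sub K (P n) x}.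
      aug_sub K (P (Suc n)) x +>\<^bsub>yob (P (Suc n)) x\<^esub> p \<in> \<delta> (Suc n) x ` elts (C (Suc (Suc n))) x)
    \<longleftrightarrow> (\<forall>p\<in>{p \<in> elts (P (Suc n)) x. d n x p \<in> aug_sub K (P n) x}.
      \<exists>q\<in>elts (P (Suc (Suc n))) x.
        p \<ominus>\<^bsub>yob (P (Suc n)) x\<^esub> d (Suc n) x q \<in> aug_sub K (P (Suc n)) x)"
    by (rule ball_cong[OF refl boundary_iff]) simp
  then show ?thesis
    unfolding zero c' image_subset_iff by blast
qed

end

text \<open>One resolution, the chosen one, serves all degrees at once, so that statements about
  consecutive Tor groups speak of the same complex.\<close>

lemma tor_vanishes_resolution:
  fixes K :: "('k, 'c) ring_scheme" and V :: "('k, 'v) ymodule"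
  assumes "field K" "infinite (UNIV :: 'v set)" and V: "young_module K V"
  shows "\<exists>P d e. projective_resolution K V P d e \<and>
    (\<forall>x. tor_vanishes K 0 V x \<longleftrightarrow> (\<forall>p\<in>elts (P 0) x. \<exists>q\<in>elts (P (Suc 0)) x.
      p \<ominus>\<^bsub>yob (P 0) x\<^esub> d 0 x q \<in> aug_sub K (P 0) x)) \<and>
    (\<forall>n x. tor_vanishes K (Suc n) V x \<longleftrightarrow>
      (\<forall>p\<in>elts (P (Suc n)) x. d n x p \<in> aug_sub K (P n) x \<longrightarrow>
        (\<exists>q\<in>elts (P (Suc (Suc n))) x.
          p \<ominus>\<^bsub>yob (P (Suc n)) x\<^esub> d (Suc n) x q \<in> aug_sub K (P (Suc n)) x)))"
proof -
  obtain P d where Pd: "chosen_resolution K V = (P, d)"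
    by fastforce
  have "\<exists>Pd. case Pd of (P, d) \<Rightarrow> \<exists>e. projective_resolution K V P d e"
    using projective_resolution_exists[OF assms] by auto
  from someI_ex[OF this] obtain e where res: "projective_resolution K V P d e"
    using Pd unfolding chosen_resolution_def by auto
  then have P: "young_module K (P n)" and d: "d n \<in> yhom K (P (Suc n)) (P n)" for n
    by (auto simp: projective_resolution_def projective_ymodule_def)
  have tor: "Tor_homology K i V = homology_of (\<lambda>n. H0 K (P n)) (\<lambda>n. H0_map K (P n) (d n)) i" for i
    by (simp add: Tor_homology_def Pd)
  show ?thesis
    by (intro exI conjI allI) (rule res, unfold tor_vanishes_def tor
        homology_H0_vanishes_0[where K = K and P = P and d = d, OF P d]
        homology_H0_vanishes_Suc[where K = K and P = P and d = d, OF P d], (rule refl)+)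
qed

text \<open>A set of natural numbers is empty, has a largest element or is unbounded. In the empty
  case every bound holds and N = 0 is taken; in the second case N is the largest element.\<close>

lemma hdeg_cases:
  obtains "hdeg K i V = \<infinity>"
  | N where "hdeg K i V = -1 \<or> hdeg K i V = ereal (real N)"
    "\<And>x. \<not> tor_vanishes K i V x \<Longrightarrow> sum_norm x \<le> N"
proof -
  let ?S = "{x. \<not> tor_vanishes K i V x}"
  have h: "hdeg K i V = (if ?S = {} then -1 else (SUP x\<in>?S. ereal (real (sum_norm x))))"
    by (simp add: hdeg_def tor_vanishes_def Let_def)
  consider "?S = {}" | M where "?S \<noteq> {}" "\<forall>x\<in>?S. sum_norm x \<le> M" | "\<forall>M. \<exists>x\<in>?S. sum_norm x > M"
    by (meson not_le)
  then show thesis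
  proof cases
    case 1
    then have "hdeg K i V = -1"
      unfolding h by simp
    then show thesis
      using 1 by (intro that(2)[of 0]) auto
  next
    case 2
    let ?N = "Max (sum_norm ` ?S)"
    have fin: "finite (sum_norm ` ?S)"
      by (rule finite_subset[of _ "{..M}"]) (use 2(2) in auto)
    have le: "sum_norm x \<le> ?N" if "x \<in> ?S" for x
      using that fin by (intro Max_ge) auto
    have "?N \<in> sum_norm ` ?S"
      using fin 2(1) by (intro Max_in) auto
    then obtain x where x: "x \<in> ?S" "?N = sum_norm x"
      by auto
    have "(SUP x\<in>?S. ereal (real (sum_norm x))) = ereal (real ?N)"
    proof (rule antisym)
      show "(SUP x\<in>?S. ereal (real (sum_norm x))) \<le> ereal (real ?N)"
        by (rule SUP_least) (use le in auto)
      show "ereal (real ?N) \<le> (SUP x\<in>?S. ereal (real (sum_norm x)))"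
        unfolding x(2) by (rule SUP_upper[OF x(1)])
    qed
    then have "hdeg K i V = ereal (real ?N)"
      by (rule trans[OF h[unfolded if_not_P[OF 2(1)]]])
    then show thesis
      using le by (intro that(2)[of ?N]) auto
  next
    case 3
    have "(SUP x\<in>?S. ereal (real (sum_norm x))) = \<infinity>"
      by (rule SUP_PInfty) (use 3 in \<open>auto intro: less_imp_le\<close>)
    moreover have "?S \<noteq> {}"
      using 3 by blast
    ultimately show thesis
      by (intro that(1)) (simp only: h if_False)
  qed
qed

lemma hdeg_le:
  assumes "\<And>x. \<not> tor_vanishes K i V x \<Longrightarrow> sum_norm x \<le> N"
  shows "hdeg K i V \<le> ereal (real N)"
proof -
  have "(SUP x\<in>{x. \<not> tor_vanishes K i V x}. ereal (real (sum_norm x))) \<le> ereal (real N)"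
    by (rule SUP_least) (use assms in auto)
  then show ?thesis
    by (auto simp: hdeg_def tor_vanishes_def Let_def one_ereal_def)
qed

lemma projective_resolutionD:
  assumes "projective_resolution K V P d e"
  shows "projective_ymodule K (P n)" "young_module K (P n)" "d n \<in> yhom K (P (Suc n)) (P n)"
    "e \<in> yhom K (P 0) V" "ysurj (P 0) V e"
    "d 0 x ` elts (P (Suc 0)) x = a_kernel (yob (P 0) x) (yob V x) (e x)"
    "d (Suc n) x ` elts (P (Suc (Suc n))) x = a_kernel (yob (P (Suc n)) x) (yob (P n) x) (d n x)"
  using assms by (auto simp: projective_resolution_def projective_ymodule_def)

text \<open>With s = n + 2, the premise concerns Tor in degree s - 1 and the claim degree s.
  Coordinates are taken on \<open>P n\<close>, two steps below \<open>P s\<close>; this is where s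
  \<ge> 2 enters.\<close>

lemma tor_vanishes_beyond_hyperbola:
  fixes K :: "('k, 'c) ring_scheme" and V :: "('k, 'v) ymodule"
  assumes K: "field K" "infinite (UNIV :: 'v set)" and V: "young_module K V"
    and N: "\<And>x. \<not> tor_vanishes K (Suc n) V x \<Longrightarrow> sum_norm x \<le> N"
    and x: "\<not> x \<le> hyperbola N"
  shows "tor_vanishes K (Suc (Suc n)) V x"
proof -
  obtain P d e where res: "projective_resolution K V P d e"
    and tor': "\<forall>n x. tor_vanishes K (Suc n) V x \<longleftrightarrow>
      (\<forall>p\<in>elts (P (Suc n)) x. d n x p \<in> aug_sub K (P n) x \<longrightarrow>
        (\<exists>q\<in>elts (P (Suc (Suc n))) x.
          p \<ominus>\<^bsub>yob (P (Suc n)) x\<^esub> d (Suc n) x q \<in> aug_sub K (P (Suc n)) x))"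
    using tor_vanishes_resolution[OF K V] by (elim exE conjE)
  note tor = tor'[THEN spec, THEN spec]
  note R = projective_resolutionD[OF res]
  obtain E :: "young \<Rightarrow> ('k, 'v) module" and c where c: "coordinates K (P n) E c"
    using projective_coordinates[OF K R(1)[of n]] by blast
  have hyp: "\<exists>r\<in>elts (P (Suc (Suc n))) y. q \<ominus>\<^bsub>yob (P (Suc n)) y\<^esub> d (Suc n) y r \<in> aug_sub K (P (Suc n)) y"
    if "sum_norm y > N" "q \<in> elts (P (Suc n)) y" "d n y q \<in> aug_sub K (P n) y" for y q
  proof -
    have "tor_vanishes K (Suc n) V y"
      using N[of y] that(1) by auto
    then show ?thesis
      using that(2,3) unfolding tor by blast
  qed
  show ?thesis
    unfolding tor
  proof (intro ballI impI)
    fix r assume r: "r \<in> elts (P (Suc (Suc n))) x" "d (Suc n) x r \<in> aug_sub K (P (Suc n)) x"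
    show "\<exists>q\<in>elts (P (Suc (Suc (Suc n)))) x.
        r \<ominus>\<^bsub>yob (P (Suc (Suc n))) x\<^esub> d (Suc (Suc n)) x q \<in> aug_sub K (P (Suc (Suc n))) x"
      by (rule vanishing_step[where d' = "d (Suc n)" and d = "d n" and N = N and P = "P n",
            OF R(2) R(2) R(2) c R(3) R(3) R(3) R(7) R(7) _ x r]) (rule hyp)
  qed
qed

lemma hdeg_bound:
  fixes K :: "('k, 'c) ring_scheme" and V :: "('k, 'v) ymodule"
  assumes K: "field K" "infinite (UNIV :: 'v set)" and V: "young_module K V"
    and s: "s \<ge> 2" and pos: "hdeg K (s - 1) V > 0"
  shows "hdeg K s V \<le> hdeg K (s - 1) V * (ln_ereal (hdeg K (s - 1) V) + 1)"
proof (rule hdeg_cases[of K "s - 1" V])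
  assume "hdeg K (s - 1) V = \<infinity>"
  moreover have "ln_ereal \<infinity> = \<infinity>"
    unfolding ln_ereal_def infinity_ereal_def by (simp only: ereal.case)
  ultimately show ?thesis
    by simp
next
  fix N
  assume "hdeg K (s - 1) V = -1 \<or> hdeg K (s - 1) V = ereal (real N)"
    and N: "\<And>x. \<not> tor_vanishes K (s - 1) V x \<Longrightarrow> sum_norm x \<le> N"
  then have h: "hdeg K (s - 1) V = ereal (real N)"
    using pos by (auto simp: one_ereal_def zero_ereal_def)
  then have "N \<ge> 1"
    using pos by (auto simp: zero_ereal_def)
  define n where "n = s - 2"
  have n: "s = Suc (Suc n)"
    using s by (simp add: n_def)
  have N': "sum_norm x \<le> N" if "\<not> tor_vanishes K (Suc n) V x" for x
    using N[of x] that by (simp add: n)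
  have "tor_vanishes K s V x" if "\<not> x \<le> hyperbola N" for x
    unfolding n by (rule tor_vanishes_beyond_hyperbola[OF K V _ that]) (rule N')
  then have "hdeg K s V \<le> ereal (real (sum_norm (hyperbola N)))"
    by (intro hdeg_le sum_norm_mono) blast
  also have "\<dots> \<le> ereal (real N * (ln (real N) + 1))"
    using sum_norm_hyperbola[OF \<open>N \<ge> 1\<close>] by simp
  also have "\<dots> = hdeg K (s - 1) V * (ln_ereal (hdeg K (s - 1) V) + 1)"
    unfolding h by (simp add: ln_ereal_def one_ereal_def)
  finally show ?thesis .
qed

text \<open>Replaces a condition on the chosen resolution by one on the values and maps of V alone,
  which can be followed through kernels, cokernels and direct sums.\<close>

lemma presented_in_finite_degrees_iff:
  fixes K :: "('k, 'c) ring_scheme" and V :: "('k, 'v) ymodule"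
  assumes K: "field K" "infinite (UNIV :: 'v set)" and V: "young_module K V"
  shows "presented_in_finite_degrees K V \<longleftrightarrow> (\<exists>N. determined_by N V)"
proof -
  obtain P d e where res: "projective_resolution K V P d e"
    and tor0': "\<forall>x. tor_vanishes K 0 V x \<longleftrightarrow> (\<forall>p\<in>elts (P 0) x. \<exists>q\<in>elts (P (Suc 0)) x.
      p \<ominus>\<^bsub>yob (P 0) x\<^esub> d 0 x q \<in> aug_sub K (P 0) x)"
    and tor': "\<forall>n x. tor_vanishes K (Suc n) V x \<longleftrightarrow>
      (\<forall>p\<in>elts (P (Suc n)) x. d n x p \<in> aug_sub K (P n) x \<longrightarrow>
        (\<exists>q\<in>elts (P (Suc (Suc n))) x.
          p \<ominus>\<^bsub>yob (P (Suc n)) x\<^esub> d (Suc n) x q \<in> aug_sub K (P (Suc n)) x))"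
    using tor_vanishes_resolution[OF K V] by (elim exE conjE)
  note tor0 = tor0'[THEN spec] and tor = tor'[THEN spec, THEN spec]
  note PR = projective_resolutionD[OF res]
  obtain E :: "young \<Rightarrow> ('k, 'v) module" and c where c: "coordinates K (P 0) E c"
    using projective_coordinates[OF K PR(1)[of 0]] by blast
  interpret young_presentation K "P (Suc 0)" "P 0" V "d 0" e E c
    by (rule young_presentation.intro) (rule c V PR(2-6))+
  show ?thesis
  proof
    assume pfd: "presented_in_finite_degrees K V"
    have bounded: "\<exists>N. \<forall>x. \<not> tor_vanishes K i V x \<longrightarrow> sum_norm x \<le> N" if "hdeg K i V < \<infinity>" for i
      by (rule hdeg_cases[of K i V]) (use that in auto)
    obtain M where M: "\<And>x. \<not> tor_vanishes K 0 V x \<Longrightarrow> sum_norm x \<le> M"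
      using bounded[of 0] pfd unfolding presented_in_finite_degrees_def by blast
    obtain M' where M': "\<And>x. \<not> tor_vanishes K (Suc 0) V x \<Longrightarrow> sum_norm x \<le> M'"
      using bounded[of "Suc 0"] pfd unfolding presented_in_finite_degrees_def by auto
    have "determined_by (max M M') V"
    proof (rule determined_of_vanishing)
      fix y q assume "max M M' < sum_norm y" "q \<in> elts (P 0) y"
      then show "\<exists>r\<in>elts (P (Suc 0)) y. q \<ominus>\<^bsub>yob (P 0) y\<^esub> d 0 y r \<in> aug_sub K (P 0) y"
        using M[of y] tor0[of y] by fastforce
    next
      fix y r assume y: "max M M' < sum_norm y" and r: "r \<in> elts (P (Suc 0)) y"
        "d 0 y r \<in> aug_sub K (P 0) y"
      have "tor_vanishes K (Suc 0) V y"
        using M'[of y] y by fastforce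
      then obtain q where q: "q \<in> elts (P (Suc (Suc 0))) y"
        "r \<ominus>\<^bsub>yob (P (Suc 0)) y\<^esub> d (Suc 0) y q \<in> aug_sub K (P (Suc 0)) y"
        using r unfolding tor by blast
      \<comment> \<open>The correction supplied by the vanishing of Tor in degree 1 is an image of
        the next differential, hence a cycle, as \<open>determined_of_vanishing\<close>
        demands.\<close>
      have "d (Suc 0) y q \<in> a_kernel (yob (P (Suc 0)) y) (yob (P 0) y) (d 0 y)"
        using q(1) unfolding PR(7)[symmetric] by blast
      then show "\<exists>u\<in>elts (P (Suc 0)) y. d 0 y u = \<zero>\<^bsub>yob (P 0) y\<^esub> \<and>
          r \<ominus>\<^bsub>yob (P (Suc 0)) y\<^esub> u \<in> aug_sub K (P (Suc 0)) y"
        using q(2) by (auto simp: mem_a_kernel)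
    qed
    then show "\<exists>N. determined_by N V"
      by blast
  next
    assume "\<exists>N. determined_by N V"
    then obtain N where N: "determined_by N V"
      by blast
    have "tor_vanishes K 0 V x" if "\<not> x \<le> hyperbola N" for x
      unfolding tor0 using vanishing_0_of_determined[OF N that] by blast
    then have "hdeg K 0 V \<le> ereal (real (sum_norm (hyperbola N)))"
      by (intro hdeg_le sum_norm_mono) blast
    moreover have "tor_vanishes K (Suc 0) V x" if x: "\<not> x \<le> hyperbola N" for x
      unfolding tor
    proof (intro ballI impI)
      fix p assume p: "p \<in> elts (P (Suc 0)) x" "d 0 x p \<in> aug_sub K (P 0) x"
      show "\<exists>q\<in>elts (P (Suc (Suc 0))) x.
          p \<ominus>\<^bsub>yob (P (Suc 0)) x\<^esub> d (Suc 0) x q \<in> aug_sub K (P (Suc 0)) x"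
        by (rule lift_modulo_kernel[where d'' = "d (Suc 0)" and d' = "d 0" and x = x,
              OF PR(2) PR(2) PR(3) PR(7) p(1) vanishing_1_of_determined[OF N x p]])
    qed
    then have "hdeg K (Suc 0) V \<le> ereal (real (sum_norm (hyperbola N)))"
      by (intro hdeg_le sum_norm_mono) blast
    ultimately show "presented_in_finite_degrees K V"
      unfolding presented_in_finite_degrees_def by (auto intro: le_less_trans)
  qed
qed

section \<open>The abelian category\<close>

lemma yhom_zero_map:
  assumes "young_module K V" "young_module K W"
  shows "(\<lambda>x. \<lambda>v\<in>elts V x. \<zero>\<^bsub>yob W x\<^esub>) \<in> yhom K V W"
proof (rule yhom_restrictI[OF assms(1)])
  fix x show "linear_map K (yob V x) (yob W x) (\<lambda>v. \<zero>\<^bsub>yob W x\<^esub>)"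
    by (rule linear_map_zero_map[OF young_moduleD(1)[OF assms(2)]])
next
  fix x y v assume "x \<le> y" "v \<in> elts V x"
  show "\<zero>\<^bsub>yob W y\<^esub> = ytr W x y \<zero>\<^bsub>yob W x\<^esub>"
    by (rule linear_map_zero[symmetric, OF young_moduleD(1)[OF assms(2)] young_moduleD(1)[OF assms(2)]
          young_moduleD(2)[OF assms(2) \<open>x \<le> y\<close>]])
qed

lemma yhom_plus:
  assumes "young_module K V" "young_module K W" "f \<in> yhom K V W" "g \<in> yhom K V W"
  shows "(\<lambda>x. \<lambda>v\<in>elts V x. f x v \<oplus>\<^bsub>yob W x\<^esub> g x v) \<in> yhom K V W"
proof (rule yhom_restrictI[OF assms(1)])
  fix x show "linear_map K (yob V x) (yob W x) (\<lambda>v. f x v \<oplus>\<^bsub>yob W x\<^esub> g x v)"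
    by (rule linear_map_plus[OF young_moduleD(1)[OF assms(1)] young_moduleD(1)[OF assms(2)]
          yhomD(1)[OF assms(3)] yhomD(1)[OF assms(4)]])
next
  fix x y v assume xy: "x \<le> y" and v: "v \<in> elts V x"
  show "f y (ytr V x y v) \<oplus>\<^bsub>yob W y\<^esub> g y (ytr V x y v) = ytr W x y (f x v \<oplus>\<^bsub>yob W x\<^esub> g x v)"
    by (simp add: yhomD(2)[OF assms(3) xy v] yhomD(2)[OF assms(4) xy v]
        ytr_add[OF assms(2) xy yhom_closed[OF assms(3) v] yhom_closed[OF assms(4) v]])
qed

lemma yhom_uminus:
  assumes "young_module K V" "young_module K W" "f \<in> yhom K V W"
  shows "(\<lambda>x. \<lambda>v\<in>elts V x. \<ominus>\<^bsub>yob W x\<^esub> f x v) \<in> yhom K V W"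
proof (rule yhom_restrictI[OF assms(1)])
  fix x show "linear_map K (yob V x) (yob W x) (\<lambda>v. \<ominus>\<^bsub>yob W x\<^esub> f x v)"
    by (rule linear_map_uminus[OF young_moduleD(1)[OF assms(1)] young_moduleD(1)[OF assms(2)] yhomD(1)[OF assms(3)]])
next
  fix x y v assume xy: "x \<le> y" and v: "v \<in> elts V x"
  show "\<ominus>\<^bsub>yob W y\<^esub> f y (ytr V x y v) = ytr W x y (\<ominus>\<^bsub>yob W x\<^esub> f x v)"
    by (simp add: yhomD(2)[OF assms(3) xy v] yhom_closed[OF assms(3) v]
        linear_map_neg[OF young_moduleD(1)[OF assms(2)] young_moduleD(1)[OF assms(2)] young_moduleD(2)[OF assms(2) xy]])
qed

lemma yhom_comm_group:
  assumes V: "young_module K V" and W: "young_module K W"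
  shows "comm_group \<lparr>carrier = yhom K V W,
    mult = (\<lambda>f g x. \<lambda>v\<in>elts V x. f x v \<oplus>\<^bsub>yob W x\<^esub> g x v),
    one = (\<lambda>x. \<lambda>v\<in>elts V x. \<zero>\<^bsub>yob W x\<^esub>)\<rparr>" (is "comm_group ?G")
proof -
  interpret W: Module.module K "yob W x" for x
    by (rule young_moduleD(1)[OF W])
  note plus = yhom_plus[OF V W] and zero = yhom_zero_map[OF V W]
  show ?thesis
  proof (rule comm_groupI)
    fix f g assume f: "f \<in> carrier ?G" and g: "g \<in> carrier ?G"
    show "f \<otimes>\<^bsub>?G\<^esub> g \<in> carrier ?G"
      using f g plus by simp
    show "f \<otimes>\<^bsub>?G\<^esub> g = g \<otimes>\<^bsub>?G\<^esub> f"
      using f g by (intro ext) (auto simp: restrict_def W.a_comm yhom_closed)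
    fix h assume h: "h \<in> carrier ?G"
    show "f \<otimes>\<^bsub>?G\<^esub> g \<otimes>\<^bsub>?G\<^esub> h = f \<otimes>\<^bsub>?G\<^esub> (g \<otimes>\<^bsub>?G\<^esub> h)"
      using f g h by (intro ext) (auto simp: restrict_def W.a_assoc yhom_closed)
  next
    show "\<one>\<^bsub>?G\<^esub> \<in> carrier ?G"
      using zero by simp
  next
    fix f assume "f \<in> carrier ?G"
    then have f: "f \<in> yhom K V W"
      by simp
    have "(\<lambda>x. \<lambda>v\<in>elts V x. (\<lambda>v\<in>elts V x. \<zero>\<^bsub>yob W x\<^esub>) v \<oplus>\<^bsub>yob W x\<^esub> f x v) = f"
      by (rule yhom_eqI[OF plus[OF zero f] f]) (simp add: yhom_closed[OF f])
    then show "\<one>\<^bsub>?G\<^esub> \<otimes>\<^bsub>?G\<^esub> f = f"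
      by simp
    have "(\<lambda>x. \<lambda>v\<in>elts V x. (\<lambda>v\<in>elts V x. \<ominus>\<^bsub>yob W x\<^esub> f x v) v \<oplus>\<^bsub>yob W x\<^esub> f x v)
        = (\<lambda>x. \<lambda>v\<in>elts V x. \<zero>\<^bsub>yob W x\<^esub>)"
      by (rule yhom_eqI[OF plus[OF yhom_uminus[OF V W f] f] zero]) (simp add: yhom_closed[OF f] W.l_neg)
    then show "\<exists>g\<in>carrier ?G. g \<otimes>\<^bsub>?G\<^esub> f = \<one>\<^bsub>?G\<^esub>"
      using yhom_uminus[OF V W f] by (intro bexI[of _ "\<lambda>x. \<lambda>v\<in>elts V x. \<ominus>\<^bsub>yob W x\<^esub> f x v"]) simp_all
  qed
qed

section \<open>Factorisations, quotients, kernels and biproducts\<close>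

lemma yhom_factor_surj:
  assumes V: "young_module K V" and Q: "young_module K Q" and T: "young_module K T"
    and p: "p \<in> yhom K V Q" "ysurj V Q p" and t: "t \<in> yhom K V T"
    and ker: "\<And>x v. \<lbrakk>v \<in> elts V x; p x v = \<zero>\<^bsub>yob Q x\<^esub>\<rbrakk> \<Longrightarrow> t x v = \<zero>\<^bsub>yob T x\<^esub>"
  shows "\<exists>u\<in>yhom K Q T. \<forall>x. \<forall>v\<in>elts V x. u x (p x v) = t x v"
proof -
  interpret Q: Module.module K "yob Q x" for x
    by (rule young_moduleD(1)[OF Q])
  interpret T: Module.module K "yob T x" for x
    by (rule young_moduleD(1)[OF T])
  interpret V: Module.module K "yob V x" for x
    by (rule young_moduleD(1)[OF V])
  have dep: "t x v = t x w" if vw: "v \<in> elts V x" "w \<in> elts V x" "p x v = p x w" for x v w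
  proof -
    have "p x (v \<ominus>\<^bsub>yob V x\<^esub> w) = \<zero>\<^bsub>yob Q x\<^esub>"
      using linear_map_minus[OF V.module_axioms Q.module_axioms yhomD(1)[OF p(1)] vw(1,2)]
        yhom_closed[OF p(1) vw(2)] vw(3) by (simp add: Q.minus_eq_zero_iff)
    then have "t x (v \<ominus>\<^bsub>yob V x\<^esub> w) = \<zero>\<^bsub>yob T x\<^esub>"
      using vw by (intro ker) auto
    then show ?thesis
      using linear_map_minus[OF V.module_axioms T.module_axioms yhomD(1)[OF t] vw(1,2)]
        yhom_closed[OF t] vw by (simp add: T.minus_eq_zero_iff)
  qed
  \<comment> \<open>By \<open>dep\<close>, the value does not depend on which preimage of q is
    chosen.\<close>
  define u where "u x q = t x (SOME v. v \<in> elts V x \<and> p x v = q)" for x q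
  have u: "u x (p x v) = t x v" if v: "v \<in> elts V x" for x v
  proof -
    have "\<exists>w. w \<in> elts V x \<and> p x w = p x v"
      using v by blast
    from someI_ex[OF this] show ?thesis
      unfolding u_def by (intro dep[OF _ v]) simp_all
  qed
  have "(\<lambda>x. restrict (u x) (elts Q x)) \<in> yhom K Q T"
  proof (rule yhom_restrictI[OF Q])
    fix x
    show "linear_map K (yob Q x) (yob T x) (u x)"
    proof (rule linear_mapI)
      fix q assume "q \<in> elts Q x"
      then obtain v where v: "v \<in> elts V x" "p x v = q"
        by (rule ysurjD[OF p(2)])
      show "u x q \<in> elts T x"
        unfolding v(2)[symmetric] u[OF v(1)] by (rule yhom_closed[OF t v(1)])
      show "u x (a \<odot>\<^bsub>yob Q x\<^esub> q) = a \<odot>\<^bsub>yob T x\<^esub> u x q" if a: "a \<in> carrier K" for a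
        using u[of "a \<odot>\<^bsub>yob V x\<^esub> v" x] a v u[OF v(1)]
        by (simp add: yhom_smult[OF p(1)] yhom_smult[OF t])
      fix r assume "r \<in> elts Q x"
      then obtain w where w: "w \<in> elts V x" "p x w = r"
        by (rule ysurjD[OF p(2)])
      show "u x (q \<oplus>\<^bsub>yob Q x\<^esub> r) = u x q \<oplus>\<^bsub>yob T x\<^esub> u x r"
        using u[of "v \<oplus>\<^bsub>yob V x\<^esub> w" x] v w u[OF v(1)] u[OF w(1)]
        by (simp add: yhom_add[OF p(1)] yhom_add[OF t])
    qed
  next
    fix x y q assume xy: "x \<le> y" and "q \<in> elts Q x"
    from this(2) obtain v where v: "v \<in> elts V x" "p x v = q"
      by (rule ysurjD[OF p(2)])
    show "u y (ytr Q x y q) = ytr T x y (u x q)"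
      using u[OF ytr_closed[OF V xy v(1)]] u[OF v(1)] v
      by (simp add: yhomD(2)[OF p(1) xy] yhomD(2)[OF t xy])
  qed
  then show ?thesis
    by (rule bexI[rotated]) (simp add: u yhom_closed[OF p(1)])
qed

lemma yhom_factor_inj:
  assumes N: "young_module K N" and V: "young_module K V" and T: "young_module K T"
    and i: "i \<in> yhom K N V" "\<And>x. inj_on (i x) (elts N x)" and t: "t \<in> yhom K T V"
    and im: "\<And>x v. v \<in> elts T x \<Longrightarrow> t x v \<in> i x ` elts N x"
  shows "\<exists>u\<in>yhom K T N. \<forall>x. \<forall>v\<in>elts T x. i x (u x v) = t x v"
proof -
  interpret N: Module.module K "yob N x" for x
    by (rule young_moduleD(1)[OF N])
  interpret T: Module.module K "yob T x" for x
    by (rule young_moduleD(1)[OF T])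
  define u where "u x v = inv_into (elts N x) (i x) (t x v)" for x v
  have u: "u x v \<in> elts N x" "i x (u x v) = t x v" if "v \<in> elts T x" for x v
    using im[OF that] by (simp_all add: u_def inv_into_into f_inv_into_f)
  \<comment> \<open>Linearity and naturality of u are checked after applying i, where they become
    those of t and i.\<close>
  note eqI = inj_onD[OF i(2)]
  have "(\<lambda>x. restrict (u x) (elts T x)) \<in> yhom K T N"
  proof (rule yhom_restrictI[OF T])
    fix x
    show "linear_map K (yob T x) (yob N x) (u x)"
    proof (rule linear_mapI)
      fix v w assume vw: "v \<in> elts T x" "w \<in> elts T x"
      show "u x (v \<oplus>\<^bsub>yob T x\<^esub> w) = u x v \<oplus>\<^bsub>yob N x\<^esub> u x w"
      proof (rule eqI)
        show "i x (u x (v \<oplus>\<^bsub>yob T x\<^esub> w)) = i x (u x v \<oplus>\<^bsub>yob N x\<^esub> u x w)"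
          using vw by (simp add: u yhom_add[OF i(1)] yhom_add[OF t])
      qed (use vw u in auto)
    next
      fix a v assume av: "a \<in> carrier K" "v \<in> elts T x"
      show "u x (a \<odot>\<^bsub>yob T x\<^esub> v) = a \<odot>\<^bsub>yob N x\<^esub> u x v"
      proof (rule eqI)
        show "i x (u x (a \<odot>\<^bsub>yob T x\<^esub> v)) = i x (a \<odot>\<^bsub>yob N x\<^esub> u x v)"
          using av by (simp add: u yhom_smult[OF i(1)] yhom_smult[OF t])
      qed (use av u in auto)
    qed (rule u)
  next
    fix x y v assume xy: "x \<le> y" and v: "v \<in> elts T x"
    note c = ytr_closed[OF T xy v]
    show "u y (ytr T x y v) = ytr N x y (u x v)"
    proof (rule eqI)
      show "i y (u y (ytr T x y v)) = i y (ytr N x y (u x v))"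
        by (simp add: u(2)[OF c] yhomD(2)[OF i(1) xy u(1)[OF v]] u(2)[OF v] yhomD(2)[OF t xy v])
    qed (use u(1)[OF c] ytr_closed[OF N xy u(1)[OF v]] in auto)
  qed
  then show ?thesis
    by (rule bexI[rotated]) (simp add: u)
qed

text \<open>Cosets are nonempty disjoint sets of elements of V, so choosing a representative of each
  embeds the quotient into the type of V.\<close>

lemma quotient_exists:
  fixes K :: "('k, 'c) ring_scheme" and V :: "('k, 'v) ymodule"
  assumes V: "young_module K V" and N: "\<And>x. submodule (N x) K (yob V x)"
    and stable: "\<And>x y v. \<lbrakk>x \<le> y; v \<in> N x\<rbrakk> \<Longrightarrow> ytr V x y v \<in> N y"
  shows "\<exists>(Q :: ('k, 'v) ymodule) p. young_module K Q \<and> p \<in> yhom K V Q \<and> ysurj V Q p \<and>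
    (\<forall>x. \<forall>v\<in>elts V x. p x v = \<zero>\<^bsub>yob Q x\<^esub> \<longleftrightarrow> v \<in> N x)"
proof -
  note VM = young_moduleD(1)[OF V]
  let ?Q = "quot_ymodule V N"
  let ?\<pi> = "\<lambda>x. \<lambda>v\<in>elts V x. N x +>\<^bsub>yob V x\<^esub> v"
  have Q: "young_module K ?Q"
    by (rule young_module_quot(1)[OF V N]) (rule stable)
  have \<pi>: "?\<pi> \<in> yhom K V ?Q"
    by (rule young_module_quot(2)[OF V N]) (rule stable)
  have yobQ: "yob ?Q x = quot_module (yob V x) (N x)" for x
    by (simp add: quot_ymodule_def)
  have carr: "elts ?Q x = (\<lambda>v. N x +>\<^bsub>yob V x\<^esub> v) ` elts V x" for x
    unfolding yobQ by (rule quot_module_carrier[OF VM N])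
  have zero: "\<zero>\<^bsub>yob ?Q x\<^esub> = N x" for x
    unfolding yobQ by (simp add: quot_module_def)
  have inj: "\<exists>\<phi> :: 'v set \<Rightarrow> 'v. inj_on \<phi> (elts ?Q x)" for x
  proof (intro exI inj_onI)
    fix A B assume A: "A \<in> elts ?Q x" and B: "B \<in> elts ?Q x"
      and eq: "(SOME v. v \<in> A) = (SOME v. v \<in> B)"
    obtain a where a: "a \<in> elts V x" "A = N x +>\<^bsub>yob V x\<^esub> a"
      using A unfolding carr by (rule imageE)
    obtain b where b: "b \<in> elts V x" "B = N x +>\<^bsub>yob V x\<^esub> b"
      using B unfolding carr by (rule imageE)
    have mem: "a \<in> A" "b \<in> B"
      using a b by (simp_all add: mem_coset_iff[OF VM N])
    have "(SOME v. v \<in> A) \<in> A" "(SOME v. v \<in> B) \<in> B"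
      by (rule someI, rule mem)+
    then have "(SOME v. v \<in> A) \<in> A" "(SOME v. v \<in> A) \<in> B"
      unfolding eq by simp_all
    then show "A = B"
      unfolding a(2) b(2) mem_coset_iff[OF VM N a(1)] mem_coset_iff[OF VM N b(1)] by simp
  qed
  from transport_ymodule[OF Q inj] obtain T :: "('k, 'v) ymodule" and f g where T: "young_module K T"
    and f: "f \<in> yhom K ?Q T" and g: "g \<in> yhom K T ?Q"
    and gf: "\<And>x w. w \<in> elts ?Q x \<Longrightarrow> g x (f x w) = w"
    and fg: "\<And>x t. t \<in> elts T x \<Longrightarrow> f x (g x t) = t"
    by metis
  let ?p = "\<lambda>x. compose (elts V x) (f x) (?\<pi> x)"
  have p: "?p \<in> yhom K V T"
    by (rule yhom_comp[OF \<pi> f V])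
  have pv: "?p x v = f x (N x +>\<^bsub>yob V x\<^esub> v)" if "v \<in> elts V x" for x v
    using that by (simp add: compose_def)
  have "ysurj V T ?p"
    unfolding ysurj_def
  proof (intro allI equalityI subsetI)
    fix x t assume t: "t \<in> elts T x"
    then have "g x t \<in> elts ?Q x"
      by (rule yhom_closed[OF g])
    then obtain v where v: "v \<in> elts V x" "g x t = N x +>\<^bsub>yob V x\<^esub> v"
      unfolding carr by (rule imageE)
    then have "t = ?p x v"
      using fg[OF t] pv by simp
    then show "t \<in> ?p x ` elts V x"
      using v(1) by (rule image_eqI)
  next
    fix x t assume "t \<in> ?p x ` elts V x"
    then show "t \<in> elts T x"
      by (elim imageE) (simp only: yhom_closed[OF p])
  qed
  moreover have "?p x v = \<zero>\<^bsub>yob T x\<^esub> \<longleftrightarrow> v \<in> N x" if v: "v \<in> elts V x" for x v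
  proof -
    have c: "N x +>\<^bsub>yob V x\<^esub> v \<in> elts ?Q x" "\<zero>\<^bsub>yob ?Q x\<^esub> \<in> elts ?Q x"
      using v by (simp_all add: carr submodule_zero_mem[OF Module.module.carrier_is_submodule[OF young_moduleD(1)[OF Q]], unfolded carr])
    have "f x \<zero>\<^bsub>yob ?Q x\<^esub> = \<zero>\<^bsub>yob T x\<^esub>"
      by (rule yhom_zero[OF Q T f])
    then have "?p x v = \<zero>\<^bsub>yob T x\<^esub> \<longleftrightarrow> N x +>\<^bsub>yob V x\<^esub> v = \<zero>\<^bsub>yob ?Q x\<^esub>"
      unfolding pv[OF v] using gf[OF c(1)] gf[OF c(2)] by metis
    then show ?thesis
      unfolding zero coset_eq_self_iff[OF VM N v] .
  qed
  ultimately show ?thesis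
    using T p by blast
qed

lemma cokernel_exists:
  fixes K :: "('k, 'c) ring_scheme" and V :: "('k, 'v) ymodule" and W :: "('k, 'w) ymodule"
  assumes W: "young_module K W" and V: "young_module K V" and f: "f \<in> yhom K W V"
  shows "\<exists>(Q :: ('k, 'v) ymodule) p. young_module K Q \<and> p \<in> yhom K V Q \<and> ysurj V Q p \<and>
    (\<forall>x. \<forall>v\<in>elts V x. p x v = \<zero>\<^bsub>yob Q x\<^esub> \<longleftrightarrow> v \<in> f x ` elts W x)"
proof (rule quotient_exists[OF V])
  show "submodule (f x ` elts W x) K (yob V x)" for x
    by (rule submodule_image[OF young_moduleD(1)[OF W] young_moduleD(1)[OF V] yhomD(1)[OF f]
          Module.module.carrier_is_submodule[OF young_moduleD(1)[OF W]]])
  fix x y v assume xy: "x \<le> y" and "v \<in> f x ` elts W x"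
  then obtain w where w: "w \<in> elts W x" "v = f x w"
    by blast
  then show "ytr V x y v \<in> f y ` elts W y"
    using ytr_closed[OF W xy w(1)] by (intro image_eqI[of _ _ "ytr W x y w"]) (simp_all add: yhomD(2)[OF f xy])
qed

lemma kernel_exists:
  fixes K :: "('k, 'c) ring_scheme" and V :: "('k, 'v) ymodule" and W :: "('k, 'w) ymodule"
  assumes V: "young_module K V" and W: "young_module K W" and f: "f \<in> yhom K V W"
  shows "\<exists>(N :: ('k, 'v) ymodule) i. young_module K N \<and> i \<in> yhom K N V \<and>
    (\<forall>x. inj_on (i x) (elts N x)) \<and>
    (\<forall>x. \<forall>v\<in>elts V x. f x v = \<zero>\<^bsub>yob W x\<^esub> \<longleftrightarrow> v \<in> i x ` elts N x)"
proof -
  let ?k = "\<lambda>x. a_kernel (yob V x) (yob W x) (f x)"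
  let ?N = "sub_ymodule V ?k"
  have k: "submodule (?k x) K (yob V x)" for x
    by (rule submodule_yhom_kernel[OF V W f])
  have N: "young_module K ?N"
    by (rule young_module_sub(1)[OF V k]) (rule yhom_kernel_stable[OF V W f])
  have i: "(\<lambda>x. restrict (\<lambda>v. v) (?k x)) \<in> yhom K ?N V"
    by (rule young_module_sub(2)[OF V k]) (rule yhom_kernel_stable[OF V W f])
  have c: "elts ?N x = ?k x" for x
    by (simp add: sub_ymodule_def)
  show ?thesis
    by (rule exI[of _ ?N], rule exI[of _ "\<lambda>x. restrict (\<lambda>v. v) (?k x)"])
      (simp add: N i c inj_on_def image_def mem_a_kernel)
qed

text \<open>The direct sum is formed on pairs and moved into \<open>'v\<close> along an injective
  pairing, which an infinite type possesses.\<close>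

lemma biproduct_exists:
  fixes K :: "('k, 'c) ring_scheme" and V W :: "('k, 'v) ymodule"
  assumes "infinite (UNIV :: 'v set)" and V: "young_module K V" and W: "young_module K W"
  shows "\<exists>(B :: ('k, 'v) ymodule) i j p q. young_module K B \<and>
    i \<in> yhom K V B \<and> j \<in> yhom K W B \<and> p \<in> yhom K B V \<and> q \<in> yhom K B W \<and>
    (\<forall>x. \<forall>v\<in>elts V x. p x (i x v) = v \<and> q x (i x v) = \<zero>\<^bsub>yob W x\<^esub>) \<and>
    (\<forall>x. \<forall>w\<in>elts W x. q x (j x w) = w \<and> p x (j x w) = \<zero>\<^bsub>yob V x\<^esub>) \<and>
    (\<forall>x. \<forall>b\<in>elts B x. i x (p x b) \<oplus>\<^bsub>yob B x\<^esub> j x (q x b) = b)"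
proof -
  interpret V: Module.module K "yob V x" for x
    by (rule young_moduleD(1)[OF V])
  interpret W: Module.module K "yob W x" for x
    by (rule young_moduleD(1)[OF W])
  define D :: "('k, 'v \<times> 'v) ymodule" where "D = \<lparr>yob = (\<lambda>x.
      \<lparr>carrier = elts V x \<times> elts W x, mult = undefined, one = undefined,
       zero = (\<zero>\<^bsub>yob V x\<^esub>, \<zero>\<^bsub>yob W x\<^esub>),
       add = (\<lambda>(v, w) (v', w'). (v \<oplus>\<^bsub>yob V x\<^esub> v', w \<oplus>\<^bsub>yob W x\<^esub> w')),
       smult = (\<lambda>a (v, w). (a \<odot>\<^bsub>yob V x\<^esub> v, a \<odot>\<^bsub>yob W x\<^esub> w))\<rparr>),
     ytr = (\<lambda>x y (v, w). (ytr V x y v, ytr W x y w))\<rparr>"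
  have [simp]: "elts D x = elts V x \<times> elts W x"
    "\<zero>\<^bsub>yob D x\<^esub> = (\<zero>\<^bsub>yob V x\<^esub>, \<zero>\<^bsub>yob W x\<^esub>)"
    "(v, w) \<oplus>\<^bsub>yob D x\<^esub> (v', w') = (v \<oplus>\<^bsub>yob V x\<^esub> v', w \<oplus>\<^bsub>yob W x\<^esub> w')"
    "a \<odot>\<^bsub>yob D x\<^esub> (v, w) = (a \<odot>\<^bsub>yob V x\<^esub> v, a \<odot>\<^bsub>yob W x\<^esub> w)"
    "ytr D x y (v, w) = (ytr V x y v, ytr W x y w)" for x y v w v' w' a
    by (simp_all add: D_def)
  have DM: "Module.module K (yob D x)" for x
  proof (rule moduleI)
    show "cring K" ..
    show "abelian_group (yob D x)"
    proof (rule abelian_groupI)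
      fix b assume "b \<in> elts D x"
      then obtain v w where "b = (v, w)" "v \<in> elts V x" "w \<in> elts W x"
        by auto
      then show "\<exists>b'\<in>elts D x. b' \<oplus>\<^bsub>yob D x\<^esub> b = \<zero>\<^bsub>yob D x\<^esub>"
        by (intro bexI[of _ "(\<ominus>\<^bsub>yob V x\<^esub> v, \<ominus>\<^bsub>yob W x\<^esub> w)"]) (simp_all add: V.l_neg W.l_neg)
    qed (auto simp: V.a_ac W.a_ac)
  qed (auto simp: V.smult_l_distr W.smult_l_distr V.smult_r_distr W.smult_r_distr
      V.smult_assoc1 W.smult_assoc1)
  have D: "young_module K D"
  proof (rule young_moduleI[OF DM])
    fix x y :: young assume xy: "x \<le> y"
    note lV = young_moduleD(2)[OF V xy] and lW = young_moduleD(2)[OF W xy]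
    show "linear_map K (yob D x) (yob D y) (ytr D x y)"
      by (rule linear_mapI)
        (auto simp: linear_map_closed[OF lV] linear_map_closed[OF lW] linear_map_add[OF lV]
          linear_map_add[OF lW] linear_map_smult[OF lV] linear_map_smult[OF lW])
  qed (auto simp: young_moduleD(3,4)[OF V] young_moduleD(3,4)[OF W])
  obtain \<pi> :: "'v \<times> 'v \<Rightarrow> 'v" where "inj \<pi>"
    using infinite_pairing[OF assms(1)] by blast
  then have "\<exists>\<phi> :: 'v \<times> 'v \<Rightarrow> 'v. inj_on \<phi> (elts D x)" for x
    using inj_on_subset[OF _ subset_UNIV] by blast
  from transport_ymodule[OF D this] obtain T :: "('k, 'v) ymodule" and f g where T: "young_module K T"
    and f: "f \<in> yhom K D T" and g: "g \<in> yhom K T D"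
    and gf: "\<And>x w. w \<in> elts D x \<Longrightarrow> g x (f x w) = w"
    and fg: "\<And>x t. t \<in> elts T x \<Longrightarrow> f x (g x t) = t"
    by metis
  have zV: "ytr V x y \<zero>\<^bsub>yob V x\<^esub> = \<zero>\<^bsub>yob V y\<^esub>" if "x \<le> y" for x y
    by (rule linear_map_zero[OF V.module_axioms V.module_axioms young_moduleD(2)[OF V that]])
  have zW: "ytr W x y \<zero>\<^bsub>yob W x\<^esub> = \<zero>\<^bsub>yob W y\<^esub>" if "x \<le> y" for x y
    by (rule linear_map_zero[OF W.module_axioms W.module_axioms young_moduleD(2)[OF W that]])
  define i j p q where "i = (\<lambda>x. \<lambda>v\<in>elts V x. f x (v, \<zero>\<^bsub>yob W x\<^esub>))"
    and "j = (\<lambda>x. \<lambda>w\<in>elts W x. f x (\<zero>\<^bsub>yob V x\<^esub>, w))"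
    and "p = (\<lambda>x. \<lambda>t\<in>elts T x. fst (g x t))"
    and "q = (\<lambda>x. \<lambda>t\<in>elts T x. snd (g x t))"
  have i: "i \<in> yhom K V T"
    unfolding i_def
  proof (rule yhom_restrictI[OF V])
    fix x
    have "linear_map K (yob V x) (yob D x) (\<lambda>v. (v, \<zero>\<^bsub>yob W x\<^esub>))"
      by (rule linear_mapI) auto
    then show "linear_map K (yob V x) (yob T x) (\<lambda>v. f x (v, \<zero>\<^bsub>yob W x\<^esub>))"
      by (rule linear_map_comp[OF _ yhomD(1)[OF f]])
  next
    fix x y v assume xy: "x \<le> y" and v: "v \<in> elts V x"
    show "f y (ytr V x y v, \<zero>\<^bsub>yob W y\<^esub>) = ytr T x y (f x (v, \<zero>\<^bsub>yob W x\<^esub>))"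
      using yhomD(2)[OF f xy, of "(v, \<zero>\<^bsub>yob W x\<^esub>)"] v by (simp add: zW[OF xy])
  qed
  have j: "j \<in> yhom K W T"
    unfolding j_def
  proof (rule yhom_restrictI[OF W])
    fix x
    have "linear_map K (yob W x) (yob D x) (\<lambda>w. (\<zero>\<^bsub>yob V x\<^esub>, w))"
      by (rule linear_mapI) auto
    then show "linear_map K (yob W x) (yob T x) (\<lambda>w. f x (\<zero>\<^bsub>yob V x\<^esub>, w))"
      by (rule linear_map_comp[OF _ yhomD(1)[OF f]])
  next
    fix x y w assume xy: "x \<le> y" and w: "w \<in> elts W x"
    show "f y (\<zero>\<^bsub>yob V y\<^esub>, ytr W x y w) = ytr T x y (f x (\<zero>\<^bsub>yob V x\<^esub>, w))"
      using yhomD(2)[OF f xy, of "(\<zero>\<^bsub>yob V x\<^esub>, w)"] w by (simp add: zV[OF xy])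
  qed
  have split: "g x t = (fst (g x t), snd (g x t))" "fst (g x t) \<in> elts V x" "snd (g x t) \<in> elts W x"
    if "t \<in> elts T x" for x t
    using yhom_closed[OF g that] by auto
  have p: "p \<in> yhom K T V"
    unfolding p_def
  proof (rule yhom_restrictI[OF T])
    fix x
    have "linear_map K (yob D x) (yob V x) fst"
      by (rule linear_mapI) auto
    then show "linear_map K (yob T x) (yob V x) (\<lambda>t. fst (g x t))"
      by (rule linear_map_comp[OF yhomD(1)[OF g]])
  next
    fix x y t assume xy: "x \<le> y" and t: "t \<in> elts T x"
    show "fst (g y (ytr T x y t)) = ytr V x y (fst (g x t))"
      unfolding yhomD(2)[OF g xy t] by (cases "g x t") simp
  qed
  have q: "q \<in> yhom K T W"
    unfolding q_def
  proof (rule yhom_restrictI[OF T])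
    fix x
    have "linear_map K (yob D x) (yob W x) snd"
      by (rule linear_mapI) auto
    then show "linear_map K (yob T x) (yob W x) (\<lambda>t. snd (g x t))"
      by (rule linear_map_comp[OF yhomD(1)[OF g]])
  next
    fix x y t assume xy: "x \<le> y" and t: "t \<in> elts T x"
    show "snd (g y (ytr T x y t)) = ytr W x y (snd (g x t))"
      unfolding yhomD(2)[OF g xy t] by (cases "g x t") simp
  qed
  have "p x (i x v) = v \<and> q x (i x v) = \<zero>\<^bsub>yob W x\<^esub>" if v: "v \<in> elts V x" for x v
  proof -
    have "(v, \<zero>\<^bsub>yob W x\<^esub>) \<in> elts D x"
      using v by simp
    from gf[OF this] yhom_closed[OF f this] show ?thesis
      using v by (simp add: p_def q_def i_def)
  qed
  moreover have "q x (j x w) = w \<and> p x (j x w) = \<zero>\<^bsub>yob V x\<^esub>" if w: "w \<in> elts W x" for x w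
  proof -
    have "(\<zero>\<^bsub>yob V x\<^esub>, w) \<in> elts D x"
      using w by simp
    from gf[OF this] yhom_closed[OF f this] show ?thesis
      using w by (simp add: p_def q_def j_def)
  qed
  moreover have "i x (p x t) \<oplus>\<^bsub>yob T x\<^esub> j x (q x t) = t" if t: "t \<in> elts T x" for x t
  proof -
    note s = split[OF t]
    have "i x (p x t) \<oplus>\<^bsub>yob T x\<^esub> j x (q x t)
        = f x (fst (g x t), \<zero>\<^bsub>yob W x\<^esub>) \<oplus>\<^bsub>yob T x\<^esub> f x (\<zero>\<^bsub>yob V x\<^esub>, snd (g x t))"
      using t s by (simp add: i_def j_def p_def q_def)
    also have "\<dots> = f x ((fst (g x t), \<zero>\<^bsub>yob W x\<^esub>) \<oplus>\<^bsub>yob D x\<^esub> (\<zero>\<^bsub>yob V x\<^esub>, snd (g x t)))"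
      using s by (intro yhom_add[OF f, symmetric]) auto
    also have "\<dots> = f x (g x t)"
      using s by (simp del: prod.collapse)
    also have "\<dots> = t"
      by (rule fg[OF t])
    finally show ?thesis .
  qed
  ultimately show ?thesis
    using T i j p q by blast
qed

subsection \<open>Closure properties of determined modules\<close>

text \<open>A diagram chase between the degrees x and \<open>inf x (hyperbola n)\<close>.
  Surjectivity for N combines surjectivity for V with injectivity for W: the vector found in V lies
  in the kernel of f already in the smaller degree.\<close>

lemma determined_by_kernel:
  assumes V: "young_module K V" and W: "young_module K W" and N: "young_module K N"
    and f: "f \<in> yhom K V W" and i: "i \<in> yhom K N V" and inj: "\<And>x. inj_on (i x) (elts N x)"
    and ker: "\<And>x v. v \<in> elts V x \<Longrightarrow> f x v = \<zero>\<^bsub>yob W x\<^esub> \<longleftrightarrow> v \<in> i x ` elts N x"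
    and dV: "determined_by n V" and dW: "determined_by n W"
  shows "determined_by n N"
proof (rule determined_byI[OF N])
  fix x u assume u: "u \<in> elts N x"
  let ?z = "inf x (hyperbola n)"
  have z: "?z \<le> x"
    by simp
  obtain v where v: "v \<in> elts V ?z" "ytr V ?z x v = i x u"
    by (rule determined_by_lift[OF dV yhom_closed[OF i u]])
  have "ytr W ?z x (f ?z v) = f x (i x u)"
    using v z by (simp add: yhomD(2)[OF f, symmetric])
  also have "\<dots> = \<zero>\<^bsub>yob W x\<^esub>"
    using u by (simp add: ker[OF yhom_closed[OF i u]])
  finally have "f ?z v = \<zero>\<^bsub>yob W ?z\<^esub>"
    by (rule determined_by_zero[OF W dW yhom_closed[OF f v(1)]])
  then obtain w where w: "w \<in> elts N ?z" "v = i ?z w"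
    using ker[OF v(1)] by auto
  have "i x (ytr N ?z x w) = i x u"
    using v(2) w(2) by (simp add: yhomD(2)[OF i z w(1)])
  then have "ytr N ?z x w = u"
    by (rule inj_onD[OF inj _ ytr_closed[OF N z w(1)] u])
  then show "u \<in> ytr N ?z x ` elts N ?z"
    using w(1) by blast
next
  fix x u
  let ?z = "inf x (hyperbola n)"
  assume u: "u \<in> elts N ?z" and u0: "ytr N ?z x u = \<zero>\<^bsub>yob N x\<^esub>"
  have z: "?z \<le> x"
    by simp
  note i0 = yhom_zero[OF N V i]
  have "ytr V ?z x (i ?z u) = \<zero>\<^bsub>yob V x\<^esub>"
    unfolding yhomD(2)[OF i z u, symmetric] u0 by (rule i0)
  then have "i ?z u = i ?z \<zero>\<^bsub>yob N ?z\<^esub>"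
    unfolding i0 by (rule determined_by_zero[OF V dV yhom_closed[OF i u]])
  then show "u = \<zero>\<^bsub>yob N ?z\<^esub>"
    by (rule inj_onD[OF inj _ u submodule_zero_mem[OF Module.module.carrier_is_submodule[OF young_moduleD(1)[OF N]]]])
qed

text \<open>The dual chase. Injectivity for Q combines surjectivity for V with injectivity for W: a
  vector of W that becomes an image under f at x is one already in the smaller degree.\<close>

lemma determined_by_cokernel:
  assumes V: "young_module K V" and W: "young_module K W" and Q: "young_module K Q"
    and f: "f \<in> yhom K V W" and p: "p \<in> yhom K W Q" "ysurj W Q p"
    and ker: "\<And>x w. w \<in> elts W x \<Longrightarrow> p x w = \<zero>\<^bsub>yob Q x\<^esub> \<longleftrightarrow> w \<in> f x ` elts V x"
    and dV: "determined_by n V" and dW: "determined_by n W"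
  shows "determined_by n Q"
proof (rule determined_byI[OF Q])
  fix x q assume q: "q \<in> elts Q x"
  let ?z = "inf x (hyperbola n)"
  have z: "?z \<le> x"
    by simp
  obtain w where w: "w \<in> elts W x" "p x w = q"
    by (rule ysurjD[OF p(2) q])
  obtain w0 where w0: "w0 \<in> elts W ?z" "ytr W ?z x w0 = w"
    by (rule determined_by_lift[OF dW w(1)])
  have "ytr Q ?z x (p ?z w0) = q"
    using w w0 by (simp add: yhomD(2)[OF p(1) z w0(1), symmetric])
  then show "q \<in> ytr Q ?z x ` elts Q ?z"
    using yhom_closed[OF p(1) w0(1)] by blast
next
  fix x q
  let ?z = "inf x (hyperbola n)"
  assume q: "q \<in> elts Q ?z" and q0: "ytr Q ?z x q = \<zero>\<^bsub>yob Q x\<^esub>"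
  have z: "?z \<le> x"
    by simp
  obtain w where w: "w \<in> elts W ?z" "p ?z w = q"
    by (rule ysurjD[OF p(2) q])
  have "p x (ytr W ?z x w) = \<zero>\<^bsub>yob Q x\<^esub>"
    using q0 w by (simp add: yhomD(2)[OF p(1) z w(1)])
  then obtain v where v: "v \<in> elts V x" "ytr W ?z x w = f x v"
    using ker[OF ytr_closed[OF W z w(1)]] by auto
  obtain v0 where v0: "v0 \<in> elts V ?z" "ytr V ?z x v0 = v"
    by (rule determined_by_lift[OF dV v(1)])
  have fv: "f ?z v0 \<in> elts W ?z"
    by (rule yhom_closed[OF f v0(1)])
  have "ytr W ?z x w = ytr W ?z x (f ?z v0)"
    using v v0 by (simp add: yhomD(2)[OF f z v0(1), symmetric])
  moreover have "inj_on (ytr W ?z x) (elts W ?z)"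
    using dW by (simp add: determined_by_def bij_betw_def)
  ultimately have "w = f ?z v0"
    using w(1) fv by (simp add: inj_on_def)
  then show "q = \<zero>\<^bsub>yob Q ?z\<^esub>"
    using ker[OF w(1)] v0(1) w(2) by simp
qed

lemma determined_by_biproduct:
  assumes V: "young_module K V" and W: "young_module K W" and B: "young_module K B"
    and i: "i \<in> yhom K V B" and j: "j \<in> yhom K W B" and p: "p \<in> yhom K B V" and q: "q \<in> yhom K B W"
    and dec: "\<And>x b. b \<in> elts B x \<Longrightarrow> i x (p x b) \<oplus>\<^bsub>yob B x\<^esub> j x (q x b) = b"
    and dV: "determined_by n V" and dW: "determined_by n W"
  shows "determined_by n B"
proof (rule determined_byI[OF B])
  interpret B: Module.module K "yob B x" for x
    by (rule young_moduleD(1)[OF B])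
  fix x
  let ?z = "inf x (hyperbola n)"
  have z: "?z \<le> x"
    by simp
  show "b \<in> ytr B ?z x ` elts B ?z" if b: "b \<in> elts B x" for b
  proof -
    obtain v where v: "v \<in> elts V ?z" "ytr V ?z x v = p x b"
      by (rule determined_by_lift[OF dV yhom_closed[OF p b]])
    obtain w where w: "w \<in> elts W ?z" "ytr W ?z x w = q x b"
      by (rule determined_by_lift[OF dW yhom_closed[OF q b]])
    have c: "i ?z v \<in> elts B ?z" "j ?z w \<in> elts B ?z"
      by (rule yhom_closed[OF i v(1)], rule yhom_closed[OF j w(1)])
    have "ytr B ?z x (i ?z v \<oplus>\<^bsub>yob B ?z\<^esub> j ?z w) = i x (p x b) \<oplus>\<^bsub>yob B x\<^esub> j x (q x b)"
      using v(2) w(2) by (simp add: ytr_add[OF B z c]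
          yhomD(2)[OF i z v(1), symmetric] yhomD(2)[OF j z w(1), symmetric])
    then have "b = ytr B ?z x (i ?z v \<oplus>\<^bsub>yob B ?z\<^esub> j ?z w)"
      by (simp add: dec[OF b])
    then show ?thesis
      by (rule image_eqI) (simp add: c)
  qed
  fix b assume b: "b \<in> elts B ?z" and b0: "ytr B ?z x b = \<zero>\<^bsub>yob B x\<^esub>"
  have "ytr V ?z x (p ?z b) = \<zero>\<^bsub>yob V x\<^esub>"
    unfolding yhomD(2)[OF p z b, symmetric] b0
    by (rule linear_map_zero[OF B.module_axioms young_moduleD(1)[OF V] yhomD(1)[OF p]])
  then have pb: "p ?z b = \<zero>\<^bsub>yob V ?z\<^esub>"
    by (rule determined_by_zero[OF V dV yhom_closed[OF p b]])
  have "ytr W ?z x (q ?z b) = \<zero>\<^bsub>yob W x\<^esub>"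
    unfolding yhomD(2)[OF q z b, symmetric] b0
    by (rule linear_map_zero[OF B.module_axioms young_moduleD(1)[OF W] yhomD(1)[OF q]])
  then have qb: "q ?z b = \<zero>\<^bsub>yob W ?z\<^esub>"
    by (rule determined_by_zero[OF W dW yhom_closed[OF q b]])
  show "b = \<zero>\<^bsub>yob B ?z\<^esub>"
    using dec[OF b] linear_map_zero[OF young_moduleD(1)[OF V] B.module_axioms yhomD(1)[OF i], of ?z]
      linear_map_zero[OF young_moduleD(1)[OF W] B.module_axioms yhomD(1)[OF j], of ?z]
    by (simp add: pb qb)
qed

lemma zero_ymodule_exists:
  fixes K :: "('k, 'c) ring_scheme"
  assumes "cring K"
  shows "\<exists>Z :: ('k, 'v) ymodule. young_module K Z \<and> determined_by n Z \<and>
    (\<forall>x. elts Z x = {\<zero>\<^bsub>yob Z x\<^esub>})"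
proof -
  define Z :: "('k, 'v) ymodule" where "Z = \<lparr>yob = (\<lambda>x. \<lparr>carrier = {undefined}, mult = undefined,
    one = undefined, zero = undefined, add = (\<lambda>_ _. undefined), smult = (\<lambda>_ _. undefined)\<rparr>),
    ytr = (\<lambda>_ _ v. v)\<rparr>"
  have [simp]: "elts Z x = {undefined}" "\<zero>\<^bsub>yob Z x\<^esub> = undefined"
    "v \<oplus>\<^bsub>yob Z x\<^esub> w = undefined" "a \<odot>\<^bsub>yob Z x\<^esub> v = undefined" "ytr Z x y v = v" for x y v w a
    by (simp_all add: Z_def)
  have "abelian_group (yob Z x)" for x
    by (rule abelian_groupI) auto
  then have "Module.module K (yob Z x)" for x
    using assms by (intro moduleI) auto
  then have "young_module K Z"
    by (intro young_moduleI linear_mapI) auto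
  moreover have "determined_by n Z"
    by (simp add: determined_by_def bij_betw_def)
  ultimately show ?thesis
    by (intro exI[of _ Z]) simp
qed

subsection \<open>The full subcategory\<close>

context
  fixes K :: "('k, 'c) ring_scheme" and S :: "('k, 'v) ymodule \<Rightarrow> bool"
    and C :: "(('k, 'v) ymodule, young \<Rightarrow> 'v \<Rightarrow> 'v) preadd_cat"
  assumes C: "C = full_subcategory (YMod K) S"
begin

lemma category_simps:
  "cobj C = {V. young_module K V \<and> S V}" "chom C = yhom K"
  "cid C = (\<lambda>V x. \<lambda>v\<in>elts V x. v)"
  "ccomp C = (\<lambda>U V W g f x. compose (elts U x) (g x) (f x))"
  "czero C = (\<lambda>V W x. \<lambda>v\<in>elts V x. \<zero>\<^bsub>yob W x\<^esub>)"
  "cplus C = (\<lambda>V W f g x. \<lambda>v\<in>elts V x. f x v \<oplus>\<^bsub>yob W x\<^esub> g x v)"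
  by (auto simp: C full_subcategory_def YMod_def)

lemma preadditive: "preadditive_category C"
proof (rule preadditive_category.intro)
  fix V assume "V \<in> cobj C"
  then show "cid C V \<in> chom C V V"
    by (simp add: category_simps yhom_id)
next
  fix U V W f g assume "U \<in> cobj C" "V \<in> cobj C" "W \<in> cobj C" "f \<in> chom C U V" "g \<in> chom C V W"
  then show "ccomp C U V W g f \<in> chom C U W"
    by (simp add: category_simps yhom_comp)
next
  fix V W f assume V: "V \<in> cobj C" and W: "W \<in> cobj C" and f: "f \<in> chom C V W"
  then have f': "f \<in> yhom K V W" and V': "young_module K V" and W': "young_module K W"
    by (simp_all add: category_simps)
  have "(\<lambda>x. compose (elts V x) (f x) (\<lambda>v\<in>elts V x. v)) = f"
    by (rule yhom_eqI[OF yhom_comp[OF yhom_id[OF V'] f' V'] f']) (simp add: compose_eq)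
  then show "ccomp C V V W f (cid C V) = f"
    by (simp add: category_simps)
  have "(\<lambda>x. compose (elts V x) (\<lambda>w\<in>elts W x. w) (f x)) = f"
    by (rule yhom_eqI[OF yhom_comp[OF f' yhom_id[OF W'] V'] f']) (simp add: compose_eq yhom_closed[OF f'])
  then show "ccomp C V W W (cid C W) f = f"
    by (simp add: category_simps)
next
  fix T U V W f g h
  assume "T \<in> cobj C" "U \<in> cobj C" "V \<in> cobj C" "W \<in> cobj C"
    and f: "f \<in> chom C T U" and "g \<in> chom C U V" "h \<in> chom C V W"
  then show "ccomp C T V W h (ccomp C T U V g f) = ccomp C T U W (ccomp C U V W h g) f"
    by (auto simp: category_simps compose_def restrict_def fun_eq_iff yhom_closed)
next
  fix V W assume "V \<in> cobj C" "W \<in> cobj C"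
  then show "comm_group \<lparr>carrier = chom C V W, mult = cplus C V W, one = czero C V W\<rparr>"
    by (simp add: category_simps yhom_comm_group)
next
  fix U V W f f' g assume "U \<in> cobj C" "V \<in> cobj C" "W \<in> cobj C"
    and "f \<in> chom C U V" "f' \<in> chom C U V" "g \<in> chom C V W"
  then show "ccomp C U V W g (cplus C U V f f') = cplus C U W (ccomp C U V W g f) (ccomp C U V W g f')"
    by (auto simp: category_simps compose_def restrict_def fun_eq_iff yhom_closed
        linear_map_add[OF yhomD(1)])
next
  fix U V W f g g' assume "U \<in> cobj C" "V \<in> cobj C" "W \<in> cobj C"
    and "f \<in> chom C U V" "g \<in> chom C V W" "g' \<in> chom C V W"
  then show "ccomp C U V W (cplus C V W g g') f = cplus C U W (ccomp C U V W g f) (ccomp C U V W g' f)"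
    by (auto simp: category_simps compose_def restrict_def fun_eq_iff yhom_closed)
qed

text \<open>Degreewise injectivity and exactness give the universal property against all Young
  modules, hence in every full subcategory that contains V, W and N.\<close>

lemma is_kernelI:
  assumes V: "V \<in> cobj C" and W: "W \<in> cobj C" and N: "N \<in> cobj C"
    and f: "f \<in> yhom K V W" and i: "i \<in> yhom K N V" and inj: "\<And>x. inj_on (i x) (elts N x)"
    and ker: "\<And>x v. v \<in> elts V x \<Longrightarrow> f x v = \<zero>\<^bsub>yob W x\<^esub> \<longleftrightarrow> v \<in> i x ` elts N x"
  shows "is_kernel C V W f N i"
  unfolding is_kernel_def
proof (intro conjI ballI impI)
  have V': "young_module K V" and W': "young_module K W" and N': "young_module K N"
    using V W N by (simp_all add: category_simps)
  show "N \<in> cobj C" "i \<in> chom C N V"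
    using N i by (simp_all add: category_simps)
  have "(\<lambda>x. compose (elts N x) (f x) (i x)) = (\<lambda>x. \<lambda>v\<in>elts N x. \<zero>\<^bsub>yob W x\<^esub>)"
  proof (rule yhom_eqI[OF yhom_comp[OF i f N'] yhom_zero_map[OF N' W']])
    fix x v assume v: "v \<in> elts N x"
    then show "compose (elts N x) (f x) (i x) v = (\<lambda>v\<in>elts N x. \<zero>\<^bsub>yob W x\<^esub>) v"
      using ker[OF yhom_closed[OF i v]] by (simp add: compose_eq)
  qed
  then show "ccomp C N V W f i = czero C N W"
    by (simp add: category_simps)
  fix T t assume "T \<in> cobj C" "t \<in> chom C T V" and eq: "ccomp C T V W f t = czero C T W"
  then have T: "young_module K T" and t: "t \<in> yhom K T V"
    by (simp_all add: category_simps)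
  have "t x v \<in> i x ` elts N x" if v: "v \<in> elts T x" for x v
  proof -
    have "f x (t x v) = \<zero>\<^bsub>yob W x\<^esub>"
      using fun_cong[OF fun_cong[OF eq], of x v] v by (simp add: category_simps compose_eq)
    then show ?thesis
      using ker[OF yhom_closed[OF t v]] by simp
  qed
  from yhom_factor_inj[OF N' V' T i inj t this] obtain u where u: "u \<in> yhom K T N"
    and iu: "\<And>x v. v \<in> elts T x \<Longrightarrow> i x (u x v) = t x v"
    by blast
  show "\<exists>!u. u \<in> chom C T N \<and> ccomp C T N V i u = t"
  proof (rule ex1I[of _ u])
    have "(\<lambda>x. compose (elts T x) (i x) (u x)) = t"
      by (rule yhom_eqI[OF yhom_comp[OF u i T] t]) (simp add: compose_eq iu)
    then show "u \<in> chom C T N \<and> ccomp C T N V i u = t"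
      using u by (simp add: category_simps)
    fix u' assume "u' \<in> chom C T N \<and> ccomp C T N V i u' = t"
    then have u': "u' \<in> yhom K T N" and iu': "(\<lambda>x. compose (elts T x) (i x) (u' x)) = t"
      by (simp_all add: category_simps)
    show "u' = u"
    proof (rule yhom_eqI[OF u' u])
      fix x v assume v: "v \<in> elts T x"
      have "i x (u' x v) = i x (u x v)"
        using fun_cong[OF fun_cong[OF iu'], of x v] v iu by (simp add: compose_eq)
      then show "u' x v = u x v"
        by (rule inj_onD[OF inj _ yhom_closed[OF u' v] yhom_closed[OF u v]])
    qed
  qed
qed

lemma is_cokernelI:
  assumes V: "V \<in> cobj C" and W: "W \<in> cobj C" and Q: "Q \<in> cobj C"
    and f: "f \<in> yhom K V W" and p: "p \<in> yhom K W Q" "ysurj W Q p"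
    and ker: "\<And>x w. w \<in> elts W x \<Longrightarrow> p x w = \<zero>\<^bsub>yob Q x\<^esub> \<longleftrightarrow> w \<in> f x ` elts V x"
  shows "is_cokernel C V W f Q p"
  unfolding is_cokernel_def
proof (intro conjI ballI impI)
  have V': "young_module K V" and W': "young_module K W" and Q': "young_module K Q"
    using V W Q by (simp_all add: category_simps)
  show "Q \<in> cobj C" "p \<in> chom C W Q"
    using Q p by (simp_all add: category_simps)
  have "(\<lambda>x. compose (elts V x) (p x) (f x)) = (\<lambda>x. \<lambda>v\<in>elts V x. \<zero>\<^bsub>yob Q x\<^esub>)"
  proof (rule yhom_eqI[OF yhom_comp[OF f p(1) V'] yhom_zero_map[OF V' Q']])
    fix x v assume v: "v \<in> elts V x"
    then show "compose (elts V x) (p x) (f x) v = (\<lambda>v\<in>elts V x. \<zero>\<^bsub>yob Q x\<^esub>) v"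
      using ker[OF yhom_closed[OF f v]] by (simp add: compose_eq)
  qed
  then show "ccomp C V W Q p f = czero C V Q"
    by (simp add: category_simps)
  fix T t assume "T \<in> cobj C" "t \<in> chom C W T" and eq: "ccomp C V W T t f = czero C V T"
  then have T: "young_module K T" and t: "t \<in> yhom K W T"
    by (simp_all add: category_simps)
  have kert: "t x w = \<zero>\<^bsub>yob T x\<^esub>" if w: "w \<in> elts W x" "p x w = \<zero>\<^bsub>yob Q x\<^esub>" for x w
  proof -
    obtain v where v: "v \<in> elts V x" "w = f x v"
      using ker[OF w(1)] w(2) by auto
    then show ?thesis
      using fun_cong[OF fun_cong[OF eq], of x v] by (simp add: category_simps compose_eq)
  qed
  have "\<exists>u\<in>yhom K Q T. \<forall>x. \<forall>w\<in>elts W x. u x (p x w) = t x w"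
    by (rule yhom_factor_surj[OF W' Q' T p t]) (rule kert)
  then obtain u where u: "u \<in> yhom K Q T"
    and up: "\<And>x w. w \<in> elts W x \<Longrightarrow> u x (p x w) = t x w"
    by blast
  show "\<exists>!u. u \<in> chom C Q T \<and> ccomp C W Q T u p = t"
  proof (rule ex1I[of _ u])
    have "(\<lambda>x. compose (elts W x) (u x) (p x)) = t"
      by (rule yhom_eqI[OF yhom_comp[OF p(1) u W'] t]) (simp add: compose_eq up)
    then show "u \<in> chom C Q T \<and> ccomp C W Q T u p = t"
      using u by (simp add: category_simps)
    fix u' assume "u' \<in> chom C Q T \<and> ccomp C W Q T u' p = t"
    then have u': "u' \<in> yhom K Q T" and up': "(\<lambda>x. compose (elts W x) (u' x) (p x)) = t"
      by (simp_all add: category_simps)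
    show "u' = u"
    proof (rule yhom_eqI[OF u' u])
      fix x q assume "q \<in> elts Q x"
      then obtain w where w: "w \<in> elts W x" "p x w = q"
        by (rule ysurjD[OF p(2)])
      show "u' x q = u x q"
        using fun_cong[OF fun_cong[OF up'], of x w] w up[OF w(1)] by (simp add: compose_eq)
    qed
  qed
qed

text \<open>Degreewise kernels and cokernels stay in the subcategory, so monics and epics may be
  tested against them. This makes monics degreewise injective and epics degreewise surjective, and
  degreewise exactness exhibits them as a kernel of their cokernel and a cokernel of their
  kernel.\<close>

lemma abelian_if_determined:
  assumes K: "cring K" and inf: "infinite (UNIV :: 'v set)"
    and S: "\<And>V. young_module K V \<Longrightarrow> S V \<longleftrightarrow> (\<exists>n. determined_by n V)"
  shows "abelian_category C"
proof -
  interpret preadditive_category C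
    by (rule preadditive)
  have obj: "V \<in> cobj C \<longleftrightarrow> young_module K V \<and> (\<exists>n. determined_by n V)" for V
    using S by (auto simp: category_simps)
  \<comment> \<open>The closure properties speak of one bound for both modules; the maximum of the
    two bounds serves.\<close>
  have common: "\<exists>n. determined_by n V \<and> determined_by n W" if VW: "V \<in> cobj C" "W \<in> cobj C" for V W
  proof -
    obtain m n where "determined_by m V" "determined_by n W"
      using VW obj by blast
    then have "determined_by (max m n) V" "determined_by (max m n) W"
      using VW obj determined_by_mono by (meson max.cobounded1 max.cobounded2)+
    then show ?thesis
      by blast
  qed
  have kernels: "\<exists>N i. N \<in> cobj C \<and> i \<in> yhom K N V \<and> (\<forall>x. inj_on (i x) (elts N x)) \<and>
      (\<forall>x. \<forall>v\<in>elts V x. f x v = \<zero>\<^bsub>yob W x\<^esub> \<longleftrightarrow> v \<in> i x ` elts N x)"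
    if V: "V \<in> cobj C" and W: "W \<in> cobj C" and f: "f \<in> chom C V W" for V W f
  proof -
    have V': "young_module K V" and W': "young_module K W" and f': "f \<in> yhom K V W"
      using V W f by (simp_all add: category_simps)
    obtain n where n: "determined_by n V" "determined_by n W"
      using common[OF V W] by blast
    obtain N :: "('k, 'v) ymodule" and i where N: "young_module K N" and i: "i \<in> yhom K N V"
      and inj: "\<forall>x. inj_on (i x) (elts N x)"
      and ker: "\<forall>x. \<forall>v\<in>elts V x. f x v = \<zero>\<^bsub>yob W x\<^esub> \<longleftrightarrow> v \<in> i x ` elts N x"
      using kernel_exists[OF V' W' f'] by (elim exE conjE)
    have "determined_by n N"
      by (rule determined_by_kernel[OF V' W' N f' i _ _ n]) (use inj ker in blast)+
    then show ?thesis
      using N i inj ker unfolding obj by (intro exI[of _ N] exI[of _ i]) auto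
  qed
  have cokernels: "\<exists>Q p. Q \<in> cobj C \<and> p \<in> yhom K W Q \<and> ysurj W Q p \<and>
      (\<forall>x. \<forall>w\<in>elts W x. p x w = \<zero>\<^bsub>yob Q x\<^esub> \<longleftrightarrow> w \<in> f x ` elts V x)"
    if V: "V \<in> cobj C" and W: "W \<in> cobj C" and f: "f \<in> chom C V W" for V W f
  proof -
    have V': "young_module K V" and W': "young_module K W" and f': "f \<in> yhom K V W"
      using V W f by (simp_all add: category_simps)
    obtain n where n: "determined_by n V" "determined_by n W"
      using common[OF V W] by blast
    obtain Q :: "('k, 'v) ymodule" and p where Q: "young_module K Q" and p: "p \<in> yhom K W Q" "ysurj W Q p"
      and ker: "\<forall>x. \<forall>w\<in>elts W x. p x w = \<zero>\<^bsub>yob Q x\<^esub> \<longleftrightarrow> w \<in> f x ` elts V x"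
      using cokernel_exists[OF V' W' f'] by (elim exE conjE)
    have "determined_by n Q"
      by (rule determined_by_cokernel[OF V' W' Q f' p _ n]) (use ker in blast)
    then show ?thesis
      using Q p ker unfolding obj by (intro exI[of _ Q] exI[of _ p]) auto
  qed
  have zero_closed: "czero C V W \<in> chom C V W" if "V \<in> cobj C" "W \<in> cobj C" for V W
    using that by (simp add: category_simps yhom_zero_map)
  show ?thesis
  proof
    obtain Z :: "('k, 'v) ymodule" where Z: "young_module K Z" "determined_by 0 Z"
      and Z0: "\<forall>x. elts Z x = {\<zero>\<^bsub>yob Z x\<^esub>}"
      using zero_ymodule_exists[OF K, of 0] by (elim exE conjE)
    have "(\<exists>!f. f \<in> chom C V Z) \<and> (\<exists>!f. f \<in> chom C Z V)" if V: "V \<in> cobj C" for V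
    proof
      have V': "young_module K V"
        using V obj by blast
      show "\<exists>!f. f \<in> chom C V Z"
        unfolding category_simps(2)
      proof (rule ex1I)
        show "(\<lambda>x. \<lambda>v\<in>elts V x. \<zero>\<^bsub>yob Z x\<^esub>) \<in> yhom K V Z"
          by (rule yhom_zero_map[OF V' Z(1)])
        fix f assume f: "f \<in> yhom K V Z"
        show "f = (\<lambda>x. \<lambda>v\<in>elts V x. \<zero>\<^bsub>yob Z x\<^esub>)"
        proof (rule yhom_eqI[OF f yhom_zero_map[OF V' Z(1)]])
          fix x v assume v: "v \<in> elts V x"
          show "f x v = (\<lambda>v\<in>elts V x. \<zero>\<^bsub>yob Z x\<^esub>) v"
            using yhom_closed[OF f v] Z0 v by simp
        qed
      qed
      show "\<exists>!f. f \<in> chom C Z V"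
        unfolding category_simps(2)
      proof (rule ex1I)
        show "(\<lambda>x. \<lambda>v\<in>elts Z x. \<zero>\<^bsub>yob V x\<^esub>) \<in> yhom K Z V"
          by (rule yhom_zero_map[OF Z(1) V'])
        fix f assume f: "f \<in> yhom K Z V"
        show "f = (\<lambda>x. \<lambda>v\<in>elts Z x. \<zero>\<^bsub>yob V x\<^esub>)"
        proof (rule yhom_eqI[OF f yhom_zero_map[OF Z(1) V']])
          fix x v assume v: "v \<in> elts Z x"
          then have "v = \<zero>\<^bsub>yob Z x\<^esub>"
            using Z0 by simp
          then show "f x v = (\<lambda>v\<in>elts Z x. \<zero>\<^bsub>yob V x\<^esub>) v"
            using v linear_map_zero[OF young_moduleD(1)[OF Z(1)] young_moduleD(1)[OF V'] yhomD(1)[OF f]]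
            by simp
        qed
      qed
    qed
    then have "is_zero_object C Z"
      using Z obj unfolding is_zero_object_def by blast
    then show "\<exists>Z. is_zero_object C Z" ..
  next
    fix V W assume V: "V \<in> cobj C" and W: "W \<in> cobj C"
    then have V': "young_module K V" and W': "young_module K W"
      by (simp_all add: category_simps)
    obtain n where n: "determined_by n V" "determined_by n W"
      using common[OF V W] by blast
    obtain B :: "('k, 'v) ymodule" and i j p q where B: "young_module K B"
      and i: "i \<in> yhom K V B" and j: "j \<in> yhom K W B" and p: "p \<in> yhom K B V" and q: "q \<in> yhom K B W"
      and e1: "\<forall>x. \<forall>v\<in>elts V x. p x (i x v) = v \<and> q x (i x v) = \<zero>\<^bsub>yob W x\<^esub>"
      and e2: "\<forall>x. \<forall>w\<in>elts W x. q x (j x w) = w \<and> p x (j x w) = \<zero>\<^bsub>yob V x\<^esub>"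
      and e3: "\<forall>x. \<forall>b\<in>elts B x. i x (p x b) \<oplus>\<^bsub>yob B x\<^esub> j x (q x b) = b"
      using biproduct_exists[OF inf V' W'] by (elim exE conjE)
    have "determined_by n B"
      by (rule determined_by_biproduct[OF V' W' B i j p q _ n]) (use e3 in blast)
    then have "B \<in> cobj C"
      using B obj by blast
    then have "is_biproduct C V W B i j p q"
      unfolding is_biproduct_def
      using i j p q e1 e2 e3
      by (auto simp: category_simps compose_def restrict_def fun_eq_iff)
    then show "\<exists>B i j p q. is_biproduct C V W B i j p q"
      by (intro exI)
  next
    fix V W f assume V: "V \<in> cobj C" and W: "W \<in> cobj C" and f: "f \<in> chom C V W"
    have f': "f \<in> yhom K V W" and V': "young_module K V" and W': "young_module K W"
      using f V W by (simp_all add: category_simps)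
    obtain N i where N: "N \<in> cobj C" and i: "i \<in> yhom K N V" and inj: "\<forall>x. inj_on (i x) (elts N x)"
      and ker: "\<forall>x. \<forall>v\<in>elts V x. f x v = \<zero>\<^bsub>yob W x\<^esub> \<longleftrightarrow> v \<in> i x ` elts N x"
      using kernels[OF V W f] by (elim exE conjE)
    obtain Q p where Q: "Q \<in> cobj C" and p: "p \<in> yhom K W Q" "ysurj W Q p"
      and coker: "\<forall>x. \<forall>w\<in>elts W x. p x w = \<zero>\<^bsub>yob Q x\<^esub> \<longleftrightarrow> w \<in> f x ` elts V x"
      using cokernels[OF V W f] by (elim exE conjE)
    have N': "young_module K N" and Q': "young_module K Q"
      using N Q by (simp_all add: category_simps)
    have is_ker: "is_kernel C V W f N i"
      by (rule is_kernelI[OF V W N f' i]) (use inj ker in blast)+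
    then show "\<exists>N i. is_kernel C V W f N i"
      by (intro exI)
    have is_coker: "is_cokernel C V W f Q p"
      by (rule is_cokernelI[OF V W Q f' p]) (use coker in blast)
    then show "\<exists>Q p. is_cokernel C V W f Q p"
      by (intro exI)
    show "\<exists>Z\<in>cobj C. \<exists>g\<in>chom C W Z. is_kernel C W Z g V f" if monic: "is_monic C V W f"
    proof -
      \<comment> \<open>Both the kernel inclusion i and the zero map become 0 after f. As N is an
        object of the subcategory, monicity forces i = 0, so f has trivial kernel in each
        degree.\<close>
      have ext: "ccomp C N V W f i = ccomp C N V W f (czero C N V)"
        using is_ker linear_map_zero[OF young_moduleD(1)[OF V'] young_moduleD(1)[OF W'] yhomD(1)[OF f']]
          submodule_zero_mem[OF Module.module.carrier_is_submodule[OF young_moduleD(1)[OF V']]]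
        by (auto simp: is_kernel_def category_simps compose_def restrict_def fun_eq_iff)
      have "i = czero C N V"
        using monic N ext i zero_closed[OF N V] unfolding is_monic_def category_simps(2) by blast
      then have i0: "i x u = \<zero>\<^bsub>yob V x\<^esub>" if "u \<in> elts N x" for x u
        using that by (simp add: category_simps)
      have injf: "inj_on (f x) (elts V x)" for x
      proof (rule linear_map_inj_onI[OF young_moduleD(1)[OF V'] young_moduleD(1)[OF W'] yhomD(1)[OF f']])
        fix v assume "v \<in> elts V x" "f x v = \<zero>\<^bsub>yob W x\<^esub>"
        then have "v \<in> i x ` elts N x"
          using ker by simp
        then show "v = \<zero>\<^bsub>yob V x\<^esub>"
          using i0 by auto
      qed
      have "is_kernel C W Q p V f"
        by (rule is_kernelI[OF W Q V p(1) f' injf]) (use coker in blast)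
      then show ?thesis
        using Q p(1) by (auto simp: category_simps(2))
    qed
    show "\<exists>Z\<in>cobj C. \<exists>g\<in>chom C Z V. is_cokernel C Z V g W f" if epic: "is_epic C V W f"
    proof -
      \<comment> \<open>Dually, the cokernel projection p and the zero map agree after f, so p = 0
        and each vector of W is an image under f.\<close>
      have ext: "ccomp C V W Q p f = ccomp C V W Q (czero C W Q) f"
        using is_coker yhom_closed[OF f']
        by (auto simp: is_cokernel_def category_simps compose_def restrict_def fun_eq_iff)
      have "p = czero C W Q"
        using epic Q ext p(1) zero_closed[OF W Q] unfolding is_epic_def category_simps(2) by blast
      then have p0: "p x w = \<zero>\<^bsub>yob Q x\<^esub>" if "w \<in> elts W x" for x w
        using that by (simp add: category_simps)
      have "ysurj V W f"
        unfolding ysurj_def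
      proof (intro allI equalityI subsetI)
        fix x w assume "w \<in> elts W x"
        then show "w \<in> f x ` elts V x"
          using coker p0 by blast
      qed (auto simp: yhom_closed[OF f'])
      then have "is_cokernel C N V i W f"
        by (rule is_cokernelI[OF N V W i f']) (use ker in blast)
      then show ?thesis
        using N i by (auto simp: category_simps(2))
    qed
  qed
qed

end

theorem theorem1p3:
  fixes K :: "('k, 'c) ring_scheme"
  assumes "field K"
    and "infinite (UNIV :: 'v set)"
  shows "(\<forall>(V :: ('k, 'v) ymodule) s.
            young_module K V \<longrightarrow> s \<ge> 2 \<longrightarrow> hdeg K (s - 1) V > 0 \<longrightarrow>
            hdeg K s V \<le> hdeg K (s - 1) V * (ln_ereal (hdeg K (s - 1) V) + 1))
       \<and> abelian_category
           (full_subcategory (YMod K :: (('k, 'v) ymodule, young \<Rightarrow> 'v \<Rightarrow> 'v) preadd_cat)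
              (presented_in_finite_degrees K))"
proof (intro conjI allI impI)
  fix V :: "('k, 'v) ymodule" and s :: nat
  assume "young_module K V" "s \<ge> 2" "hdeg K (s - 1) V > 0"
  then show "hdeg K s V \<le> hdeg K (s - 1) V * (ln_ereal (hdeg K (s - 1) V) + 1)"
    by (rule hdeg_bound[OF assms])
next
  interpret K: field K
    by (rule assms(1))
  show "abelian_category (full_subcategory (YMod K :: (('k, 'v) ymodule, young \<Rightarrow> 'v \<Rightarrow> 'v) preadd_cat)
      (presented_in_finite_degrees K))"
    by (rule abelian_if_determined[OF refl K.is_cring assms(2)])
      (rule presented_in_finite_degrees_iff[OF assms])
qed

end
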